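(* Let $\mathfrak C=\{P(x,y)=0\}\subset\mathbb C^2$ be an irreducible and nondegenerate affine curve (of positive degrees $d_x$ in $x$ and $d_y$ in $y$), and let $\mathcal S=(\tilde C,x,\omega_{0,1},\omega_{0,2})$ be a compact spectral curve associated to $\mathfrak C$ (for some fundamental bidifferential $\omega_{0,2}$ on $\tilde C$). Then $\mathcal S$ is globally admissible if and only if the following three conditions hold: ($\Gamma$A1) $|\hat\Gamma_{00}(P)|_{\mathbb Z}=0$, i.e. $\mathfrak C$ is smooth at the origin; ($\Gamma$A2) the edges of $\Delta(P)$ in $E_{0\infty}$ are globally admissible; ($\Gamma$A3) the edges of $\Delta(P)$ in $E_{\infty0}$ are globally admissible.
   Context: **Local parameters.** Let $\Sigma$ be a disjoint union of Riemann surfaces with holomorphic $x:\Sigma\to\mathbb P^1$ and meromorphic 1-form $\omega_{0,1}$. At $p\in\Sigma$, $r_p$ is the ramification order of $x$; a standard coordinate $\zeta$ is a local coordinate centred at $p$ with $x=x(p)+\zeta^{r_p}$, or $x=\zeta^{-r_p}$ if $x(p)=\infty$. Write $\omega_{0,1}=\sum_{l\ge\bar s_p}\tau_{p,l}\zeta^l\frac{d\zeta}\zeta$, $\tau_p:=\tau_{p,\bar s_p}\ne0$, $s_p=\min\{l:\tau_{p,l}\ne0,r_p\nmid l\}$ ($\infty$ if empty), $\nu_p=\bar s_p/r_p$. The curve is locally admissible at $p$ if $r_p=1$, or $r_p\ge2$ and: $s_p,r_p$ coprime; $s_p\le-1$, or $s_p\in\{1,\dots,r_p+1\}$ and $r_p\equiv\pm1\pmod{s_p}$;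 $\bar s_p\in\{s_p,s_p-1\}$. **Compact spectral curve.** Let $C=\{F=0\}\subset\mathbb P^1\times\mathbb P^1$, $F=X_1^{d_x}Y_1^{d_y}P(X_0/X_1,Y_0/Y_1)$, $\eta:\tilde C\to C$ its normalisation, $\pi_X([X_0:X_1],[Y_0:Y_1])=[X_0:X_1]$. The compact spectral curve associated to $\mathfrak C$ and a fundamental bidifferential $\omega_{0,2}$ on $\tilde C$ (symmetric meromorphic bidifferential on $\tilde C\times\tilde C$ whose only poles are a double pole on the diagonal with biresidue 1) is $(\tilde C,x=\pi_X\circ\eta,\ \omega_{0,1}=\eta^*(\frac{Y_0}{Y_1}d\frac{X_0}{X_1}),\omega_{0,2})$. **Global admissibility of $\mathcal S$.** $E'=\big((\mathbb P^1\times\{\infty\})\cup\{(\infty,0)\}\big)\cap C$. For a pair $p_1,p_2$ in the same $x$-fibre, labelled with $\nu_1\le\nu_2$, $r_{12}=\max(r_1,r_2)$: (C-i) $\nu_1\le\frac1m\le\nu_2$ for some integer $m\in\{1,\dots,r_{12}-1\}$; (C-ii) $\nu_1\le\frac1{r_{12}}$; the pair is non-resonant if $\nu_1\ne\nu_2$, or $\nu_1=\nu_2$ and $\left(\frac{\tau_1/r_1}{\tau_2/r_2}\right)^{r'}\ne1$ with $r'=\frac{r_1}{\gcd(r_1,\bar s_1)}=\frac{r_2}{\gcd(r_2,\bar s_2)}$. $\mathcal S$ is globally admissible if for every singular point $p$ of $C$: $p\in E'$; $\mathcal S$ is locally admissible at all points of $\eta^{-1}(p)$; every pair in $\eta^{-1}(p)$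 is non-resonant and satisfies (C-i) or (C-ii). **Newton polygons.** For $Q=\sum c_{ij}x^iy^j$, $\Delta(Q)$ is the convex hull of $\{(i,j):c_{ij}\ne0\}$; $\Gamma^+(Q)$ is the convex hull of $\bigcup_{c_{ij}\ne0}\big((i,j)+\mathbb R_{\ge0}^2\big)$ and $\Gamma(Q)$ is the closure of $\mathbb R^2_{\ge0}\setminus\Gamma^+(Q)$ in $\mathbb R^2_{\geq 0}$. Let $\square(d_x,d_y)=[0,d_x]\times[0,d_y]$. Corners: $\Gamma_{00}(P)=\Gamma(P)$; $\Gamma_{0\infty}(P)$ is the image of $\Gamma(y^{d_y}P(x,1/y))$ under $(i,j)\mapsto(i,d_y-j)$; $\Gamma_{\infty0}(P)$ is the image of $\Gamma(x^{d_x}P(1/x,y))$ under $(i,j)\mapsto(d_x-i,j)$. $\hat\Gamma_{00}(P)$ is the set of points of $\Gamma_{00}(P)$ not on the boundary of $\square(d_x,d_y)$; $|A|_{\mathbb Z}=|A\cap\mathbb Z^2|$. An edge of $\Delta(P)$ is a closed segment in the boundary of $\Delta(P)$ whose only integral points are its endpoints; a maximal edge is a closed segment obtained as a maximal union of edges. $E_{0\infty}=\Gamma_{0\infty}(P)\cap\Delta(P)$, $E_{\infty0}=\Gamma_{\infty0}(P)\cap\Delta(P)$; each is a point or a union of edges of positive finite slope. **Nondegenerate.** For $\tau$ a maximal edge of $\Delta(P)$ or $\tau=\Delta(P)$ put $P_\tau=\sum_{(i,j)\in\tau}c_{ij}x^iy^j$. $\mathfrak C$ is nondegenerate if for every such $\tau$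 the system $P_\tau=\partial_xP_\tau=\partial_yP_\tau=0$ has no solution in $(\mathbb C^* )^2$. **Edges in $E_{0\infty}$.** An edge of slope $\mu=\frac rk$ ($r,k$ coprime positive) has parameters $r$ and $\bar s=r-k$ (with $s=\bar s$ if $r\ge2$). It is locally admissible if $\mu\le1$ or $r\equiv\pm1\pmod s$. A pair of edges with slopes $\mu_i\le\mu_j$, $r_{ij}=\max(r_i,r_j)$, is globalisable if (G1) $1<\mu_i\le\mu_j$ and there is an integer $m\in\{2,\dots,r_{ij}-1\}$ with $\frac1{\mu_j}\le\frac{m-1}m\le\frac1{\mu_i}$; or (G2) $1<\mu_i\le\mu_j$ and $\frac1{\mu_i}\ge\frac{r_{ij}-1}{r_{ij}}$; or (G3) $\mu_i\le1$. The edges in $E_{0\infty}$ are globally admissible if each is locally admissible and each pair of distinct edges is globalisable. **Edges in $E_{\infty0}$.** An edge of slope $\mu=\frac rk$ ($r,k$ coprime positive) has parameters $r$ and $\bar s=k-r$ (with $s=\bar s$ if $r\ge2$). It is locally admissible if $\mu\ge1$ or $r\equiv\pm1\pmod s$ (automatic if $r=1$). A pair with slopes $\mu_i\le\mu_j$ is globalisable if (G1') $0<\mu_i\le\mu_j<1$ and there is $m\in\{1,\dots,r_{ij}-1\}$ with $\frac1{\mu_j}\le\frac{m+1}m\le\frac1{\mu_i}$; or (G2') $0<\mu_i\le\mu_j<1$ and $\frac1{\mu_j}\le\frac{r_{ij}+1}{r_{ij}}$; or (G3') $\mu_j\ge1$. The edges in $E_{\infty0}$ are globally admissible if each is locally admissible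 and each pair of distinct edges is globalisable. *)

theory Defs
  imports "HOL-Complex_Analysis.Complex_Analysis" "HOL-Number_Theory.Cong"
begin

section \<open>Riemann surfaces\<close>

type_synonym 'a chart = "'a set \<times> ('a \<Rightarrow> complex)"

record 'a surface =
  surf_top :: "'a topology"
  atlas :: "'a chart set"

definition is_chart :: "'a topology \<Rightarrow> 'a chart \<Rightarrow> bool" where
  "is_chart T c \<longleftrightarrow> openin T (fst c) \<and> open (snd c ` fst c) \<and>
     homeomorphic_map (subtopology T (fst c)) (top_of_set (snd c ` fst c)) (snd c)"

definition param :: "'a chart \<Rightarrow> complex \<Rightarrow> 'a" where
  "param c = inv_into (fst c) (snd c)"

definition transition :: "'a chart \<Rightarrow> 'a chart \<Rightarrow> complex \<Rightarrow> complex" where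
  "transition c d = snd d \<circ> param c"

definition compatible :: "'a chart \<Rightarrow> 'a chart \<Rightarrow> bool" where
  "compatible c d \<longleftrightarrow>
     transition c d holomorphic_on snd c ` (fst c \<inter> fst d) \<and>
     transition d c holomorphic_on snd d ` (fst c \<inter> fst d)"

definition riemann_surface :: "'a surface \<Rightarrow> bool" where
  "riemann_surface X \<longleftrightarrow>
     Hausdorff_space (surf_top X) \<and> connected_space (surf_top X) \<and>
     (\<forall>c\<in>atlas X. is_chart (surf_top X) c) \<and>
     (\<forall>c\<in>atlas X. \<forall>d\<in>atlas X. compatible c d) \<and>
     (\<Union>c\<in>atlas X. fst c) = topspace (surf_top X)"

text \<open>The holomorphic charts (local coordinates) of a surface: its maximal atlas.\<close>

definition charts :: "'a surface \<Rightarrow> 'a chart set" where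
  "charts X = {c. is_chart (surf_top X) c \<and> (\<forall>d\<in>atlas X. compatible c d)}"

section \<open>The projective line and maps to it\<close>

text \<open>\<open>Aff a\<close> is the point \<open>[a : 1]\<close> and \<open>Inf_pt\<close> is the point \<open>[1 : 0]\<close>.\<close>

datatype P1 = Aff complex | Inf_pt

text \<open>Affine coordinate \<open>Z0/Z1\<close>; the value at the point at infinity is a dummy.\<close>

fun aff :: "P1 \<Rightarrow> complex" where
  "aff (Aff a) = a"
| "aff Inf_pt = 0"

text \<open>The standard affine neighbourhood of a point of the projective line (\<open>Z1 \<noteq> 0\<close> or
  \<open>Z0 \<noteq> 0\<close>), the coordinate on it (\<open>Z0/Z1\<close> or \<open>Z1/Z0\<close>), and homogeneous coordinates of the
  point with a given affine coordinate.\<close>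

fun P1_dom :: "P1 \<Rightarrow> P1 set" where
  "P1_dom (Aff a) = UNIV - {Inf_pt}"
| "P1_dom Inf_pt = UNIV - {Aff 0}"

fun P1_coord :: "P1 \<Rightarrow> P1 \<Rightarrow> complex" where
  "P1_coord (Aff a) w = aff w"
| "P1_coord Inf_pt w = inverse (aff w)"

fun P1_hom :: "P1 \<Rightarrow> complex \<Rightarrow> complex \<times> complex" where
  "P1_hom (Aff a) u = (u, 1)"
| "P1_hom Inf_pt u = (1, u)"

definition holomorphic_to_P1 :: "'a surface \<Rightarrow> ('a \<Rightarrow> P1) \<Rightarrow> bool" where
  "holomorphic_to_P1 X f \<longleftrightarrow>
     (\<forall>p\<in>topspace (surf_top X). \<exists>c\<in>charts X. p \<in> fst c \<and> f ` fst c \<subseteq> P1_dom (f p) \<and>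
        (\<lambda>z. P1_coord (f p) (f (param c z))) holomorphic_on snd c ` fst c)"

section \<open>Bidifferentials\<close>

text \<open>Joint holomorphy on an open set, in the form of Osgood's lemma.\<close>

definition holomorphic2_on :: "(complex \<Rightarrow> complex \<Rightarrow> complex) \<Rightarrow> (complex \<times> complex) set \<Rightarrow> bool" where
  "holomorphic2_on f D \<longleftrightarrow>
     continuous_on D (\<lambda>(z, w). f z w) \<and>
     (\<forall>w. (\<lambda>z. f z w) holomorphic_on {z. (z, w) \<in> D}) \<and>
     (\<forall>z. (\<lambda>w. f z w) holomorphic_on {w. (z, w) \<in> D})"

text \<open>A (meromorphic) 1-form is given by its coefficient with respect to \<open>dz\<close> in every
  holomorphic chart, and a bidifferential by its coefficient with respect to \<open>dz dw\<close> in every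
  pair of holomorphic charts. Values at poles carry no information.\<close>

type_synonym 'a form1 = "'a chart \<Rightarrow> complex \<Rightarrow> complex"
type_synonym 'a bidiff = "'a chart \<Rightarrow> 'a chart \<Rightarrow> complex \<Rightarrow> complex \<Rightarrow> complex"

definition off_diagonal :: "'a chart \<Rightarrow> 'a chart \<Rightarrow> (complex \<times> complex) set" where
  "off_diagonal c d = {(z, w). z \<in> snd c ` fst c \<and> w \<in> snd d ` fst d \<and> param c z \<noteq> param d w}"

text \<open>The last conjunct says that there is a double pole with biresidue 1 along the diagonal.\<close>

definition fundamental_bidifferential :: "'a surface \<Rightarrow> 'a bidiff \<Rightarrow> bool" where
  "fundamental_bidifferential X B \<longleftrightarrow>
     (\<forall>c\<in>charts X. \<forall>d\<in>charts X. \<forall>c'\<in>charts X. \<forall>d'\<in>charts X.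
        \<forall>p\<in>fst c \<inter> fst c'. \<forall>q\<in>fst d \<inter> fst d'. p \<noteq> q \<longrightarrow>
          B c d (snd c p) (snd d q) =
            B c' d' (snd c' p) (snd d' q) *
              deriv (transition c c') (snd c p) * deriv (transition d d') (snd d q)) \<and>
     (\<forall>c\<in>charts X. \<forall>d\<in>charts X. \<forall>(z, w)\<in>off_diagonal c d. B c d z w = B d c w z) \<and>
     (\<forall>c\<in>charts X. \<forall>d\<in>charts X. holomorphic2_on (B c d) (off_diagonal c d)) \<and>
     (\<forall>c\<in>charts X. \<exists>H. holomorphic2_on H (snd c ` fst c \<times> snd c ` fst c) \<and>
        (\<forall>z\<in>snd c ` fst c. H z z = 1) \<and>
        (\<forall>z\<in>snd c ` fst c. \<forall>w\<in>snd c ` fst c. z \<noteq> w \<longrightarrow> B c c z w = H z w / (z - w)\<^sup>2))"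

section \<open>Spectral curves and local admissibility\<close>

record 'a spectral_curve =
  surf :: "'a surface"
  xmap :: "'a \<Rightarrow> P1"
  om01 :: "'a form1"
  om02 :: "'a bidiff"

definition ram :: "'a spectral_curve \<Rightarrow> 'a \<Rightarrow> nat" where
  "ram S p =
     (let c = (SOME c. c \<in> charts (surf S) \<and> p \<in> fst c)
      in nat (zorder (\<lambda>z. P1_coord (xmap S p) (xmap S (param c z)) - P1_coord (xmap S p) (xmap S p))
                (snd c p)))"

definition standard_coordinate :: "'a spectral_curve \<Rightarrow> 'a \<Rightarrow> 'a chart \<Rightarrow> bool" where
  "standard_coordinate S p c \<longleftrightarrow>
     c \<in> charts (surf S) \<and> p \<in> fst c \<and> snd c p = 0 \<and>
     (\<forall>q\<in>fst c. xmap S q =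
        (case xmap S p of
           Aff a \<Rightarrow> Aff (a + snd c q ^ ram S p)
         | Inf_pt \<Rightarrow> if q = p then Inf_pt else Aff (inverse (snd c q ^ ram S p))))"

text \<open>Two standard coordinates at \<open>p\<close> differ by an \<open>r\<^sub>p\<close>-th root of unity; the notions below that
  depend on \<open>\<tau>\<close> (local admissibility, non-resonance) do not depend on the choice. As
  \<open>\<omega>\<^sub>0\<^sub>1 = \<Sum>\<tau>\<^sub>l \<zeta>\<^sup>l d\<zeta>/\<zeta>\<close>, the coefficient \<open>\<tau>\<^sub>l\<close> is the Laurent coefficient of index \<open>l - 1\<close>.\<close>

definition om01_expansion :: "'a spectral_curve \<Rightarrow> 'a \<Rightarrow> complex fls" where
  "om01_expansion S p = laurent_expansion (om01 S (SOME c. standard_coordinate S p c)) 0"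

definition tau :: "'a spectral_curve \<Rightarrow> 'a \<Rightarrow> int \<Rightarrow> complex" where
  "tau S p l = fls_nth (om01_expansion S p) (l - 1)"

definition sbar :: "'a spectral_curve \<Rightarrow> 'a \<Rightarrow> int" where
  "sbar S p = fls_subdegree (om01_expansion S p) + 1"

definition tau0 :: "'a spectral_curve \<Rightarrow> 'a \<Rightarrow> complex" where
  "tau0 S p = tau S p (sbar S p)"

text \<open>\<open>None\<close> stands for infinity.\<close>

definition s_par :: "'a spectral_curve \<Rightarrow> 'a \<Rightarrow> int option" where
  "s_par S p =
     (if \<exists>l. tau S p l \<noteq> 0 \<and> \<not> int (ram S p) dvd l
      then Some (LEAST l. tau S p l \<noteq> 0 \<and> \<not> int (ram S p) dvd l) else None)"

definition nu :: "'a spectral_curve \<Rightarrow> 'a \<Rightarrow> real" where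
  "nu S p = of_int (sbar S p) / of_nat (ram S p)"

definition cong_pm1 :: "int \<Rightarrow> int \<Rightarrow> bool" where
  "cong_pm1 r s \<longleftrightarrow> [r = 1] (mod s) \<or> [r = - 1] (mod s)"

definition locally_admissible :: "'a spectral_curve \<Rightarrow> 'a \<Rightarrow> bool" where
  "locally_admissible S p \<longleftrightarrow>
     (let r = int (ram S p) in
      r = 1 \<or>
      (r \<ge> 2 \<and> (\<exists>s. s_par S p = Some s \<and> coprime s r \<and>
        (s \<le> - 1 \<or> (s \<in> {1..r + 1} \<and> cong_pm1 r s)) \<and>
        sbar S p \<in> {s, s - 1})))"

definition cond_C_i :: "'a spectral_curve \<Rightarrow> 'a \<Rightarrow> 'a \<Rightarrow> bool" where
  "cond_C_i S p1 p2 \<longleftrightarrow>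
     (\<exists>m::int. 1 \<le> m \<and> m \<le> int (max (ram S p1) (ram S p2)) - 1 \<and>
        nu S p1 \<le> 1 / of_int m \<and> 1 / of_int m \<le> nu S p2)"

definition cond_C_ii :: "'a spectral_curve \<Rightarrow> 'a \<Rightarrow> 'a \<Rightarrow> bool" where
  "cond_C_ii S p1 p2 \<longleftrightarrow> nu S p1 \<le> 1 / of_nat (max (ram S p1) (ram S p2))"

definition non_resonant :: "'a spectral_curve \<Rightarrow> 'a \<Rightarrow> 'a \<Rightarrow> bool" where
  "non_resonant S p1 p2 \<longleftrightarrow>
     nu S p1 \<noteq> nu S p2 \<or>
     ((tau0 S p1 / of_nat (ram S p1)) / (tau0 S p2 / of_nat (ram S p2))) ^
       (ram S p1 div nat (gcd (int (ram S p1)) (sbar S p1))) \<noteq> 1"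

section \<open>Plane curves and their normalisation\<close>

text \<open>A polynomial \<open>P(x,y)\<close> is a polynomial in \<open>y\<close> whose coefficients are polynomials in \<open>x\<close>.\<close>

definition cf :: "complex poly poly \<Rightarrow> nat \<Rightarrow> nat \<Rightarrow> complex" where
  "cf P i j = coeff (coeff P j) i"

definition deg_x :: "complex poly poly \<Rightarrow> nat" where
  "deg_x P = (MAX j\<in>{..degree P}. degree (coeff P j))"

definition deg_y :: "complex poly poly \<Rightarrow> nat" where
  "deg_y P = degree P"

definition bihom :: "complex poly poly \<Rightarrow> complex \<times> complex \<Rightarrow> complex \<times> complex \<Rightarrow> complex" where
  "bihom P X Y =
     (\<Sum>i\<le>deg_x P. \<Sum>j\<le>deg_y P. cf P i j *
        fst X ^ i * snd X ^ (deg_x P - i) * fst Y ^ j * snd Y ^ (deg_y P - j))"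

text \<open>Equation of the projective curve in the affine coordinates \<open>u\<close>, \<open>v\<close> around a point.\<close>

definition local_equation :: "complex poly poly \<Rightarrow> P1 \<times> P1 \<Rightarrow> complex \<Rightarrow> complex \<Rightarrow> complex" where
  "local_equation P p u v = bihom P (P1_hom (fst p) u) (P1_hom (snd p) v)"

definition proj_curve :: "complex poly poly \<Rightarrow> (P1 \<times> P1) set" where
  "proj_curve P = {p. local_equation P p (aff (fst p)) (aff (snd p)) = 0}"

definition singular_points :: "complex poly poly \<Rightarrow> (P1 \<times> P1) set" where
  "singular_points P = {p \<in> proj_curve P.
     deriv (\<lambda>u. local_equation P p u (aff (snd p))) (aff (fst p)) = 0 \<and>
     deriv (\<lambda>v. local_equation P p (aff (fst p)) v) (aff (snd p)) = 0}"

text \<open>The normalisation of an irreducible projective curve: a compact Riemann surface with a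
  holomorphic map onto the curve that is injective over the smooth points and finite over the
  singular ones.\<close>

definition normalisation :: "complex poly poly \<Rightarrow> 'a surface \<Rightarrow> ('a \<Rightarrow> P1 \<times> P1) \<Rightarrow> bool" where
  "normalisation P X \<eta> \<longleftrightarrow>
     riemann_surface X \<and> compact_space (surf_top X) \<and>
     holomorphic_to_P1 X (fst \<circ> \<eta>) \<and> holomorphic_to_P1 X (snd \<circ> \<eta>) \<and>
     \<eta> ` topspace (surf_top X) = proj_curve P \<and>
     finite {q \<in> topspace (surf_top X). \<eta> q \<in> singular_points P} \<and>
     inj_on \<eta> {q \<in> topspace (surf_top X). \<eta> q \<notin> singular_points P}"

definition pullback_ydx :: "('a \<Rightarrow> P1 \<times> P1) \<Rightarrow> 'a form1" where
  "pullback_ydx \<eta> c z =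
     aff (snd (\<eta> (param c z))) * deriv (\<lambda>w. aff (fst (\<eta> (param c w)))) z"

definition compact_spectral_curve ::
    "'a surface \<Rightarrow> ('a \<Rightarrow> P1 \<times> P1) \<Rightarrow> 'a bidiff \<Rightarrow> 'a spectral_curve" where
  "compact_spectral_curve X \<eta> B = \<lparr>surf = X, xmap = fst \<circ> \<eta>, om01 = pullback_ydx \<eta>, om02 = B\<rparr>"

definition E' :: "complex poly poly \<Rightarrow> (P1 \<times> P1) set" where
  "E' P = ((UNIV \<times> {Inf_pt}) \<union> {(Inf_pt, Aff 0)}) \<inter> proj_curve P"

definition globally_admissible ::
    "complex poly poly \<Rightarrow> ('a \<Rightarrow> P1 \<times> P1) \<Rightarrow> 'a spectral_curve \<Rightarrow> bool" where
  "globally_admissible P \<eta> S \<longleftrightarrow>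
     (\<forall>p\<in>singular_points P.
        p \<in> E' P \<and>
        (let F = {q \<in> topspace (surf_top (surf S)). \<eta> q = p} in
           (\<forall>q\<in>F. locally_admissible S q) \<and>
           (\<forall>q1\<in>F. \<forall>q2\<in>F. q1 \<noteq> q2 \<and> nu S q1 \<le> nu S q2 \<longrightarrow>
              non_resonant S q1 q2 \<and> (cond_C_i S q1 q2 \<or> cond_C_ii S q1 q2))))"

section \<open>Newton polygons\<close>

definition supp :: "complex poly poly \<Rightarrow> (real \<times> real) set" where
  "supp P = {(real i, real j) | i j. cf P i j \<noteq> 0}"

definition newton_polygon :: "complex poly poly \<Rightarrow> (real \<times> real) set" where
  "newton_polygon P = convex hull (supp P)"

definition Gamma_plus :: "complex poly poly \<Rightarrow> (real \<times> real) set" where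
  "Gamma_plus P = convex hull (\<Union>(i, j)\<in>supp P. {i..} \<times> {j..})"

definition Gamma :: "complex poly poly \<Rightarrow> (real \<times> real) set" where
  "Gamma P = closure ({0..} \<times> {0..} - Gamma_plus P)"

text \<open>\<open>x\<^sup>d P(1/x, y)\<close> for \<open>d = deg_x P\<close>; the library's \<^const>\<open>reflect_poly\<close> gives \<open>y\<^sup>d P(x, 1/y)\<close>
  for \<open>d = deg_y P\<close>.\<close>

definition reflect_x :: "complex poly poly \<Rightarrow> complex poly poly" where
  "reflect_x P = map_poly (\<lambda>c. monom 1 (deg_x P - degree c) * reflect_poly c) P"

definition Gamma_0inf :: "complex poly poly \<Rightarrow> (real \<times> real) set" where
  "Gamma_0inf P = (\<lambda>(i, j). (i, real (deg_y P) - j)) ` Gamma (reflect_poly P)"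

definition Gamma_inf0 :: "complex poly poly \<Rightarrow> (real \<times> real) set" where
  "Gamma_inf0 P = (\<lambda>(i, j). (real (deg_x P) - i, j)) ` Gamma (reflect_x P)"

definition square :: "complex poly poly \<Rightarrow> (real \<times> real) set" where
  "square P = {0..real (deg_x P)} \<times> {0..real (deg_y P)}"

definition Gamma_hat :: "complex poly poly \<Rightarrow> (real \<times> real) set" where
  "Gamma_hat P = Gamma P - frontier (square P)"

text \<open>Only meaningful for bounded sets, since \<^const>\<open>card\<close> is 0 on infinite ones. The set \<open>Gamma P\<close>
  is bounded as soon as \<open>P\<close> is divisible neither by \<open>x\<close> nor by \<open>y\<close>.\<close>

definition lattice_count :: "(real \<times> real) set \<Rightarrow> nat" where
  "lattice_count A = card (A \<inter> \<int> \<times> \<int>)"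

definition edges :: "complex poly poly \<Rightarrow> (real \<times> real) set set" where
  "edges P = {e. \<exists>a b. a \<noteq> b \<and> e = closed_segment a b \<and>
     e \<subseteq> frontier (newton_polygon P) \<and> e \<inter> \<int> \<times> \<int> = {a, b}}"

definition edge_union_segment :: "complex poly poly \<Rightarrow> (real \<times> real) set \<Rightarrow> bool" where
  "edge_union_segment P \<tau> \<longleftrightarrow>
     (\<exists>a b. a \<noteq> b \<and> \<tau> = closed_segment a b) \<and> (\<exists>D\<subseteq>edges P. \<tau> = \<Union>D)"

definition maximal_edges :: "complex poly poly \<Rightarrow> (real \<times> real) set set" where
  "maximal_edges P = {\<tau>. edge_union_segment P \<tau> \<and>
     \<not> (\<exists>\<sigma>. edge_union_segment P \<sigma> \<and> \<tau> \<subset> \<sigma>)}"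

definition face_poly :: "complex poly poly \<Rightarrow> (real \<times> real) set \<Rightarrow> complex \<Rightarrow> complex \<Rightarrow> complex" where
  "face_poly P \<tau> x y =
     (\<Sum>(i, j)\<in>{(i, j). cf P i j \<noteq> 0 \<and> (real i, real j) \<in> \<tau>}. cf P i j * x ^ i * y ^ j)"

definition nondegenerate :: "complex poly poly \<Rightarrow> bool" where
  "nondegenerate P \<longleftrightarrow>
     (\<forall>\<tau>\<in>insert (newton_polygon P) (maximal_edges P).
        \<not> (\<exists>x y. x \<noteq> 0 \<and> y \<noteq> 0 \<and> face_poly P \<tau> x y = 0 \<and>
             deriv (\<lambda>u. face_poly P \<tau> u y) x = 0 \<and> deriv (\<lambda>v. face_poly P \<tau> x v) y = 0))"

subsection \<open>Admissibility of edges\<close>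

definition E_0inf :: "complex poly poly \<Rightarrow> (real \<times> real) set" where
  "E_0inf P = Gamma_0inf P \<inter> newton_polygon P"

definition E_inf0 :: "complex poly poly \<Rightarrow> (real \<times> real) set" where
  "E_inf0 P = Gamma_inf0 P \<inter> newton_polygon P"

text \<open>Edges have integral end points, so non-vertical ones have a rational slope.\<close>

definition slope :: "(real \<times> real) set \<Rightarrow> rat" where
  "slope e = (THE \<mu>. \<exists>a b. e = closed_segment a b \<and> fst a \<noteq> fst b \<and>
     of_rat \<mu> = (snd b - snd a) / (fst b - fst a))"

definition edge_r :: "(real \<times> real) set \<Rightarrow> int" where
  "edge_r e = fst (quotient_of (slope e))"

definition edge_k :: "(real \<times> real) set \<Rightarrow> int" where
  "edge_k e = snd (quotient_of (slope e))"

definition edge_sbar_0inf :: "(real \<times> real) set \<Rightarrow> int" where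
  "edge_sbar_0inf e = edge_r e - edge_k e"

definition edge_sbar_inf0 :: "(real \<times> real) set \<Rightarrow> int" where
  "edge_sbar_inf0 e = edge_k e - edge_r e"

definition edge_loc_adm_0inf :: "(real \<times> real) set \<Rightarrow> bool" where
  "edge_loc_adm_0inf e \<longleftrightarrow> slope e \<le> 1 \<or> cong_pm1 (edge_r e) (edge_sbar_0inf e)"

definition edge_loc_adm_inf0 :: "(real \<times> real) set \<Rightarrow> bool" where
  "edge_loc_adm_inf0 e \<longleftrightarrow> slope e \<ge> 1 \<or> cong_pm1 (edge_r e) (edge_sbar_inf0 e)"

text \<open>In the two definitions below the edges are labelled such that \<open>slope e1 \<le> slope e2\<close>.\<close>

definition globalisable_0inf :: "(real \<times> real) set \<Rightarrow> (real \<times> real) set \<Rightarrow> bool" where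
  "globalisable_0inf e1 e2 \<longleftrightarrow>
     (let r12 = max (edge_r e1) (edge_r e2) in
      (1 < slope e1 \<and> (\<exists>m\<in>{2..r12 - 1}.
         1 / slope e2 \<le> (of_int m - 1) / of_int m \<and> (of_int m - 1) / of_int m \<le> 1 / slope e1)) \<or>
      (1 < slope e1 \<and> 1 / slope e1 \<ge> (of_int r12 - 1) / of_int r12) \<or>
      slope e1 \<le> 1)"

definition globalisable_inf0 :: "(real \<times> real) set \<Rightarrow> (real \<times> real) set \<Rightarrow> bool" where
  "globalisable_inf0 e1 e2 \<longleftrightarrow>
     (let r12 = max (edge_r e1) (edge_r e2) in
      (0 < slope e1 \<and> slope e2 < 1 \<and> (\<exists>m\<in>{1..r12 - 1}.
         1 / slope e2 \<le> (of_int m + 1) / of_int m \<and> (of_int m + 1) / of_int m \<le> 1 / slope e1)) \<or>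
      (0 < slope e1 \<and> slope e2 < 1 \<and> 1 / slope e2 \<le> (of_int r12 + 1) / of_int r12) \<or>
      slope e2 \<ge> 1)"

definition globally_admissible_0inf :: "complex poly poly \<Rightarrow> bool" where
  "globally_admissible_0inf P \<longleftrightarrow>
     (let D = {e \<in> edges P. e \<subseteq> E_0inf P} in
      (\<forall>e\<in>D. edge_loc_adm_0inf e) \<and>
      (\<forall>e1\<in>D. \<forall>e2\<in>D. e1 \<noteq> e2 \<and> slope e1 \<le> slope e2 \<longrightarrow> globalisable_0inf e1 e2))"

definition globally_admissible_inf0 :: "complex poly poly \<Rightarrow> bool" where
  "globally_admissible_inf0 P \<longleftrightarrow>
     (let D = {e \<in> edges P. e \<subseteq> E_inf0 P} in
      (\<forall>e\<in>D. edge_loc_adm_inf0 e) \<and>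
      (\<forall>e1\<in>D. \<forall>e2\<in>D. e1 \<noteq> e2 \<and> slope e1 \<le> slope e2 \<longrightarrow> globalisable_inf0 e1 e2))"

end

theory Submission
  imports Defs "HOL-Computational_Algebra.Fundamental_Theorem_Algebra"
begin

text \<open>
  Nondegeneracy confines the singular points of the projective curve to the four corners
  \<open>{0, \<infinity>} \<times> {0, \<infinity>}\<close>. Let \<open>Q(u, v)\<close> be the local equation at a corner. A point of the normalisation
  above the corner has a standard coordinate \<open>z\<close> with \<open>u = z\<^sup>r\<close> and \<open>v = z\<^sup>m h(z)\<close>, \<open>h(0) \<noteq> 0\<close>. Substituting
  \<open>u = \<xi>\<^sup>r\<close>, \<open>v = \<xi>\<^sup>m w\<close> in \<open>Q\<close> and dividing by the largest power of \<open>\<xi>\<close> gives a function whose value at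
  \<open>\<xi> = 0\<close> is the polynomial of the face of the Newton diagram with inner normal \<open>(r, m)\<close>, and \<open>h(0)\<close> is a
  root of it. By nondegeneracy its nonzero roots are simple, so near each of them the curve is the
  graph of a function of \<open>\<xi>\<close>. Injectivity of the normalisation over smooth points then forces \<open>r\<close> and
  \<open>m\<close> to be coprime and \<open>h(0)\<^sup>r\<close> to determine the point; compactness of the normalisation shows that
  every root occurs. Counting roots, the points above the corner with exponents \<open>(r, m)\<close> are as many
  as the primitive edges of direction \<open>(m, -r)\<close> in the Newton diagram. The 1-form \<open>y dx\<close> has leading
  exponent \<open>\<plusminus>r \<plusminus> m\<close> and leading coefficient \<open>\<plusminus>r h(0)\<^bsup>\<plusminus>1\<^esup>\<close>, so distinct points are never resonant, and the
  remaining conditions on points are those on edges.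
\<close>

section \<open>Weighted blow-ups of a polynomial at the origin\<close>

text \<open>\<open>normalisation\<close> provides only compactness, holomorphy, surjectivity onto
  the curve, finiteness over singular points and injectivity over smooth ones. No Puiseux
  parametrisation comes with it; simplicity of the face roots replaces one, giving both local
  uniqueness and persistence of roots for small \<xi>. Coprimality of r and m reduces the local data
  to the leading term: \<open>sbar\<close> is \<plusminus>r \<plusminus> m, hence prime to r, so
  \<open>s_par\<close> is \<open>sbar\<close> as soon as r \<ge> 2 and later Laurent coefficients
  never enter. Single points and single edges have no canonical correspondence. Only their numbers
  for each pair (r, m) agree, which suffices because every condition left besides non-resonance
  depends on (r, m) alone. The corners play different roles. The origin lies outside
  \<open>E'\<close> and so must be smooth; at (\<infinity>, \<infinity>) \<open>sbar\<close> is
  negative and all conditions hold; the two mixed corners yield the edge conditions. As these are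
  imposed even when a mixed corner is smooth, they have to be shown automatic there.\<close>

definition msupp :: "(nat \<Rightarrow> nat \<Rightarrow> complex) \<Rightarrow> (nat \<times> nat) set" where
  "msupp C = {p. C (fst p) (snd p) \<noteq> 0}"

definition face :: "int \<Rightarrow> int \<Rightarrow> (nat \<times> nat) set \<Rightarrow> (nat \<times> nat) set" where
  "face \<alpha> \<beta> S = {p \<in> S. \<forall>q\<in>S. \<alpha> * int (fst p) + \<beta> * int (snd p) \<le> \<alpha> * int (fst q) + \<beta> * int (snd q)}"

definition psum :: "(nat \<times> nat) set \<Rightarrow> (nat \<Rightarrow> nat \<Rightarrow> complex) \<Rightarrow> complex \<Rightarrow> complex \<Rightarrow> complex" where
  "psum F C x y = (\<Sum>p\<in>F. C (fst p) (snd p) * x ^ fst p * y ^ snd p)"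

text \<open>
  Faces are given by integral weights, the weight \<open>(0, 0)\<close> giving the whole polygon. With the logarithmic
  derivatives in place of the partial derivatives the condition is visibly invariant under
  \<open>x \<mapsto> 1/x\<close> and \<open>y \<mapsto> 1/y\<close>.
\<close>

definition nondeg :: "(nat \<Rightarrow> nat \<Rightarrow> complex) \<Rightarrow> bool" where
  "nondeg C \<longleftrightarrow> (\<forall>\<alpha> \<beta> x y. x \<noteq> 0 \<longrightarrow> y \<noteq> 0 \<longrightarrow>
     \<not> (psum (face \<alpha> \<beta> (msupp C)) C x y = 0 \<and>
        psum (face \<alpha> \<beta> (msupp C)) (\<lambda>i j. of_nat i * C i j) x y = 0 \<and>
        psum (face \<alpha> \<beta> (msupp C)) (\<lambda>i j. of_nat j * C i j) x y = 0))"

lemma nondegD: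
  assumes "nondeg C" "x \<noteq> 0" "y \<noteq> 0" "psum (face \<alpha> \<beta> (msupp C)) C x y = 0"
    "psum (face \<alpha> \<beta> (msupp C)) (\<lambda>i j. of_nat i * C i j) x y = 0"
    "psum (face \<alpha> \<beta> (msupp C)) (\<lambda>i j. of_nat j * C i j) x y = 0"
  shows False
  using assms unfolding nondeg_def by blast

lemma face_subset: "face \<alpha> \<beta> S \<subseteq> S"
  by (auto simp: face_def)

lemma has_derivative_psum_x:
  assumes "finite S"
  shows "((\<lambda>u. psum S C u b) has_field_derivative
           (\<Sum>p\<in>S. C (fst p) (snd p) * (of_nat (fst p) * a ^ (fst p - 1)) * b ^ snd p)) (at a)"
  unfolding psum_def
  by (rule DERIV_sum) (auto intro!: derivative_eq_intros)

lemma has_derivative_psum_y: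
  assumes "finite S"
  shows "((\<lambda>v. psum S C a v) has_field_derivative
           (\<Sum>p\<in>S. C (fst p) (snd p) * a ^ fst p * (of_nat (snd p) * b ^ (snd p - 1)))) (at b)"
  unfolding psum_def
  by (rule DERIV_sum) (auto intro!: derivative_eq_intros)

lemma power_pred_mult: "of_nat n * (a * a ^ (n - Suc 0)) = of_nat n * (a::complex) ^ n"
  by (cases n) auto

lemma deriv_psum_x:
  assumes "finite S"
  shows "a * deriv (\<lambda>u. psum S C u b) a = psum S (\<lambda>i j. of_nat i * C i j) a b"
  unfolding DERIV_imp_deriv[OF has_derivative_psum_x[OF assms]]
  unfolding psum_def sum_distrib_left
proof (intro sum.cong refl)
  fix p
  have "a * (C (fst p) (snd p) * (of_nat (fst p) * a ^ (fst p - 1)) * b ^ snd p) =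
        (of_nat (fst p) * (a * a ^ (fst p - Suc 0))) * C (fst p) (snd p) * b ^ snd p"
    by simp
  thus "a * (C (fst p) (snd p) * (of_nat (fst p) * a ^ (fst p - 1)) * b ^ snd p) =
        of_nat (fst p) * C (fst p) (snd p) * a ^ fst p * b ^ snd p"
    unfolding power_pred_mult by simp
qed

lemma deriv_psum_y:
  assumes "finite S"
  shows "b * deriv (\<lambda>v. psum S C a v) b = psum S (\<lambda>i j. of_nat j * C i j) a b"
  unfolding DERIV_imp_deriv[OF has_derivative_psum_y[OF assms]]
  unfolding psum_def sum_distrib_left
proof (intro sum.cong refl)
  fix p
  have "b * (C (fst p) (snd p) * a ^ fst p * (of_nat (snd p) * b ^ (snd p - 1))) =
        (of_nat (snd p) * (b * b ^ (snd p - Suc 0))) * C (fst p) (snd p) * a ^ fst p"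
    by simp
  thus "b * (C (fst p) (snd p) * a ^ fst p * (of_nat (snd p) * b ^ (snd p - 1))) =
        of_nat (snd p) * C (fst p) (snd p) * a ^ fst p * b ^ snd p"
    unfolding power_pred_mult by simp
qed

lemma psum_y_0:
  assumes "finite S"
  shows "psum S C a 0 = psum {p \<in> S. snd p = 0} C a 1"
  unfolding psum_def by (rule sum.mono_neutral_cong_right) (use assms in auto)

lemma psum_x_0:
  assumes "finite S"
  shows "psum S C 0 b = psum {p \<in> S. fst p = 0} C 1 b"
  unfolding psum_def by (rule sum.mono_neutral_cong_right) (use assms in auto)

text \<open>On the axis \<open>b = 0\<close> only the monomials without y survive. They form the
  face of weight (0, 1), because \<open>C a0 0\<close> makes 0 the least exponent of y, and the
  logarithmic y-derivative vanishes identically on it. The case \<open>a = 0\<close> is symmetric,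
  and in the torus the weight (0, 0) gives the whole polygon.\<close>

lemma nondeg_singular_origin:
  assumes nd: "nondeg C" and fin: "finite (msupp C)" and "C a0 0 \<noteq> 0" "C 0 b0 \<noteq> 0"
    and Q: "psum (msupp C) C a b = 0"
    and Qx: "deriv (\<lambda>u. psum (msupp C) C u b) a = 0"
    and Qy: "deriv (\<lambda>v. psum (msupp C) C a v) b = 0"
  shows "a = 0 \<and> b = 0"
proof -
  let ?S = "msupp C"
  have x: "psum ?S (\<lambda>i j. of_nat i * C i j) a b = 0"
    using deriv_psum_x[OF fin, of a C b] Qx by simp
  have y: "psum ?S (\<lambda>i j. of_nat j * C i j) a b = 0"
    using deriv_psum_y[OF fin, of b C a] Qy by simp
  have f00: "face 0 0 ?S = ?S"
    by (auto simp: face_def)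
  have f01: "face 0 1 ?S = {p \<in> ?S. snd p = 0}"
  proof (intro equalityI subsetI)
    fix p assume "p \<in> face 0 1 ?S"
    moreover have "(a0, 0) \<in> ?S" using assms(3) by (simp add: msupp_def)
    ultimately show "p \<in> {p \<in> ?S. snd p = 0}" unfolding face_def by force
  qed (auto simp: face_def)
  have f10: "face 1 0 ?S = {p \<in> ?S. fst p = 0}"
  proof (intro equalityI subsetI)
    fix p assume "p \<in> face 1 0 ?S"
    moreover have "(0, b0) \<in> ?S" using assms(4) by (simp add: msupp_def)
    ultimately show "p \<in> {p \<in> ?S. fst p = 0}" unfolding face_def by force
  qed (auto simp: face_def)
  consider "a \<noteq> 0" "b \<noteq> 0" | "a \<noteq> 0" "b = 0" | "a = 0" "b \<noteq> 0" | "a = 0" "b = 0"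
    by blast
  thus ?thesis
  proof cases
    case 1
    thus ?thesis using nondegD[OF nd, of a b 0 0] x y Q unfolding f00 by blast
  next
    case 2
    have "psum {p \<in> ?S. snd p = 0} C a 1 = 0"
         "psum {p \<in> ?S. snd p = 0} (\<lambda>i j. of_nat i * C i j) a 1 = 0"
      using Q x psum_y_0[OF fin] 2 by simp_all
    moreover have "psum {p \<in> ?S. snd p = 0} (\<lambda>i j. of_nat j * C i j) a 1 = 0"
      unfolding psum_def by (intro sum.neutral) auto
    ultimately show ?thesis
      using nondegD[OF nd, of a 1 0 1] 2 unfolding f01 by simp
  next
    case 3
    have "psum {p \<in> ?S. fst p = 0} C 1 b = 0"
         "psum {p \<in> ?S. fst p = 0} (\<lambda>i j. of_nat j * C i j) 1 b = 0"
      using Q y psum_x_0[OF fin] 3 by simp_all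
    moreover have "psum {p \<in> ?S. fst p = 0} (\<lambda>i j. of_nat i * C i j) 1 b = 0"
      unfolding psum_def by (intro sum.neutral) auto
    ultimately show ?thesis
      using nondegD[OF nd, of 1 b 1 0] 3 unfolding f10 by simp
  qed auto
qed

section \<open>Strict transforms and their zeros near \<xi> = 0\<close>

definition wt :: "nat \<Rightarrow> nat \<Rightarrow> nat \<times> nat \<Rightarrow> nat" where
  "wt r m p = r * fst p + m * snd p"

definition wt_ord :: "nat \<Rightarrow> nat \<Rightarrow> (nat \<times> nat) set \<Rightarrow> nat" where
  "wt_ord r m S = Min (wt r m ` S)"

text \<open>The strict transform: the power of \<xi> is cancelled monomial by monomial, so the
  function makes sense at \<xi> = 0 as well. The subtraction in the exponent is exact on the
  support, whose least weight is \<open>wt_ord\<close>.\<close>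

definition blowup :: "(nat \<Rightarrow> nat \<Rightarrow> complex) \<Rightarrow> nat \<Rightarrow> nat \<Rightarrow> complex \<Rightarrow> complex \<Rightarrow> complex" where
  "blowup C r m \<xi> w = (\<Sum>p\<in>msupp C. C (fst p) (snd p) *
     \<xi> ^ (wt r m p - wt_ord r m (msupp C)) * w ^ snd p)"

lemma face_eq_wt:
  assumes "finite S"
  shows "face (int r) (int m) S = {p \<in> S. wt r m p = wt_ord r m S}"
proof -
  have "p \<in> face (int r) (int m) S \<longleftrightarrow> p \<in> {p \<in> S. wt r m p = wt_ord r m S}" for p
  proof -
    have "(int r * int (fst p) + int m * int (snd p) \<le> int r * int (fst q) + int m * int (snd q)) \<longleftrightarrow>
          wt r m p \<le> wt r m q" for q
      unfolding wt_def by (simp flip: of_nat_mult of_nat_add)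
    hence "p \<in> face (int r) (int m) S \<longleftrightarrow> p \<in> S \<and> (\<forall>q\<in>S. wt r m p \<le> wt r m q)"
      by (auto simp: face_def)
    also have "\<dots> \<longleftrightarrow> p \<in> S \<and> wt r m p = Min (wt r m ` S)"
      using assms by (auto intro!: Min_eqI[symmetric])
    finally show ?thesis by (simp add: wt_ord_def)
  qed
  thus ?thesis by blast
qed

lemma wt_ord_le: "finite S \<Longrightarrow> p \<in> S \<Longrightarrow> wt_ord r m S \<le> wt r m p"
  unfolding wt_ord_def by auto

lemma psum_blowup:
  assumes "finite (msupp C)"
  shows "psum (msupp C) C (\<xi> ^ r) (\<xi> ^ m * w) = \<xi> ^ wt_ord r m (msupp C) * blowup C r m \<xi> w"
  unfolding psum_def blowup_def sum_distrib_left
proof (rule sum.cong)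
  fix p assume p: "p \<in> msupp C"
  have "\<xi> ^ wt r m p = \<xi> ^ wt_ord r m (msupp C) * \<xi> ^ (wt r m p - wt_ord r m (msupp C))"
    using wt_ord_le[OF assms p, of r m] by (simp flip: power_add)
  moreover have "(\<xi> ^ r) ^ fst p * (\<xi> ^ m * w) ^ snd p = \<xi> ^ wt r m p * w ^ snd p"
    by (simp add: wt_def power_add power_mult power_mult_distrib)
  ultimately show "C (fst p) (snd p) * (\<xi> ^ r) ^ fst p * (\<xi> ^ m * w) ^ snd p =
    \<xi> ^ wt_ord r m (msupp C) * (C (fst p) (snd p) * \<xi> ^ (wt r m p - wt_ord r m (msupp C)) * w ^ snd p)"
    by (simp only: mult.assoc) (simp only: ac_simps)
qed auto

text \<open>Since \<open>0 ^ 0 = 1\<close>, evaluation at \<xi> = 0 keeps precisely the monomials of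
  least weight. The functions f and g leave room for the polynomial and for its divided
  difference.\<close>

lemma sum_face:
  assumes "finite S"
  shows "(\<Sum>p\<in>S. f p * 0 ^ (wt r m p - wt_ord r m S) * g p) =
         (\<Sum>p\<in>face (int r) (int m) S. f p * (g p :: complex))"
  unfolding face_eq_wt[OF assms]
proof (rule sum.mono_neutral_cong_right)
  show "\<forall>i\<in>S - {p \<in> S. wt r m p = wt_ord r m S}. f i * 0 ^ (wt r m i - wt_ord r m S) * g i = 0"
  proof
    fix p assume "p \<in> S - {p \<in> S. wt r m p = wt_ord r m S}"
    hence "wt r m p - wt_ord r m S > 0"
      using wt_ord_le[OF assms, of p r m] by force
    thus "f p * 0 ^ (wt r m p - wt_ord r m S) * g p = 0" by simp
  qed
qed (use assms in auto)

lemma blowup_0: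
  assumes "finite (msupp C)"
  shows "blowup C r m 0 w = psum (face (int r) (int m) (msupp C)) C 1 w"
  unfolding blowup_def psum_def sum_face[OF assms] by simp

text \<open>Euler's identity: on the face r i + m j is a constant N, so r times the logarithmic
  x-derivative plus m times the logarithmic y-derivative is N times the face polynomial. A double
  root would make all three vanish at (1, w), against nondegeneracy.\<close>

lemma simple_root:
  assumes nd: "nondeg C" and fin: "finite (msupp C)" and r: "r > 0" and w: "w \<noteq> 0"
    and root: "blowup C r m 0 w = 0"
  shows "psum (face (int r) (int m) (msupp C)) (\<lambda>i j. of_nat j * C i j) 1 w \<noteq> 0"
proof
  let ?F = "face (int r) (int m) (msupp C)"
  let ?N = "wt_ord r m (msupp C)"
  assume y: "psum ?F (\<lambda>i j. of_nat j * C i j) 1 w = 0"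
  have f: "psum ?F C 1 w = 0" using root blowup_0[OF fin] by simp
  have "of_nat r * psum ?F (\<lambda>i j. of_nat i * C i j) 1 w + of_nat m * psum ?F (\<lambda>i j. of_nat j * C i j) 1 w
        = of_nat ?N * psum ?F C 1 w"
    unfolding psum_def sum_distrib_left sum.distrib[symmetric]
  proof (rule sum.cong)
    fix p assume "p \<in> ?F"
    hence "wt r m p = ?N" unfolding face_eq_wt[OF fin] by simp
    hence "of_nat ?N = (of_nat r * of_nat (fst p) + of_nat m * of_nat (snd p) :: complex)"
      unfolding wt_def by (simp flip: of_nat_mult of_nat_add)
    thus "of_nat r * (of_nat (fst p) * C (fst p) (snd p) * 1 ^ fst p * w ^ snd p) +
         of_nat m * (of_nat (snd p) * C (fst p) (snd p) * 1 ^ fst p * w ^ snd p) =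
         of_nat ?N * (C (fst p) (snd p) * 1 ^ fst p * w ^ snd p)"
      by (simp add: algebra_simps)
  qed auto
  hence "psum ?F (\<lambda>i j. of_nat i * C i j) 1 w = 0" using y f r by simp
  thus False using nondegD[OF nd, of 1 w "int r" "int m"] y f w by simp
qed

text \<open>The divided difference of \<open>blowup\<close> in w, written as a polynomial so that it
  is continuous up to w1 = w2, where it is the derivative.\<close>

definition blowup_quot ::
    "(nat \<Rightarrow> nat \<Rightarrow> complex) \<Rightarrow> nat \<Rightarrow> nat \<Rightarrow> complex \<times> complex \<times> complex \<Rightarrow> complex" where
  "blowup_quot C r m t = (\<Sum>p\<in>msupp C. C (fst p) (snd p) *
     fst t ^ (wt r m p - wt_ord r m (msupp C)) *
     (\<Sum>k<snd p. fst (snd t) ^ (snd p - Suc k) * snd (snd t) ^ k))"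

lemma blowup_diff:
  "blowup C r m \<xi> w1 - blowup C r m \<xi> w2 = (w1 - w2) * blowup_quot C r m (\<xi>, w1, w2)"
proof -
  have "w1 ^ n - w2 ^ n = (w1 - w2) * (\<Sum>k<n. w1 ^ (n - Suc k) * w2 ^ k)" for n
    using power_diff_sumr2[of w2 n w1] by (simp add: algebra_simps)
  hence "C (fst p) (snd p) * e * w1 ^ snd p - C (fst p) (snd p) * e * w2 ^ snd p =
      (w1 - w2) * (C (fst p) (snd p) * e * (\<Sum>k<snd p. w1 ^ (snd p - Suc k) * w2 ^ k))" for p e
    by (simp only: flip: right_diff_distrib) (simp only: ac_simps)
  thus ?thesis
    unfolding blowup_def blowup_quot_def sum_subtractf[symmetric] sum_distrib_left fst_conv snd_conv
    by (intro sum.cong refl)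
qed

text \<open>The uniqueness half of the implicit function theorem: the divided difference is nonzero
  at (0, w0, w0) because the root is simple, hence nonzero nearby by continuity, so two roots close
  to w0 coincide.\<close>

lemma blowup_root_unique:
  assumes nd: "nondeg C" and fin: "finite (msupp C)" and r: "r > 0" and w: "w0 \<noteq> 0"
    and root: "blowup C r m 0 w0 = 0"
  obtains \<delta> where "\<delta> > 0"
    "\<And>\<xi> w1 w2. norm \<xi> < \<delta> \<Longrightarrow> dist w1 w0 < \<delta> \<Longrightarrow> dist w2 w0 < \<delta> \<Longrightarrow>
       blowup C r m \<xi> w1 = 0 \<Longrightarrow> blowup C r m \<xi> w2 = 0 \<Longrightarrow> w1 = w2"
proof -
  have cont: "continuous_on UNIV (blowup_quot C r m)"
    unfolding blowup_quot_def[abs_def] by (intro continuous_intros)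
  \<comment> \<open>Multiplication by w0 turns the w-derivative at \<xi> = 0 into the logarithmic
    derivative of the face polynomial.\<close>
  have "w0 * blowup_quot C r m (0, w0, w0) =
        psum (face (int r) (int m) (msupp C)) (\<lambda>i j. of_nat j * C i j) 1 w0"
  proof -
    have *: "(\<Sum>k<n. w0 ^ (n - Suc k) * w0 ^ k) = of_nat n * w0 ^ (n - 1)" for n
    proof -
      have "(\<Sum>k<n. w0 ^ (n - Suc k) * w0 ^ k) = (\<Sum>k<n. w0 ^ (n - 1))"
        by (intro sum.cong refl) (auto simp flip: power_add)
      thus ?thesis by simp
    qed
    have **: "w0 * (c * (of_nat n * w0 ^ (n - 1))) = of_nat n * c * w0 ^ n" for n c
      using w by (cases n) auto
    have "w0 * blowup_quot C r m (0, w0, w0) =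
          (\<Sum>p\<in>face (int r) (int m) (msupp C). w0 * (C (fst p) (snd p) * (of_nat (snd p) * w0 ^ (snd p - 1))))"
      unfolding blowup_quot_def fst_conv snd_conv * sum_face[OF fin] sum_distrib_left ..
    also have "\<dots> = psum (face (int r) (int m) (msupp C)) (\<lambda>i j. of_nat j * C i j) 1 w0"
      unfolding psum_def ** by simp
    finally show ?thesis .
  qed
  hence "blowup_quot C r m (0, w0, w0) \<noteq> 0"
    using simple_root[OF nd fin r w root] by force
  moreover have "open {t. blowup_quot C r m t \<noteq> 0}"
    using open_vimage[OF open_delete[OF open_UNIV, of 0] cont] by (simp add: vimage_def)
  ultimately obtain e where e: "e > 0" "ball (0, w0, w0) e \<subseteq> {t. blowup_quot C r m t \<noteq> 0}"
    unfolding open_contains_ball by blast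
  \<comment> \<open>The distance of a triple from (0, w0, w0) is at most the sum of the three
    distances of its entries, hence the division by 3.\<close>
  show ?thesis
  proof (rule that[of "e / 3"])
    fix \<xi> w1 w2
    assume a: "norm \<xi> < e / 3" "dist w1 w0 < e / 3" "dist w2 w0 < e / 3"
      "blowup C r m \<xi> w1 = 0" "blowup C r m \<xi> w2 = 0"
    have "dist (0, w0, w0) (\<xi>, w1, w2) \<le> dist 0 \<xi> + dist (w0, w0) (w1, w2)"
      unfolding dist_Pair_Pair[of 0] by (rule sqrt_sum_squares_le_sum) auto
    also have "dist (w0, w0) (w1, w2) \<le> dist w0 w1 + dist w0 w2"
      unfolding dist_Pair_Pair by (rule sqrt_sum_squares_le_sum) auto
    finally have "(\<xi>, w1, w2) \<in> ball (0, w0, w0) e"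
      using a by (simp add: dist_commute)
    hence "blowup_quot C r m (\<xi>, w1, w2) \<noteq> 0" using e by blast
    thus "w1 = w2" using blowup_diff[of C r m \<xi> w1 w2] a by simp
  qed (use e in auto)
qed

lemma blowup_close:
  obtains M where "M > 0"
    "\<And>\<xi> w. norm \<xi> \<le> 1 \<Longrightarrow> norm w \<le> R \<Longrightarrow> norm (blowup C r m \<xi> w - blowup C r m 0 w) \<le> norm \<xi> * M"
proof -
  let ?M = "(\<Sum>p\<in>msupp C. norm (C (fst p) (snd p)) * \<bar>R\<bar> ^ snd p)"
  \<comment> \<open>The bound rests on |\<open>\<xi> ^ e - 0 ^ e\<close>| \<le> |\<xi>| in the unit
    disc; adding 1 makes the constant positive even for an empty support.\<close>
  show ?thesis
  proof (rule that[of "?M + 1"])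
    have "?M \<ge> 0" by (intro sum_nonneg) auto
    thus "?M + 1 > 0" by simp
    fix \<xi> w :: complex assume a: "norm \<xi> \<le> 1" "norm w \<le> R"
    have "norm (blowup C r m \<xi> w - blowup C r m 0 w) \<le> (\<Sum>p\<in>msupp C. norm \<xi> * (norm (C (fst p) (snd p)) * \<bar>R\<bar> ^ snd p))"
      unfolding blowup_def sum_subtractf[symmetric]
    proof (rule sum_norm_le)
      fix p assume "p \<in> msupp C"
      define e where "e = wt r m p - wt_ord r m (msupp C)"
      have "norm (\<xi> ^ e - 0 ^ e) \<le> norm \<xi>"
      proof (cases e)
        case (Suc n)
        have "norm \<xi> * norm \<xi> ^ n \<le> norm \<xi> * 1"
          using a by (intro mult_left_mono power_le_one) auto
        thus ?thesis using Suc by (simp add: norm_mult norm_power)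
      qed auto
      moreover have "norm (w ^ snd p) \<le> \<bar>R\<bar> ^ snd p"
        using a by (auto simp: norm_power intro!: power_mono)
      ultimately have "norm (\<xi> ^ e - 0 ^ e) * (norm (C (fst p) (snd p)) * norm (w ^ snd p)) \<le> norm \<xi> * (norm (C (fst p) (snd p)) * \<bar>R\<bar> ^ snd p)"
        by (intro mult_mono) auto
      thus "norm (C (fst p) (snd p) * \<xi> ^ e * w ^ snd p - C (fst p) (snd p) * 0 ^ e * w ^ snd p)
        \<le> norm \<xi> * (norm (C (fst p) (snd p)) * \<bar>R\<bar> ^ snd p)"
        unfolding norm_mult[symmetric] by (simp add: algebra_simps)
    qed
    also have "\<dots> = norm \<xi> * ?M" by (simp add: sum_distrib_left)
    also have "\<dots> \<le> norm \<xi> * (?M + 1)" by (intro mult_left_mono) auto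
    finally show "norm (blowup C r m \<xi> w - blowup C r m 0 w) \<le> norm \<xi> * (?M + 1)" .
  qed
qed

lemma holomorphic_blowup: "blowup C r m \<xi> holomorphic_on A"
  unfolding blowup_def[abs_def] by (intro holomorphic_intros)

text \<open>A Rouche-type argument through the maximum principle. On a small circle around w0 the
  unperturbed polynomial is at least \<eta> in modulus. If the perturbed one had no zero in the
  disc, its reciprocal would be at most 2/\<eta> on the circle and hence at the centre, where
  however the perturbed value is below \<eta>/2.\<close>

lemma blowup_root_exists:
  assumes nd: "nondeg C" and fin: "finite (msupp C)" and r: "r > 0" and w: "w0 \<noteq> 0"
    and root: "blowup C r m 0 w0 = 0" and \<epsilon>: "\<epsilon> > 0"
  obtains \<delta> where "\<delta> > 0" "\<And>\<xi>. norm \<xi> < \<delta> \<Longrightarrow> \<exists>w. dist w w0 < \<epsilon> \<and> blowup C r m \<xi> w = 0"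
proof -
  obtain \<delta>1 where \<delta>1: "\<delta>1 > 0" "\<And>\<xi> w1 w2. norm \<xi> < \<delta>1 \<Longrightarrow> dist w1 w0 < \<delta>1 \<Longrightarrow> dist w2 w0 < \<delta>1 \<Longrightarrow>
       blowup C r m \<xi> w1 = 0 \<Longrightarrow> blowup C r m \<xi> w2 = 0 \<Longrightarrow> w1 = w2"
    using blowup_root_unique[OF nd fin r w root] by blast
  define e where "e = min \<epsilon> \<delta>1 / 2"
  have e: "e > 0" "e < \<epsilon>" "e < \<delta>1" using \<epsilon> \<delta>1 by (auto simp: e_def min_def)
  \<comment> \<open>Isolation of w0 is local uniqueness at \<xi> = 0.\<close>
  have nz: "blowup C r m 0 w \<noteq> 0" if "w \<in> sphere w0 e" for w
    using \<delta>1(2)[of 0 w w0] root that e \<delta>1(1) by (auto simp: dist_commute)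
  obtain \<eta> where \<eta>: "\<eta> > 0" "\<And>w. w \<in> sphere w0 e \<Longrightarrow> norm (blowup C r m 0 w) \<ge> \<eta>"
  proof -
    have "continuous_on (sphere w0 e) (\<lambda>w. norm (blowup C r m 0 w))"
      by (intro continuous_intros holomorphic_on_imp_continuous_on holomorphic_blowup)
    moreover have "sphere w0 e \<noteq> {}" using e by simp
    ultimately obtain v where "v \<in> sphere w0 e" "\<forall>w\<in>sphere w0 e. norm (blowup C r m 0 v) \<le> norm (blowup C r m 0 w)"
      using continuous_attains_inf[OF compact_sphere] by blast
    thus ?thesis using that[of "norm (blowup C r m 0 v)"] nz by auto
  qed
  obtain M where M: "M > 0" "\<And>\<xi> w. norm \<xi> \<le> 1 \<Longrightarrow> norm w \<le> norm w0 + e \<Longrightarrow> norm (blowup C r m \<xi> w - blowup C r m 0 w) \<le> norm \<xi> * M"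
    using blowup_close by blast
  show ?thesis
  proof (rule that[of "min 1 (\<eta> / (2 * M))"])
    show "0 < min 1 (\<eta> / (2 * M))" using \<eta> M by simp
    fix \<xi> :: complex assume \<xi>: "norm \<xi> < min 1 (\<eta> / (2 * M))"
    hence small: "norm \<xi> * M < \<eta> / 2" using M(1) by (simp add: field_simps)
    show "\<exists>w. dist w w0 < \<epsilon> \<and> blowup C r m \<xi> w = 0"
    proof (rule ccontr)
      assume "\<nexists>w. dist w w0 < \<epsilon> \<and> blowup C r m \<xi> w = 0"
      hence nz': "blowup C r m \<xi> w \<noteq> 0" if "w \<in> cball w0 e" for w
        using that e by (force simp: dist_commute)
      have "norm (1 / blowup C r m \<xi> w0) \<le> 2 / \<eta>"
      proof (rule maximum_modulus_frontier[where f = "\<lambda>w. 1 / blowup C r m \<xi> w" and S = "cball w0 e"])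
        have hol: "(\<lambda>w. 1 / blowup C r m \<xi> w) holomorphic_on cball w0 e"
          using nz' by (intro holomorphic_intros holomorphic_blowup) auto
        show "(\<lambda>w. 1 / blowup C r m \<xi> w) holomorphic_on interior (cball w0 e)"
          by (rule holomorphic_on_subset[OF hol]) (rule interior_subset)
        show "continuous_on (closure (cball w0 e)) (\<lambda>w. 1 / blowup C r m \<xi> w)"
          using holomorphic_on_imp_continuous_on[OF hol] by simp
        show "w0 \<in> cball w0 e" using e by simp
        fix w assume "w \<in> frontier (cball w0 e)"
        hence w: "w \<in> sphere w0 e" using e by (simp add: frontier_def)
        have "norm w \<le> norm w0 + e"
          using w norm_triangle_sub[of w w0] by (simp add: dist_norm norm_minus_commute)
        hence "norm (blowup C r m \<xi> w - blowup C r m 0 w) < \<eta> / 2"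
          using M(2)[of \<xi> w] \<xi> small by simp
        moreover have "norm (blowup C r m 0 w) - norm (blowup C r m \<xi> w) \<le> norm (blowup C r m \<xi> w - blowup C r m 0 w)"
          by (metis norm_minus_commute norm_triangle_ineq2)
        ultimately have "norm (blowup C r m \<xi> w) \<ge> \<eta> / 2"
          using \<eta>(2)[OF w] by linarith
        thus "norm (1 / blowup C r m \<xi> w) \<le> 2 / \<eta>"
          using \<eta>(1) by (simp add: norm_divide divide_simps mult.commute)
      qed auto
      moreover have "norm (blowup C r m \<xi> w0) < \<eta> / 2"
        using M(2)[of \<xi> w0] \<xi> small root e by simp
      moreover have "norm (blowup C r m \<xi> w0) > 0" using nz'[of w0] e by simp
      ultimately show False using \<eta>(1) by (simp add: norm_divide divide_simps mult.commute)
    qed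
  qed
qed

text \<open>Two points of equal weight differ by a vector (x, -y) with r x = m y, so coprimality
  makes it a multiple of (m, -r). The extreme points in the first coordinate are then the ends, and
  g is the lattice length of the face, 0 for a vertex.\<close>

lemma face_points:
  assumes fin: "finite S" and ne: "S \<noteq> {}" and cop: "coprime r m" and pos: "r > 0" "m > 0"
  obtains i0 j0 g where "(i0, j0 + g * r) \<in> S" "(i0 + g * m, j0) \<in> S"
    "\<And>p. p \<in> face (int r) (int m) S \<longleftrightarrow> p \<in> S \<and> (\<exists>k\<le>g. p = (i0 + (g - k) * m, j0 + k * r))"
proof -
  let ?F = "face (int r) (int m) S"
  have finF: "finite ?F" by (rule finite_subset[OF face_subset fin])
  have "wt_ord r m S \<in> wt r m ` S"
    unfolding wt_ord_def using fin ne by (intro Min_in) auto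
  then obtain p0 where "p0 \<in> S" "wt r m p0 = wt_ord r m S" by (elim imageE) simp
  hence neF: "?F \<noteq> {}" unfolding face_eq_wt[OF fin] by blast
  obtain s where s: "s \<in> ?F" "\<And>p. p \<in> ?F \<Longrightarrow> fst s \<le> fst p"
  proof -
    have "Min (fst ` ?F) \<in> fst ` ?F" using finF neF by (intro Min_in) auto
    then obtain s where s: "s \<in> ?F" "Min (fst ` ?F) = fst s" by (elim imageE) simp
    have "fst s \<le> fst p" if "p \<in> ?F" for p
      unfolding s(2)[symmetric] using finF that by (intro Min_le) auto
    thus ?thesis using that s by blast
  qed
  obtain t where t: "t \<in> ?F" "\<And>p. p \<in> ?F \<Longrightarrow> fst p \<le> fst t"
  proof -
    have "Max (fst ` ?F) \<in> fst ` ?F" using finF neF by (intro Max_in) auto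
    then obtain s where s: "s \<in> ?F" "Max (fst ` ?F) = fst s" by (elim imageE) simp
    have "fst p \<le> fst s" if "p \<in> ?F" for p
      unfolding s(2)[symmetric] using finF that by (intro Max_ge) auto
    thus ?thesis using that s by blast
  qed
  have step: "\<exists>k. fst q = fst p + k * m \<and> snd p = snd q + k * r" if "p \<in> ?F" "q \<in> ?F" "fst p \<le> fst q" for p q
  proof -
    have eq: "r * fst p + m * snd p = r * fst q + m * snd q"
      using that unfolding face_eq_wt[OF fin] by (simp add: wt_def)
    have le: "snd q \<le> snd p"
    proof (rule ccontr)
      assume "\<not> snd q \<le> snd p"
      hence "m * snd p < m * snd q" using pos by simp
      moreover have "r * fst p \<le> r * fst q" using that by simp
      ultimately show False using eq by linarith
    qed
    have eq': "r * (fst q - fst p) = m * (snd p - snd q)"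
      using eq that le by (simp add: diff_mult_distrib2)
    hence "m dvd r * (fst q - fst p)" by simp
    hence "m dvd fst q - fst p"
      using coprime_dvd_mult_right_iff[of m r] cop unfolding coprime_commute[of m r] by blast
    then obtain k where k: "fst q - fst p = m * k" by (elim dvdE)
    have "m * (snd p - snd q) = m * (k * r)"
      unfolding eq'[symmetric] k by (simp only: ac_simps)
    hence "snd p - snd q = k * r" using pos by simp
    moreover have "fst q - fst p = k * m" using k by (simp only: mult.commute)
    ultimately show ?thesis using that(3) le by (intro exI[of _ k]) linarith
  qed
  obtain g where g: "fst t = fst s + g * m" "snd s = snd t + g * r"
    using step[OF s(1) t(1)] t(2)[OF s(1)] by blast
  show ?thesis
  proof (rule that[of "fst s" "snd t" g])
    show "(fst s, snd t + g * r) \<in> S" "(fst s + g * m, snd t) \<in> S"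
      using subsetD[OF face_subset s(1)] subsetD[OF face_subset t(1)] unfolding g[symmetric] by simp_all
    fix p
    show "p \<in> ?F \<longleftrightarrow> p \<in> S \<and> (\<exists>k\<le>g. p = (fst s + (g - k) * m, snd t + k * r))"
    proof
      assume p: "p \<in> ?F"
      obtain k where k: "fst t = fst p + k * m" "snd p = snd t + k * r"
        using step[OF p t(1)] t(2)[OF p] by blast
      obtain l where l: "fst p = fst s + l * m" "snd s = snd p + l * r"
        using step[OF s(1) p] s(2)[OF p] by blast
      have "g * r = (k + l) * r" using g(2) k(2) l(2) by (simp add: algebra_simps)
      hence gkl: "g = k + l" using pos by simp
      hence "p = (fst s + (g - k) * m, snd t + k * r)"
        using k(2) l(1) by (intro prod_eqI) simp_all
      thus "p \<in> S \<and> (\<exists>k\<le>g. p = (fst s + (g - k) * m, snd t + k * r))"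
        using subsetD[OF face_subset p] gkl by (intro conjI exI[of _ k]) simp_all
    next
      assume p: "p \<in> S \<and> (\<exists>k\<le>g. p = (fst s + (g - k) * m, snd t + k * r))"
      then obtain k where k: "k \<le> g" "p = (fst s + (g - k) * m, snd t + k * r)" by blast
      define l where "l = g - k"
      have gl: "g = l + k" using k by (simp add: l_def)
      have "wt r m p = wt r m t"
        unfolding wt_def k g fst_conv snd_conv l_def[symmetric] unfolding gl by (simp add: algebra_simps)
      also have "\<dots> = wt_ord r m S" using t unfolding face_eq_wt[OF fin] by simp
      finally show "p \<in> ?F" unfolding face_eq_wt[OF fin] using p by simp
    qed
  qed
qed

lemma rsquarefree_card_roots:
  fixes p :: "complex poly"
  assumes "rsquarefree p" "p \<noteq> 0"
  shows "card {a. poly p a = 0} = degree p"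
proof -
  have "degree p = degree (smult (lead_coeff p) (\<Prod>z|poly p z = 0. [:-z, 1:]))"
    using complex_poly_decompose_rsquarefree[OF assms(1)] by simp
  also have "\<dots> = (\<Sum>z|poly p z = 0. degree [:-z, 1:])"
    using assms by (simp add: degree_prod_eq_sum_degree)
  finally show ?thesis by simp
qed

text \<open>The exponents of w on the face are j0 + k r, so the face polynomial is
  \<open>w ^ j0\<close> times a polynomial \<phi> of degree g in \<open>w ^ r\<close>. Its end
  coefficients are nonzero because both ends of the face lie in the support, and
  \<open>simple_root\<close> makes \<phi> squarefree. Counting r-th powers instead of roots w
  removes the ambiguity of the coordinate by an r-th root of unity.\<close>

lemma card_blowup_roots:
  assumes nd: "nondeg C" and fin: "finite (msupp C)" and pos: "r > 0" "m > 0"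
    and s: "(i0, j0 + g * r) \<in> msupp C" and t: "(i0 + g * m, j0) \<in> msupp C"
    and F: "\<And>p. p \<in> face (int r) (int m) (msupp C) \<longleftrightarrow>
              p \<in> msupp C \<and> (\<exists>k\<le>g. p = (i0 + (g - k) * m, j0 + k * r))"
  shows "card {w ^ r |w. w \<noteq> 0 \<and> blowup C r m 0 w = 0} = g"
    and "finite {w ^ r |w. w \<noteq> 0 \<and> blowup C r m 0 w = 0}"
proof -
  let ?F = "face (int r) (int m) (msupp C)"
  define D where "D k = C (i0 + (g - k) * m) (j0 + k * r)" for k
  define \<phi> where "\<phi> = (\<Sum>k\<le>g. monom (D k) k)"
  have coeff: "coeff \<phi> n = (if n \<le> g then D n else 0)" for n
    unfolding \<phi>_def by (simp add: coeff_sum)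
  have D0: "D 0 \<noteq> 0" and Dg: "D g \<noteq> 0" using s t by (simp_all add: D_def msupp_def)
  have deg: "degree \<phi> = g"
    using Dg by (intro antisym degree_le le_degree) (auto simp: coeff)
  have nz: "\<phi> \<noteq> 0" using D0 coeff[of 0] by auto
  have poly: "poly \<phi> a = (\<Sum>k\<le>g. D k * a ^ k)" for a
    by (simp add: \<phi>_def poly_sum poly_monom)
  \<comment> \<open>The factor h serves the polynomial (h = 1) and its logarithmic derivative (h =
    the exponent) at once. Positions on the segment outside the support contribute zero
    coefficients.\<close>
  have sumF: "(\<Sum>p\<in>?F. h (snd p) * C (fst p) (snd p) * 1 ^ fst p * w ^ snd p) =
      (\<Sum>k\<le>g. h (j0 + k * r) * D k * w ^ (j0 + k * r))" for h :: "nat \<Rightarrow> complex" and w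
  proof -
    let ?f = "\<lambda>k. (i0 + (g - k) * m, j0 + k * r)"
    have inj: "inj_on ?f {..g}" using pos by (auto simp: inj_on_def)
    have "(\<Sum>k\<le>g. h (j0 + k * r) * D k * w ^ (j0 + k * r)) =
          (\<Sum>p\<in>?f ` {..g}. h (snd p) * C (fst p) (snd p) * 1 ^ fst p * w ^ snd p)"
      by (subst sum.reindex[OF inj]) (simp add: D_def)
    also have "\<dots> = (\<Sum>p\<in>?F. h (snd p) * C (fst p) (snd p) * 1 ^ fst p * w ^ snd p)"
    proof (rule sum.mono_neutral_right)
      show "?F \<subseteq> ?f ` {..g}" by (auto simp: F)
      show "\<forall>p\<in>?f ` {..g} - ?F. h (snd p) * C (fst p) (snd p) * 1 ^ fst p * w ^ snd p = 0"
      proof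
        fix p assume "p \<in> ?f ` {..g} - ?F"
        hence "p \<notin> msupp C" using F[of p] by blast
        thus "h (snd p) * C (fst p) (snd p) * 1 ^ fst p * w ^ snd p = 0" by (simp add: msupp_def)
      qed
    qed auto
    finally show ?thesis ..
  qed
  have val: "blowup C r m 0 w = w ^ j0 * poly \<phi> (w ^ r)" for w
    unfolding blowup_0[OF fin] psum_def poly
    using sumF[of "\<lambda>_. 1" w]
    by (simp add: sum_distrib_left power_add power_mult[symmetric] mult.commute mult.left_commute)
  have dval: "psum ?F (\<lambda>i j. of_nat j * C i j) 1 w =
      w ^ j0 * (of_nat j0 * poly \<phi> (w ^ r) + of_nat r * (w ^ r * poly (pderiv \<phi>) (w ^ r)))" for w
  proof -
    have "a * poly (pderiv \<phi>) a = (\<Sum>k\<le>g. of_nat k * D k * a ^ k)" for a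
    proof -
      have "a * (of_nat k * D k * a ^ (k - Suc 0)) = of_nat k * D k * a ^ k" for k
        by (cases k) auto
      moreover have "a * poly (pderiv \<phi>) a = (\<Sum>k\<le>g. a * (of_nat k * D k * a ^ (k - Suc 0)))"
        by (simp add: \<phi>_def higher_pderiv_sum[of 1, simplified] pderiv_monom poly_sum poly_monom sum_distrib_left)
      ultimately show ?thesis by (simp only:)
    qed
    thus ?thesis
      unfolding psum_def sumF poly
      by (simp add: sum_distrib_left power_add power_mult[symmetric] sum.distrib algebra_simps)
  qed
  have root_nz: "a \<noteq> 0" if "poly \<phi> a = 0" for a
    using that D0 coeff[of 0] by (auto simp: poly_0_coeff_0)
  have set_eq: "{w ^ r |w. w \<noteq> 0 \<and> blowup C r m 0 w = 0} = {a. poly \<phi> a = 0}"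
  proof (intro equalityI subsetI)
    fix a assume "a \<in> {a. poly \<phi> a = 0}"
    moreover obtain w where "w ^ r = a" using nth_root_exists[OF pos(1)] by blast
    ultimately show "a \<in> {w ^ r |w. w \<noteq> 0 \<and> blowup C r m 0 w = 0}"
      using root_nz[of a] pos by (auto simp: val zero_power intro!: exI[of _ w])
  qed (auto simp: val)
  have "rsquarefree \<phi>"
    unfolding rsquarefree_roots
  proof safe
    fix a assume a: "poly \<phi> a = 0" "poly (pderiv \<phi>) a = 0"
    obtain w where w: "w ^ r = a" using nth_root_exists[OF pos(1)] by blast
    hence "w \<noteq> 0" using root_nz[OF a(1)] pos by (auto simp: zero_power)
    thus False using simple_root[OF nd fin pos(1), of w m] a w by (simp add: val dval)
  qed
  thus "card {w ^ r |w. w \<noteq> 0 \<and> blowup C r m 0 w = 0} = g"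
    unfolding set_eq using rsquarefree_card_roots[OF _ nz] deg by simp
  show "finite {w ^ r |w. w \<noteq> 0 \<and> blowup C r m 0 w = 0}"
    unfolding set_eq by (rule poly_roots_finite[OF nz])
qed

section \<open>Corner coefficients\<close>

definition flip :: "bool \<Rightarrow> nat \<Rightarrow> nat \<Rightarrow> nat" where
  "flip b d i = (if b then d - i else i)"

definition flip2 :: "complex poly poly \<Rightarrow> P1 \<times> P1 \<Rightarrow> nat \<times> nat \<Rightarrow> nat \<times> nat" where
  "flip2 P p q = (flip (fst p = Inf_pt) (deg_x P) (fst q), flip (snd p = Inf_pt) (deg_y P) (snd q))"

text \<open>Coefficients in the affine chart belonging to p, which enters only through the question
  which of its coordinates are infinite. At a finite point this is \<open>cf P\<close>, not an
  expansion centred at p; at the corners the point is the origin of its chart. The bounds keep the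
  truncated subtraction in \<open>flip\<close> from producing spurious coefficients.\<close>

definition lcoef :: "complex poly poly \<Rightarrow> P1 \<times> P1 \<Rightarrow> nat \<Rightarrow> nat \<Rightarrow> complex" where
  "lcoef P p i j =
     (if i \<le> deg_x P \<and> j \<le> deg_y P
      then cf P (flip (fst p = Inf_pt) (deg_x P) i) (flip (snd p = Inf_pt) (deg_y P) j) else 0)"

lemma flip_le [simp]: "i \<le> d \<Longrightarrow> flip b d i \<le> d"
  by (simp add: flip_def)

lemma flip_flip [simp]: "i \<le> d \<Longrightarrow> flip b d (flip b d i) = i"
  by (simp add: flip_def)

lemma sum_flip: "(\<Sum>i\<le>d. f (flip b d i)) = (\<Sum>i\<le>d. f i)"
  by (rule sum.reindex_bij_witness[of _ "flip b d" "flip b d"]) auto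

lemma cf_nonzero_le:
  assumes "cf P i j \<noteq> 0"
  shows "i \<le> deg_x P" "j \<le> deg_y P"
proof -
  have "coeff P j \<noteq> 0" using assms by (auto simp: cf_def)
  thus j: "j \<le> deg_y P" unfolding deg_y_def by (rule le_degree)
  have "i \<le> degree (coeff P j)" using assms unfolding cf_def by (rule le_degree)
  also have "\<dots> \<le> deg_x P" unfolding deg_x_def using j by (intro Max_ge) (auto simp: deg_y_def)
  finally show "i \<le> deg_x P" .
qed

lemma finite_msupp_cf: "finite (msupp (cf P))"
proof (rule finite_subset)
  show "msupp (cf P) \<subseteq> {..deg_x P} \<times> {..deg_y P}"
    using cf_nonzero_le by (force simp: msupp_def)
qed auto

lemma finite_msupp_lcoef: "finite (msupp (lcoef P p))"
proof (rule finite_subset)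
  show "msupp (lcoef P p) \<subseteq> {..deg_x P} \<times> {..deg_y P}"
    by (auto simp: msupp_def lcoef_def split: if_splits)
qed auto

lemma lcoef_flip:
  assumes "i \<le> deg_x P" "j \<le> deg_y P"
  shows "lcoef P p (flip (fst p = Inf_pt) (deg_x P) i) (flip (snd p = Inf_pt) (deg_y P) j) = cf P i j"
  using assms by (simp add: lcoef_def)

lemma flip2_flip2: "fst q \<le> deg_x P \<Longrightarrow> snd q \<le> deg_y P \<Longrightarrow> flip2 P p (flip2 P p q) = q"
  by (simp add: flip2_def)

lemma msupp_lcoef: "msupp (lcoef P p) = flip2 P p ` msupp (cf P)"
proof (intro equalityI subsetI)
  fix q assume q: "q \<in> msupp (lcoef P p)"
  hence le: "fst q \<le> deg_x P" "snd q \<le> deg_y P"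
    by (auto simp: msupp_def lcoef_def split: if_splits)
  have "flip2 P p q \<in> msupp (cf P)" using q le by (simp add: msupp_def lcoef_def flip2_def)
  thus "q \<in> flip2 P p ` msupp (cf P)" using flip2_flip2[OF le] by (metis imageI)
next
  fix q assume "q \<in> flip2 P p ` msupp (cf P)"
  then obtain s where s: "s \<in> msupp (cf P)" "q = flip2 P p s" by blast
  hence "fst s \<le> deg_x P" "snd s \<le> deg_y P" using cf_nonzero_le by (auto simp: msupp_def)
  thus "q \<in> msupp (lcoef P p)" using s by (simp add: msupp_def flip2_def lcoef_flip)
qed

lemma inj_on_flip2: "inj_on (flip2 P p) (msupp (cf P))"
proof (rule inj_on_inverseI)
  fix s assume "s \<in> msupp (cf P)"
  thus "flip2 P p (flip2 P p s) = s" using cf_nonzero_le by (auto simp: msupp_def intro!: flip2_flip2)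
qed

lemma P1_hom_power:
  "i \<le> d \<Longrightarrow> fst (P1_hom a u) ^ i * snd (P1_hom a u) ^ (d - i) = u ^ flip (a = Inf_pt) d i"
  by (cases a) (simp_all add: flip_def)

lemma local_equation_eq: "local_equation P p u v = psum (msupp (lcoef P p)) (lcoef P p) u v"
proof -
  let ?bx = "fst p = Inf_pt" and ?by = "snd p = Inf_pt" and ?dx = "deg_x P" and ?dy = "deg_y P"
  have "local_equation P p u v =
     (\<Sum>i\<le>?dx. \<Sum>j\<le>?dy. cf P i j * u ^ flip ?bx ?dx i * v ^ flip ?by ?dy j)"
    unfolding local_equation_def bihom_def
  proof (intro sum.cong refl)
    fix i j assume "i \<in> {..?dx}" "j \<in> {..?dy}"
    thus "cf P i j * fst (P1_hom (fst p) u) ^ i * snd (P1_hom (fst p) u) ^ (?dx - i) *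
        fst (P1_hom (snd p) v) ^ j * snd (P1_hom (snd p) v) ^ (?dy - j) =
        cf P i j * u ^ flip ?bx ?dx i * v ^ flip ?by ?dy j"
      using P1_hom_power[of i ?dx "fst p" u] P1_hom_power[of j ?dy "snd p" v]
      by (simp add: mult.assoc)
  qed
  also have "\<dots> = (\<Sum>i\<le>?dx. \<Sum>j\<le>?dy. cf P (flip ?bx ?dx i) (flip ?by ?dy j) *
      u ^ flip ?bx ?dx (flip ?bx ?dx i) * v ^ flip ?by ?dy (flip ?by ?dy j))"
    by (subst sum_flip[of _ ?bx, symmetric], subst sum_flip[of _ ?by, symmetric]) simp
  also have "\<dots> = (\<Sum>i\<le>?dx. \<Sum>j\<le>?dy. lcoef P p i j * u ^ i * v ^ j)"
    by (intro sum.cong refl) (simp add: lcoef_def)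
  also have "\<dots> = (\<Sum>q\<in>{..?dx} \<times> {..?dy}. lcoef P p (fst q) (snd q) * u ^ fst q * v ^ snd q)"
    by (simp add: sum.cartesian_product case_prod_beta)
  also have "\<dots> = psum (msupp (lcoef P p)) (lcoef P p) u v"
    unfolding psum_def
    by (rule sum.mono_neutral_right) (auto simp: msupp_def lcoef_def split: if_splits)
  finally show ?thesis .
qed

lemma of_nat_flip: "i \<le> d \<Longrightarrow> (of_nat (flip b d i) :: 'a :: ring_1) =
    (if b then of_nat d else 0) + (if b then -1 else 1) * of_nat i"
  by (simp add: flip_def of_nat_diff)

lemma power_flip:
  assumes "i \<le> d" "(x::complex) \<noteq> 0"
  shows "x ^ flip b d i = (if b then x ^ d else 1) * (if b then inverse x else x) ^ i"
  using assms by (simp add: flip_def power_diff power_inverse divide_inverse)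

text \<open>Reversing an exponent changes the weight by a sign and a constant, and a constant does
  not affect which monomials minimise.\<close>

lemma face_flip2:
  "face \<alpha> \<beta> (flip2 P p ` msupp (cf P)) =
   flip2 P p ` face ((if fst p = Inf_pt then -1 else 1) * \<alpha>) ((if snd p = Inf_pt then -1 else 1) * \<beta>) (msupp (cf P))"
  (is "face \<alpha> \<beta> (?f ` ?S) = ?f ` face (?s * \<alpha>) (?t * \<beta>) ?S")
proof -
  have key: "\<alpha> * int (fst (?f q)) + \<beta> * int (snd (?f q)) =
      \<alpha> * (if fst p = Inf_pt then int (deg_x P) else 0) + \<beta> * (if snd p = Inf_pt then int (deg_y P) else 0)
      + ((?s * \<alpha>) * int (fst q) + (?t * \<beta>) * int (snd q))" if "q \<in> ?S" for q
  proof -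
    have le: "fst q \<le> deg_x P" "snd q \<le> deg_y P" using that cf_nonzero_le by (auto simp: msupp_def)
    show ?thesis
      unfolding flip2_def fst_conv snd_conv of_nat_flip[OF le(1), where 'a = int] of_nat_flip[OF le(2), where 'a = int]
      by (simp only: algebra_simps)
  qed
  show ?thesis
  proof (intro equalityI subsetI)
    fix z assume z: "z \<in> face \<alpha> \<beta> (?f ` ?S)"
    then obtain q where q: "q \<in> ?S" "z = ?f q" by (auto simp: face_def)
    have "?s * \<alpha> * int (fst q) + ?t * \<beta> * int (snd q) \<le> ?s * \<alpha> * int (fst w) + ?t * \<beta> * int (snd w)" if "w \<in> ?S" for w
    proof -
      have "\<alpha> * int (fst (?f q)) + \<beta> * int (snd (?f q)) \<le> \<alpha> * int (fst (?f w)) + \<beta> * int (snd (?f w))"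
        using z that unfolding face_def q by blast
      thus ?thesis unfolding key[OF q(1)] key[OF that] by linarith
    qed
    thus "z \<in> ?f ` face (?s * \<alpha>) (?t * \<beta>) ?S" unfolding q face_def using q(1) by blast
  next
    fix z assume "z \<in> ?f ` face (?s * \<alpha>) (?t * \<beta>) ?S"
    then obtain q where q: "q \<in> ?S" "z = ?f q"
      "\<And>w. w \<in> ?S \<Longrightarrow> ?s * \<alpha> * int (fst q) + ?t * \<beta> * int (snd q) \<le> ?s * \<alpha> * int (fst w) + ?t * \<beta> * int (snd w)"
      unfolding face_def by blast
    have "\<alpha> * int (fst (?f q)) + \<beta> * int (snd (?f q)) \<le> \<alpha> * int (fst (?f w)) + \<beta> * int (snd (?f w))" if "w \<in> ?S" for w
      unfolding key[OF q(1)] key[OF that] using q(3)[OF that] by linarith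
    thus "z \<in> face \<alpha> \<beta> (?f ` ?S)" unfolding q(2) face_def using q(1) by blast
  qed
qed

text \<open>Up to a common monomial factor, reversal of exponents is the substitution of 1/x or 1/y.
  It turns a logarithmic derivative into \<plusminus> itself plus a multiple of the polynomial, so
  the three expressions still vanish together.\<close>

lemma nondeg_lcoef:
  assumes nd: "nondeg (cf P)"
  shows "nondeg (lcoef P p)"
  unfolding nondeg_def
proof (intro allI impI notI)
  fix \<alpha> \<beta> :: int and x y :: complex
  assume xy: "x \<noteq> 0" "y \<noteq> 0"
  let ?bx = "fst p = Inf_pt" and ?by = "snd p = Inf_pt" and ?dx = "deg_x P" and ?dy = "deg_y P"
  let ?S = "msupp (cf P)"
  let ?s = "if ?bx then -1 else 1 :: int" and ?t = "if ?by then -1 else 1 :: int"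
  let ?s' = "if ?bx then -1 else 1 :: complex" and ?t' = "if ?by then -1 else 1 :: complex"
  let ?F = "face (?s * \<alpha>) (?t * \<beta>) ?S"
  let ?X = "if ?bx then x ^ ?dx else 1" and ?Y = "if ?by then y ^ ?dy else 1"
  let ?x = "if ?bx then inverse x else x" and ?y = "if ?by then inverse y else y"
  assume z: "psum (face \<alpha> \<beta> (msupp (lcoef P p))) (lcoef P p) x y = 0 \<and>
          psum (face \<alpha> \<beta> (msupp (lcoef P p))) (\<lambda>i j. of_nat i * lcoef P p i j) x y = 0 \<and>
          psum (face \<alpha> \<beta> (msupp (lcoef P p))) (\<lambda>i j. of_nat j * lcoef P p i j) x y = 0"
  have le: "fst q \<le> ?dx" "snd q \<le> ?dy" if "q \<in> ?F" for q
    using that subsetD[OF face_subset that] cf_nonzero_le by (auto simp: msupp_def)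
  have red: "psum (face \<alpha> \<beta> (msupp (lcoef P p))) (\<lambda>i j. h i j * lcoef P p i j) x y =
     ?X * ?Y * (\<Sum>q\<in>?F. h (flip ?bx ?dx (fst q)) (flip ?by ?dy (snd q)) * (cf P (fst q) (snd q) * ?x ^ fst q * ?y ^ snd q))"
    for h :: "nat \<Rightarrow> nat \<Rightarrow> complex"
  proof -
    have "psum (face \<alpha> \<beta> (msupp (lcoef P p))) (\<lambda>i j. h i j * lcoef P p i j) x y =
      (\<Sum>q\<in>?F. h (fst (flip2 P p q)) (snd (flip2 P p q)) * lcoef P p (fst (flip2 P p q)) (snd (flip2 P p q)) *
         x ^ fst (flip2 P p q) * y ^ snd (flip2 P p q))"
      unfolding msupp_lcoef face_flip2 psum_def
      by (subst sum.reindex[OF inj_on_subset[OF inj_on_flip2 face_subset]]) simp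
    also have "\<dots> = (\<Sum>q\<in>?F. ?X * ?Y * (h (flip ?bx ?dx (fst q)) (flip ?by ?dy (snd q)) * (cf P (fst q) (snd q) * ?x ^ fst q * ?y ^ snd q)))"
    proof (intro sum.cong refl)
      fix q assume q: "q \<in> ?F"
      show "h (fst (flip2 P p q)) (snd (flip2 P p q)) * lcoef P p (fst (flip2 P p q)) (snd (flip2 P p q)) *
         x ^ fst (flip2 P p q) * y ^ snd (flip2 P p q) = ?X * ?Y * (h (flip ?bx ?dx (fst q)) (flip ?by ?dy (snd q)) * (cf P (fst q) (snd q) * ?x ^ fst q * ?y ^ snd q))"
        unfolding flip2_def fst_conv snd_conv lcoef_flip[OF le[OF q]]
          power_flip[OF le(1)[OF q] xy(1)] power_flip[OF le(2)[OF q] xy(2)]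
        by (simp only: ac_simps)
    qed
    finally show ?thesis by (simp only: sum_distrib_left)
  qed
  have XY: "?X * ?Y \<noteq> 0" using xy by simp
  have p0: "psum ?F (cf P) ?x ?y = 0"
    using red[of "\<lambda>_ _. 1"] z XY by (simp add: psum_def)
  have p1: "psum ?F (\<lambda>i j. of_nat i * cf P i j) ?x ?y = 0"
  proof -
    have "(\<Sum>q\<in>?F. of_nat (flip ?bx ?dx (fst q)) * (cf P (fst q) (snd q) * ?x ^ fst q * ?y ^ snd q)) = 0"
      using red[of "\<lambda>i j. of_nat i"] z XY by simp
    also have "(\<Sum>q\<in>?F. of_nat (flip ?bx ?dx (fst q)) * (cf P (fst q) (snd q) * ?x ^ fst q * ?y ^ snd q)) =
      (\<Sum>q\<in>?F. (if ?bx then of_nat ?dx else 0) * (cf P (fst q) (snd q) * ?x ^ fst q * ?y ^ snd q)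
         + ?s' * (of_nat (fst q) * cf P (fst q) (snd q) * ?x ^ fst q * ?y ^ snd q))"
      by (rule sum.cong[OF refl]) (use le in \<open>simp add: of_nat_flip algebra_simps\<close>)
    also have "\<dots> = (if ?bx then of_nat ?dx else 0) * psum ?F (cf P) ?x ?y + ?s' * psum ?F (\<lambda>i j. of_nat i * cf P i j) ?x ?y"
      unfolding psum_def sum.distrib sum_distrib_left ..
    finally show ?thesis unfolding p0 by (simp split: if_splits)
  qed
  have p2: "psum ?F (\<lambda>i j. of_nat j * cf P i j) ?x ?y = 0"
  proof -
    have "(\<Sum>q\<in>?F. of_nat (flip ?by ?dy (snd q)) * (cf P (fst q) (snd q) * ?x ^ fst q * ?y ^ snd q)) = 0"
      using red[of "\<lambda>i j. of_nat j"] z XY by simp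
    also have "(\<Sum>q\<in>?F. of_nat (flip ?by ?dy (snd q)) * (cf P (fst q) (snd q) * ?x ^ fst q * ?y ^ snd q)) =
      (\<Sum>q\<in>?F. (if ?by then of_nat ?dy else 0) * (cf P (fst q) (snd q) * ?x ^ fst q * ?y ^ snd q)
         + ?t' * (of_nat (snd q) * cf P (fst q) (snd q) * ?x ^ fst q * ?y ^ snd q))"
      by (rule sum.cong[OF refl]) (use le in \<open>simp add: of_nat_flip algebra_simps\<close>)
    also have "\<dots> = (if ?by then of_nat ?dy else 0) * psum ?F (cf P) ?x ?y + ?t' * psum ?F (\<lambda>i j. of_nat j * cf P i j) ?x ?y"
      unfolding psum_def sum.distrib sum_distrib_left ..
    finally show ?thesis unfolding p0 by (simp split: if_splits)
  qed
  show False
    by (rule nondegD[OF nd _ _ p0 p1 p2]) (use xy in auto)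
qed

section \<open>Reflected polynomials and monomials on the axes\<close>

lemma cf_reflect_poly: "cf (reflect_poly P) i j = lcoef P (Aff 0, Inf_pt) i j"
proof (cases "i \<le> deg_x P")
  case False
  hence "cf P i k = 0" for k using cf_nonzero_le(1)[of P i k] by blast
  thus ?thesis using False by (auto simp: cf_def coeff_reflect_poly lcoef_def)
qed (simp add: cf_def coeff_reflect_poly lcoef_def flip_def deg_y_def)

lemma degree_coeff_le_deg_x: "degree (coeff P j) \<le> deg_x P"
proof (cases "coeff P j = 0")
  case False
  hence "cf P (degree (coeff P j)) j \<noteq> 0" by (simp add: cf_def)
  thus ?thesis by (rule cf_nonzero_le)
qed auto

text \<open>\<open>reflect_poly\<close> reverses each coefficient with respect to its own degree;
  the monomial factor makes up the difference to the common degree \<open>deg_x P\<close>.\<close>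

lemma cf_reflect_x: "cf (reflect_x P) i j = lcoef P (Inf_pt, Aff 0) i j"
proof -
  let ?c = "coeff P j"
  have "cf (reflect_x P) i j = coeff (monom 1 (deg_x P - degree ?c) * reflect_poly ?c) i"
    unfolding cf_def reflect_x_def by (subst coeff_map_poly) auto
  also have "\<dots> = (if i \<le> deg_x P then coeff ?c (deg_x P - i) else 0)"
    using degree_coeff_le_deg_x[of P j]
    by (auto simp: coeff_monom_mult coeff_reflect_poly coeff_eq_0)
  also have "\<dots> = lcoef P (Inf_pt, Aff 0) i j"
    by (auto simp: lcoef_def flip_def cf_def deg_y_def coeff_eq_0)
  finally show ?thesis .
qed

lemma cf_dx: 
  assumes "deg_x P > 0"
  shows "\<exists>j. cf P (deg_x P) j \<noteq> 0"
proof -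
  have "deg_x P \<in> (\<lambda>j. degree (coeff P j)) ` {..degree P}"
    unfolding deg_x_def by (rule Max_in) auto
  then obtain j where "deg_x P = degree (coeff P j)" by blast
  hence "cf P (deg_x P) j = lead_coeff (coeff P j)" "coeff P j \<noteq> 0" using assms by (auto simp: cf_def)
  thus ?thesis by (metis leading_coeff_0_iff)
qed

lemma cf_dy: 
  assumes "deg_y P > 0"
  shows "\<exists>i. cf P i (deg_y P) \<noteq> 0"
proof -
  have "coeff P (deg_y P) \<noteq> 0" using assms by (auto simp: deg_y_def)
  thus ?thesis unfolding cf_def by (metis leading_coeff_0_iff)
qed

text \<open>Otherwise x divides P, and irreducibility leaves P a unit times x, of degree 0 in
  y.\<close>

lemma cf_0x:
  assumes irr: "irreducible P" and dy: "deg_y P > 0"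
  shows "\<exists>j. cf P 0 j \<noteq> 0"
proof (rule ccontr)
  assume "\<nexists>j. cf P 0 j \<noteq> 0"
  hence "[:0, 1:] dvd coeff P j" for j
    by (simp add: cf_def poly_eq_0_iff_dvd[of _ 0, simplified, symmetric] poly_0_coeff_0)
  hence "[:[:0, 1:]:] dvd P" by (simp add: const_poly_dvd_iff)
  then obtain R where R: "P = [:[:0, 1:]:] * R" by (elim dvdE)
  have "\<not> is_unit [:[:0, 1:] :: complex poly:]"
    by (simp only: is_unit_const_poly_iff is_unit_pCons_iff) simp
  hence "is_unit R" using irreducibleD[OF irr R] by blast
  then obtain c where "R = [:c:]" unfolding is_unit_poly_iff by blast
  thus False using R dy by (simp add: deg_y_def)
qed

lemma cf_y0:
  assumes irr: "irreducible P" and dx: "deg_x P > 0"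
  shows "\<exists>i. cf P i 0 \<noteq> 0"
proof (rule ccontr)
  assume "\<nexists>i. cf P i 0 \<noteq> 0"
  hence "coeff P 0 = 0" by (simp add: cf_def poly_eq_iff)
  hence "poly P 0 = 0" by (simp add: poly_0_coeff_0)
  hence "[:0, 1:] dvd P" by (simp add: poly_eq_0_iff_dvd)
  then obtain R where R: "P = [:0, 1:] * R" by (elim dvdE)
  have "\<not> is_unit [:0, 1 :: complex poly:]"
    unfolding is_unit_poly_iff by simp
  hence "is_unit R" using irreducibleD[OF irr R] by blast
  then obtain c where c: "R = [:c:]" "c dvd 1" unfolding is_unit_poly_iff by blast
  obtain d where d: "c = [:d:]" using c(2) unfolding is_unit_poly_iff by blast
  obtain j where "cf P (deg_x P) j \<noteq> 0" using cf_dx[OF dx] by blast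
  thus False using dx unfolding cf_def R c d by (simp add: coeff_pCons split: nat.splits)
qed

text \<open>At a finite coordinate this is indivisibility of P by x or y, at an infinite one it is
  the fact that the degrees are attained. Hence the Newton diagram at every corner reaches both
  axes.\<close>

lemma lcoef_axes:
  assumes "irreducible P" "deg_x P > 0" "deg_y P > 0"
  shows "\<exists>a. lcoef P p a 0 \<noteq> 0" "\<exists>b. lcoef P p 0 b \<noteq> 0"
proof -
  have "\<exists>i. cf P i (flip (snd p = Inf_pt) (deg_y P) 0) \<noteq> 0"
    using cf_y0[OF assms(1,2)] cf_dy[OF assms(3)] by (simp add: flip_def)
  then obtain i where i: "cf P i (flip (snd p = Inf_pt) (deg_y P) 0) \<noteq> 0" by blast
  have "lcoef P p (flip (fst p = Inf_pt) (deg_x P) i) 0 = cf P i (flip (snd p = Inf_pt) (deg_y P) 0)"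
    using cf_nonzero_le(1)[OF i] by (simp add: lcoef_def)
  thus "\<exists>a. lcoef P p a 0 \<noteq> 0" using i by metis
  have "\<exists>j. cf P (flip (fst p = Inf_pt) (deg_x P) 0) j \<noteq> 0"
    using cf_0x[OF assms(1,3)] cf_dx[OF assms(2)] by (simp add: flip_def)
  then obtain j where j: "cf P (flip (fst p = Inf_pt) (deg_x P) 0) j \<noteq> 0" by blast
  have "lcoef P p 0 (flip (snd p = Inf_pt) (deg_y P) j) = cf P (flip (fst p = Inf_pt) (deg_x P) 0) j"
    using cf_nonzero_le(2)[OF j] by (simp add: lcoef_def)
  thus "\<exists>b. lcoef P p 0 b \<noteq> 0" using j by metis
qed

section \<open>Charts of a Riemann surface\<close>

lemma chartsD:
  assumes "c \<in> charts X"
  shows "openin (surf_top X) (fst c)" "open (snd c ` fst c)"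
    "homeomorphic_map (subtopology (surf_top X) (fst c)) (top_of_set (snd c ` fst c)) (snd c)"
    "\<And>d. d \<in> atlas X \<Longrightarrow> compatible c d"
    "fst c \<subseteq> topspace (surf_top X)" "inj_on (snd c) (fst c)"
proof -
  show 1: "openin (surf_top X) (fst c)" "open (snd c ` fst c)"
    "homeomorphic_map (subtopology (surf_top X) (fst c)) (top_of_set (snd c ` fst c)) (snd c)"
    "\<And>d. d \<in> atlas X \<Longrightarrow> compatible c d"
    using assms unfolding charts_def is_chart_def by blast+
  show 2: "fst c \<subseteq> topspace (surf_top X)" using 1(1) by (rule openin_subset)
  show "inj_on (snd c) (fst c)"
    using homeomorphic_imp_injective_map[OF 1(3)] 2 by (simp add: inf.absorb2)
qed

lemma param_in:
  assumes "z \<in> snd c ` fst c"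
  shows "param c z \<in> fst c" "snd c (param c z) = z"
  using assms unfolding param_def by (auto intro: inv_into_into f_inv_into_f)

lemma param_snd: "c \<in> charts X \<Longrightarrow> q \<in> fst c \<Longrightarrow> param c (snd c q) = q"
  unfolding param_def using chartsD(6) by (rule inv_into_f_f)

lemma chart_image_open:
  assumes c: "c \<in> charts X" and U: "openin (surf_top X) U" "U \<subseteq> fst c"
  shows "open (snd c ` U)"
proof -
  have "openin (subtopology (surf_top X) (fst c)) U"
    using U by (simp add: openin_open_subtopology chartsD(1)[OF c])
  hence "openin (top_of_set (snd c ` fst c)) (snd c ` U)"
    using homeomorphic_imp_open_map[OF chartsD(3)[OF c]] unfolding open_map_def by blast
  thus ?thesis using chartsD(2)[OF c] by (simp add: openin_open_eq)
qed

lemma chart_preimage_open: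
  assumes c: "c \<in> charts X" and V: "open V" "V \<subseteq> snd c ` fst c"
  shows "openin (surf_top X) {q \<in> fst c. snd c q \<in> V}"
proof -
  have "continuous_map (subtopology (surf_top X) (fst c)) (top_of_set (snd c ` fst c)) (snd c)"
    using homeomorphic_imp_continuous_map[OF chartsD(3)[OF c]] .
  moreover have "openin (top_of_set (snd c ` fst c)) V"
    using V chartsD(2)[OF c] by (simp add: openin_open_eq)
  ultimately have "openin (subtopology (surf_top X) (fst c)) {q \<in> topspace (subtopology (surf_top X) (fst c)). snd c q \<in> V}"
    by (rule openin_continuous_map_preimage)
  hence "openin (subtopology (surf_top X) (fst c)) {q \<in> fst c. snd c q \<in> V}"
    unfolding topspace_subtopology inf.absorb2[OF chartsD(5)[OF c]] .
  thus ?thesis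
    unfolding openin_open_subtopology[OF chartsD(1)[OF c]] by blast
qed

text \<open>Members of \<open>charts\<close> are only required to be compatible with the atlas, so
  the transition is factored through an atlas chart around each point.\<close>

lemma charts_transition_holomorphic:
  assumes X: "riemann_surface X" and c: "c \<in> charts X" and d: "d \<in> charts X"
  shows "transition c d holomorphic_on snd c ` (fst c \<inter> fst d)"
  unfolding holomorphic_on_def
proof
  fix z assume "z \<in> snd c ` (fst c \<inter> fst d)"
  then obtain q where q: "q \<in> fst c" "q \<in> fst d" "z = snd c q" by blast
  have "q \<in> topspace (surf_top X)" using q chartsD(5)[OF c] by blast
  then obtain a where a: "a \<in> atlas X" "q \<in> fst a"
    using X unfolding riemann_surface_def by blast
  have ac: "a \<in> charts X"
    using X a unfolding riemann_surface_def charts_def by blast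
  define U where "U = fst c \<inter> fst d \<inter> fst a"
  have U: "openin (surf_top X) U" "q \<in> U" "U \<subseteq> fst c" "U \<subseteq> fst d" "U \<subseteq> fst a"
    using chartsD(1)[OF c] chartsD(1)[OF d] chartsD(1)[OF ac] q a by (auto simp: U_def)
  have "transition c a holomorphic_on snd c ` (fst c \<inter> fst a)"
    using chartsD(4)[OF c a(1)] unfolding compatible_def by blast
  hence 1: "transition c a holomorphic_on snd c ` U"
    by (rule holomorphic_on_subset) (use U in blast)
  have "transition a d holomorphic_on snd a ` (fst d \<inter> fst a)"
    using chartsD(4)[OF d a(1)] unfolding compatible_def by blast
  hence 2: "transition a d holomorphic_on snd a ` U"
    by (rule holomorphic_on_subset) (use U in blast)
  have im: "transition c a ` snd c ` U \<subseteq> snd a ` U"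
    using U(3) by (auto simp: transition_def param_snd[OF c])
  have hol: "(transition a d \<circ> transition c a) holomorphic_on snd c ` U"
    by (rule holomorphic_on_compose_gen[OF 1 2]) (use im in blast)
  have "transition c d holomorphic_on snd c ` U"
  proof (rule holomorphic_transform[OF hol])
    fix w assume "w \<in> snd c ` U"
    then obtain p where p: "p \<in> U" "w = snd c p" by blast
    hence "p \<in> fst c" "p \<in> fst a" using U by blast+
    thus "(transition a d \<circ> transition c a) w = transition c d w"
      by (simp add: transition_def p param_snd[OF c] param_snd[OF ac])
  qed
  hence "transition c d field_differentiable (at z)"
    using chart_image_open[OF c U(1,3)] U(2) q(3) holomorphic_on_imp_differentiable_at by blast
  thus "transition c d field_differentiable (at z within snd c ` (fst c \<inter> fst d))"
    by (rule field_differentiable_at_within)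
qed

text \<open>Used to pass to standard coordinates. An injective holomorphic \<phi> has a holomorphic
  inverse on its image, which gives both the homeomorphism and the compatibility with the
  atlas.\<close>

lemma chart_reparametrise:
  assumes X: "riemann_surface X" and c: "c \<in> charts X" and V: "open V" "V \<subseteq> snd c ` fst c"
    and \<phi>: "\<phi> holomorphic_on V" "inj_on \<phi> V"
  defines "c' \<equiv> ({q \<in> fst c. snd c q \<in> V}, \<phi> \<circ> snd c)"
  shows "c' \<in> charts X" "\<And>z. z \<in> V \<Longrightarrow> param c' (\<phi> z) = param c z" "snd c' ` fst c' = \<phi> ` V"
proof -
  let ?U = "{q \<in> fst c. snd c q \<in> V}"
  have opU: "openin (surf_top X) ?U" by (rule chart_preimage_open[OF c V])
  have imU: "snd c ` ?U = V" using V(2) by auto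
  show im: "snd c' ` fst c' = \<phi> ` V"
    unfolding c'_def fst_conv snd_conv image_comp[symmetric] imU ..
  obtain g where g: "g holomorphic_on (\<phi> ` V)" "\<And>z. z \<in> V \<Longrightarrow> g (\<phi> z) = z"
    using holomorphic_has_inverse[OF \<phi>(1) V(1) \<phi>(2)] by metis
  have opim: "open (\<phi> ` V)" by (rule open_mapping_thm3[OF \<phi>(1) V(1) \<phi>(2)])
  have inj': "inj_on (\<phi> \<circ> snd c) ?U"
  proof (rule comp_inj_on)
    show "inj_on (snd c) ?U" by (rule inj_on_subset[OF chartsD(6)[OF c]]) blast
    show "inj_on \<phi> (snd c ` ?U)" unfolding imU by fact
  qed
  show par: "param c' (\<phi> z) = param c z" if "z \<in> V" for z
  proof -
    have z: "z \<in> snd c ` fst c" using that V by blast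
    have "param c z \<in> ?U" "(\<phi> \<circ> snd c) (param c z) = \<phi> z"
      using param_in[OF z] that by simp_all
    thus ?thesis
      using inv_into_f_f[OF inj', of "param c z"]
      by (simp add: c'_def param_def[of "({q \<in> fst c. snd c q \<in> V}, \<phi> \<circ> snd c)"])
  qed
  have homeo: "homeomorphic_map (subtopology (surf_top X) ?U) (top_of_set (\<phi> ` V)) (\<phi> \<circ> snd c)"
  proof (rule homeomorphic_map_compose)
    have "homeomorphic_map (subtopology (subtopology (surf_top X) (fst c)) ?U)
            (subtopology (top_of_set (snd c ` fst c)) (snd c ` ?U)) (snd c)"
      using homeomorphic_map_subtopologies[OF chartsD(3)[OF c], of ?U "snd c ` ?U"] chartsD(5)[OF c] imU V(2)
      by force
    moreover have "fst c \<inter> ?U = ?U" by blast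
    moreover have "snd c ` fst c \<inter> V = V" using V by blast
    ultimately show "homeomorphic_map (subtopology (surf_top X) ?U) (top_of_set V) (snd c)"
      unfolding imU subtopology_subtopology by simp
    have "homeomorphic_maps (top_of_set V) (top_of_set (\<phi> ` V)) \<phi> g"
      unfolding homeomorphic_maps_def continuous_map_in_subtopology continuous_map_iff_continuous
      using holomorphic_on_imp_continuous_on[OF \<phi>(1)] holomorphic_on_imp_continuous_on[OF g(1)] g(2)
      by auto
    thus "homeomorphic_map (top_of_set V) (top_of_set (\<phi> ` V)) \<phi>"
      unfolding homeomorphic_map_maps by blast
  qed
  have chart: "is_chart (surf_top X) c'"
    unfolding is_chart_def im using opU opim homeo by (simp add: c'_def)
  have comp: "compatible c' d" if d: "d \<in> atlas X" for d
    unfolding compatible_def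
  proof
    have fsub: "fst c' \<subseteq> fst c" by (auto simp: c'_def)
    have cd: "transition c d holomorphic_on snd c ` (fst c \<inter> fst d)"
      "transition d c holomorphic_on snd d ` (fst c \<inter> fst d)"
      using chartsD(4)[OF c d] unfolding compatible_def by blast+
    have "transition c d \<circ> g holomorphic_on snd c' ` (fst c' \<inter> fst d)"
    proof (rule holomorphic_on_compose_gen)
      show "g holomorphic_on snd c' ` (fst c' \<inter> fst d)"
        by (rule holomorphic_on_subset[OF g(1)]) (use im in blast)
      show "transition c d holomorphic_on snd c ` (fst c \<inter> fst d)" by fact
      show "g ` (snd c' ` (fst c' \<inter> fst d)) \<subseteq> snd c ` (fst c \<inter> fst d)"
        using g(2) by (auto simp: c'_def)
    qed
    thus "transition c' d holomorphic_on snd c' ` (fst c' \<inter> fst d)"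
    proof (rule holomorphic_transform)
      fix w assume "w \<in> snd c' ` (fst c' \<inter> fst d)"
      then obtain z where "z \<in> V" "w = \<phi> z" by (auto simp: c'_def)
      thus "(transition c d \<circ> g) w = transition c' d w"
        using par g(2) by (simp add: transition_def)
    qed
    have "\<phi> \<circ> transition d c holomorphic_on snd d ` (fst c' \<inter> fst d)"
    proof (rule holomorphic_on_compose_gen)
      show "transition d c holomorphic_on snd d ` (fst c' \<inter> fst d)"
        by (rule holomorphic_on_subset[OF cd(2)]) (use fsub in blast)
      show "\<phi> holomorphic_on V" by fact
      have "d \<in> charts X"
        using X d unfolding riemann_surface_def charts_def by blast
      thus "transition d c ` (snd d ` (fst c' \<inter> fst d)) \<subseteq> V"
        using d by (auto simp: transition_def param_snd c'_def)
    qed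
    thus "transition d c' holomorphic_on snd d ` (fst c' \<inter> fst d)"
      by (simp add: transition_def c'_def o_assoc)
  qed
  show "c' \<in> charts X" unfolding charts_def using chart comp by blast
qed

section \<open>The normalisation near a corner\<close>

text \<open>\<open>holomorphic_to_P1\<close> offers one suitable chart per point; composition with a
  transition map carries the statement to a prescribed chart, on a smaller disc.\<close>

lemma holomorphic_to_P1_local:
  assumes X: "riemann_surface X" and f: "holomorphic_to_P1 X f" and c: "c \<in> charts X" and q: "q \<in> fst c"
  obtains \<epsilon> where "\<epsilon> > 0" "ball (snd c q) \<epsilon> \<subseteq> snd c ` fst c"
    "\<forall>z\<in>ball (snd c q) \<epsilon>. f (param c z) \<in> P1_dom (f q)"
    "(\<lambda>z. P1_coord (f q) (f (param c z))) holomorphic_on ball (snd c q) \<epsilon>"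
proof -
  have "q \<in> topspace (surf_top X)" using q chartsD(5)[OF c] by blast
  then obtain d where d: "d \<in> charts X" "q \<in> fst d" "f ` fst d \<subseteq> P1_dom (f q)"
    "(\<lambda>z. P1_coord (f q) (f (param d z))) holomorphic_on snd d ` fst d"
    using f unfolding holomorphic_to_P1_def by blast
  let ?U = "fst c \<inter> fst d"
  have "open (snd c ` ?U)"
    by (rule chart_image_open[OF c openin_Int[OF chartsD(1)[OF c] chartsD(1)[OF d(1)]]]) blast
  moreover have "snd c q \<in> snd c ` ?U" using q d by blast
  ultimately obtain \<epsilon> where \<epsilon>: "\<epsilon> > 0" "ball (snd c q) \<epsilon> \<subseteq> snd c ` ?U"
    unfolding open_contains_ball by blast
  have hol: "((\<lambda>z. P1_coord (f q) (f (param d z))) \<circ> transition c d) holomorphic_on ball (snd c q) \<epsilon>"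
  proof (rule holomorphic_on_compose_gen)
    show "transition c d holomorphic_on ball (snd c q) \<epsilon>"
      by (rule holomorphic_on_subset[OF charts_transition_holomorphic[OF X c d(1)] \<epsilon>(2)])
    show "(\<lambda>z. P1_coord (f q) (f (param d z))) holomorphic_on snd d ` fst d" by fact
    show "transition c d ` ball (snd c q) \<epsilon> \<subseteq> snd d ` fst d"
    proof
      fix w assume "w \<in> transition c d ` ball (snd c q) \<epsilon>"
      then obtain p where "p \<in> ?U" "w = transition c d (snd c p)" using \<epsilon>(2) by blast
      thus "w \<in> snd d ` fst d" by (simp add: transition_def param_snd[OF c])
    qed
  qed
  have pt: "\<exists>p\<in>?U. z = snd c p \<and> param c z = p" if "z \<in> ball (snd c q) \<epsilon>" for z
  proof -
    have "z \<in> snd c ` ?U" using \<epsilon>(2) that by (rule subsetD)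
    then obtain p where "p \<in> ?U" "z = snd c p" by (elim imageE) simp
    thus ?thesis using param_snd[OF c] by auto
  qed
  show ?thesis
  proof (rule that[OF \<epsilon>(1)])
    show "ball (snd c q) \<epsilon> \<subseteq> snd c ` fst c" using \<epsilon>(2) by blast
    show "\<forall>z\<in>ball (snd c q) \<epsilon>. f (param c z) \<in> P1_dom (f q)"
      using pt d(3) by blast
    show "(\<lambda>z. P1_coord (f q) (f (param c z))) holomorphic_on ball (snd c q) \<epsilon>"
    proof (rule holomorphic_transform[OF hol])
      fix z assume "z \<in> ball (snd c q) \<epsilon>"
      then obtain p where "p \<in> ?U" "z = snd c p" "param c z = p" using pt by blast
      thus "((\<lambda>z. P1_coord (f q) (f (param d z))) \<circ> transition c d) z = P1_coord (f q) (f (param c z))"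
        by (simp add: transition_def param_snd[OF d(1)])
    qed
  qed
qed

lemma bihom_scale_left: "bihom P (s * a, s * b) Y = s ^ deg_x P * bihom P (a, b) Y"
proof -
  have "s ^ deg_x P = s ^ i * s ^ (deg_x P - i)" if "i \<le> deg_x P" for i
    using that by (simp flip: power_add)
  thus ?thesis
    unfolding bihom_def sum_distrib_left fst_conv snd_conv
    by (intro sum.cong refl) (simp add: power_mult_distrib)
qed

lemma bihom_scale_right: "bihom P X (s * a, s * b) = s ^ deg_y P * bihom P X (a, b)"
proof -
  have "s ^ deg_y P = s ^ i * s ^ (deg_y P - i)" if "i \<le> deg_y P" for i
    using that by (simp flip: power_add)
  thus ?thesis
    unfolding bihom_def sum_distrib_left fst_conv snd_conv
    by (intro sum.cong refl) (simp add: power_mult_distrib)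
qed

lemma P1_hom_rescale:
  assumes "a \<in> {Aff 0, Inf_pt}" "x \<in> P1_dom a"
  obtains s where "s \<noteq> 0"
    "P1_hom x (aff x) = (s * fst (P1_hom a (P1_coord a x)), s * snd (P1_hom a (P1_coord a x)))"
proof (cases x)
  case (Aff t)
  show ?thesis
  proof (cases "a = Inf_pt")
    case True
    thus ?thesis using that[of t] Aff assms by auto
  next
    case False
    thus ?thesis using that[of 1] Aff assms by auto
  qed
next
  case Inf_pt
  thus ?thesis using that[of 1] assms by auto
qed

text \<open>Membership in \<open>proj_curve\<close> is tested in the chart of the point z itself,
  while near a corner one chart has to serve all points. By bihomogeneity the two equations differ
  by a nonzero factor.\<close>

lemma proj_curve_iff:
  assumes "fst p \<in> {Aff 0, Inf_pt}" "snd p \<in> {Aff 0, Inf_pt}" "fst z \<in> P1_dom (fst p)" "snd z \<in> P1_dom (snd p)"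
  shows "z \<in> proj_curve P \<longleftrightarrow> local_equation P p (P1_coord (fst p) (fst z)) (P1_coord (snd p) (snd z)) = 0"
proof -
  obtain s where s: "s \<noteq> 0" "P1_hom (fst z) (aff (fst z)) =
      (s * fst (P1_hom (fst p) (P1_coord (fst p) (fst z))), s * snd (P1_hom (fst p) (P1_coord (fst p) (fst z))))"
    using P1_hom_rescale[OF assms(1,3)] by blast
  obtain t where t: "t \<noteq> 0" "P1_hom (snd z) (aff (snd z)) =
      (t * fst (P1_hom (snd p) (P1_coord (snd p) (snd z))), t * snd (P1_hom (snd p) (P1_coord (snd p) (snd z))))"
    using P1_hom_rescale[OF assms(2,4)] by blast
  have "local_equation P z (aff (fst z)) (aff (snd z)) =
      s ^ deg_x P * (t ^ deg_y P * local_equation P p (P1_coord (fst p) (fst z)) (P1_coord (snd p) (snd z)))"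
    unfolding local_equation_def s(2) t(2) bihom_scale_left bihom_scale_right by simp
  thus ?thesis using s(1) t(1) by (simp add: proj_curve_def)
qed

lemma P1_coord_inj:
  assumes "x \<in> P1_dom a" "y \<in> P1_dom a" "P1_coord a x = P1_coord a y"
  shows "x = y"
  using assms by (cases a; cases x; cases y) auto

lemma P1_coord_corner [simp]: "a \<in> {Aff 0, Inf_pt} \<Longrightarrow> P1_coord a a = 0"
  by auto

lemma P1_dom_self [simp]: "a \<in> P1_dom a"
  by (cases a) auto

text \<open>Injectivity over smooth points and finiteness over singular ones prevent a disc from
  being contracted to finitely many points.\<close>

lemma normalisation_image_infinite:
  assumes "normalisation P X \<eta>" "U \<subseteq> topspace (surf_top X)" "infinite U"
  shows "infinite (\<eta> ` U)"
proof
  assume fin: "finite (\<eta> ` U)"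
  let ?A = "{q \<in> topspace (surf_top X). \<eta> q \<in> singular_points P}"
  let ?B = "{q \<in> topspace (surf_top X). \<eta> q \<notin> singular_points P}"
  have "finite (\<eta> ` (U \<inter> ?B))" by (rule finite_subset[OF _ fin]) blast
  moreover have "inj_on \<eta> (U \<inter> ?B)"
    using assms(1) unfolding normalisation_def by (meson inf_le2 inj_on_subset)
  ultimately have "finite (U \<inter> ?B)" by (rule finite_imageD)
  moreover have "finite (U \<inter> ?A)" using assms(1) unfolding normalisation_def by simp
  ultimately have "finite ((U \<inter> ?A) \<union> (U \<inter> ?B))" by simp
  moreover have "(U \<inter> ?A) \<union> (U \<inter> ?B) = U" using assms(2) by blast
  ultimately show False using assms(3) by simp
qed

lemma finite_roots_psum_0_y:
  assumes "finite (msupp C)" "C 0 b \<noteq> 0"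
  shows "finite {v. psum (msupp C) C 0 v = 0}"
proof -
  let ?S = "{p \<in> msupp C. fst p = 0}"
  define \<phi> where "\<phi> = (\<Sum>p\<in>?S. monom (C 0 (snd p)) (snd p))"
  have "coeff \<phi> b = (\<Sum>p\<in>?S. if p = (0, b) then C 0 b else 0)"
    unfolding \<phi>_def coeff_sum by (intro sum.cong refl) (auto simp: prod_eq_iff)
  also have "\<dots> = C 0 b" using assms by (simp add: msupp_def)
  finally have "\<phi> \<noteq> 0" using assms by auto
  moreover have "psum (msupp C) C 0 v = poly \<phi> v" for v
    unfolding psum_x_0[OF assms(1)] \<phi>_def poly_sum unfolding psum_def
    by (intro sum.cong refl) (auto simp: poly_monom)
  ultimately show ?thesis by (simp add: poly_roots_finite)
qed

lemma finite_roots_psum_0_x: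
  assumes "finite (msupp C)" "C a 0 \<noteq> 0"
  shows "finite {u. psum (msupp C) C u 0 = 0}"
proof -
  let ?S = "{p \<in> msupp C. snd p = 0}"
  define \<phi> where "\<phi> = (\<Sum>p\<in>?S. monom (C (fst p) 0) (fst p))"
  have "coeff \<phi> a = (\<Sum>p\<in>?S. if p = (a, 0) then C a 0 else 0)"
    unfolding \<phi>_def coeff_sum by (intro sum.cong refl) (auto simp: prod_eq_iff)
  also have "\<dots> = C a 0" using assms by (simp add: msupp_def)
  finally have "\<phi> \<noteq> 0" using assms by auto
  moreover have "psum (msupp C) C u 0 = poly \<phi> u" for u
    unfolding psum_y_0[OF assms(1)] \<phi>_def poly_sum unfolding psum_def
    by (intro sum.cong refl) (auto simp: poly_monom)
  ultimately show ?thesis by (simp add: poly_roots_finite)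
qed

text \<open>The substance is that u and v are not identically zero, so that both have a finite order
  at q. Along u = 0 the values of v would be roots of the local equation restricted to the axis,
  which is a nonzero polynomial by \<open>lcoef_axes\<close>.\<close>

lemma normalisation_local_coordinates:
  assumes norm: "normalisation P X \<eta>" and irr: "irreducible P" "deg_x P > 0" "deg_y P > 0"
    and c: "c \<in> charts X" "q \<in> fst c"
    and corner: "fst (\<eta> q) \<in> {Aff 0, Inf_pt}" "snd (\<eta> q) \<in> {Aff 0, Inf_pt}"
  defines "u \<equiv> \<lambda>z. P1_coord (fst (\<eta> q)) (fst (\<eta> (param c z)))"
    and "v \<equiv> \<lambda>z. P1_coord (snd (\<eta> q)) (snd (\<eta> (param c z)))"
  obtains \<epsilon> where "\<epsilon> > 0" "ball (snd c q) \<epsilon> \<subseteq> snd c ` fst c"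
    "u holomorphic_on ball (snd c q) \<epsilon>" "v holomorphic_on ball (snd c q) \<epsilon>"
    "u (snd c q) = 0" "v (snd c q) = 0"
    "\<exists>z\<in>ball (snd c q) \<epsilon>. u z \<noteq> 0" "\<exists>z\<in>ball (snd c q) \<epsilon>. v z \<noteq> 0"
    "\<And>z. z \<in> ball (snd c q) \<epsilon> \<Longrightarrow> fst (\<eta> (param c z)) \<in> P1_dom (fst (\<eta> q))"
    "\<And>z. z \<in> ball (snd c q) \<epsilon> \<Longrightarrow> snd (\<eta> (param c z)) \<in> P1_dom (snd (\<eta> q))"
    "\<And>z. z \<in> ball (snd c q) \<epsilon> \<Longrightarrow> local_equation P (\<eta> q) (u z) (v z) = 0"
proof -
  have X: "riemann_surface X" "holomorphic_to_P1 X (fst \<circ> \<eta>)" "holomorphic_to_P1 X (snd \<circ> \<eta>)"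
    "\<eta> ` topspace (surf_top X) = proj_curve P"
    using norm unfolding normalisation_def by blast+
  obtain \<epsilon>1 where \<epsilon>1: "\<epsilon>1 > 0" "ball (snd c q) \<epsilon>1 \<subseteq> snd c ` fst c"
    "\<forall>z\<in>ball (snd c q) \<epsilon>1. (fst \<circ> \<eta>) (param c z) \<in> P1_dom ((fst \<circ> \<eta>) q)"
    "(\<lambda>z. P1_coord ((fst \<circ> \<eta>) q) ((fst \<circ> \<eta>) (param c z))) holomorphic_on ball (snd c q) \<epsilon>1"
    by (rule holomorphic_to_P1_local[OF X(1,2) c]) (rule that; assumption)
  obtain \<epsilon>2 where \<epsilon>2: "\<epsilon>2 > 0" "ball (snd c q) \<epsilon>2 \<subseteq> snd c ` fst c"
    "\<forall>z\<in>ball (snd c q) \<epsilon>2. (snd \<circ> \<eta>) (param c z) \<in> P1_dom ((snd \<circ> \<eta>) q)"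
    "(\<lambda>z. P1_coord ((snd \<circ> \<eta>) q) ((snd \<circ> \<eta>) (param c z))) holomorphic_on ball (snd c q) \<epsilon>2"
    by (rule holomorphic_to_P1_local[OF X(1,3) c]) (rule that; assumption)
  define \<epsilon> where "\<epsilon> = min \<epsilon>1 \<epsilon>2"
  let ?B = "ball (snd c q) \<epsilon>"
  have sub: "?B \<subseteq> ball (snd c q) \<epsilon>1" "?B \<subseteq> ball (snd c q) \<epsilon>2" unfolding \<epsilon>_def by auto
  have \<epsilon>: "\<epsilon> > 0" using \<epsilon>1 \<epsilon>2 by (simp add: \<epsilon>_def)
  have im: "?B \<subseteq> snd c ` fst c" using sub \<epsilon>1 by blast
  have hol: "u holomorphic_on ?B" "v holomorphic_on ?B"
    using holomorphic_on_subset[OF \<epsilon>1(4) sub(1)] holomorphic_on_subset[OF \<epsilon>2(4) sub(2)]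
    unfolding u_def v_def by simp_all
  have dom: "fst (\<eta> (param c z)) \<in> P1_dom (fst (\<eta> q))" "snd (\<eta> (param c z)) \<in> P1_dom (snd (\<eta> q))"
    if "z \<in> ?B" for z
    using bspec[OF \<epsilon>1(3) subsetD[OF sub(1) that]] bspec[OF \<epsilon>2(3) subsetD[OF sub(2) that]] by simp_all
  have top: "param c z \<in> topspace (surf_top X)" if "z \<in> ?B" for z
    using param_in(1)[OF subsetD[OF im that]] chartsD(5)[OF c(1)] by blast
  have loc: "local_equation P (\<eta> q) (u z) (v z) = 0" if "z \<in> ?B" for z
  proof -
    have "\<eta> (param c z) \<in> proj_curve P" using X(4) top[OF that] by blast
    thus ?thesis unfolding u_def v_def using proj_curve_iff[OF corner dom[OF that]] by blast
  qed
  have q0: "u (snd c q) = 0" "v (snd c q) = 0"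
    unfolding u_def v_def param_snd[OF c] using corner by simp_all
  \<comment> \<open>If \<open>u\<close> or \<open>v\<close> vanished identically, the disc would map to finitely many points of the curve.\<close>
  have inf: "infinite (\<eta> ` (param c ` ?B))"
  proof (rule normalisation_image_infinite[OF norm])
    show "param c ` ?B \<subseteq> topspace (surf_top X)" using top by blast
    have "inj_on (param c) ?B"
      by (rule inj_on_inverseI[of _ "snd c"]) (rule param_in(2)[OF subsetD[OF im]])
    moreover have "infinite ?B"
    proof -
      have "uncountable ?B" by (rule uncountable_ball[OF \<epsilon>])
      thus ?thesis using countable_finite by blast
    qed
    ultimately show "infinite (param c ` ?B)" by (simp add: finite_image_iff)
  qed
  let ?C = "lcoef P (\<eta> q)"
  obtain a b where ab: "?C a 0 \<noteq> 0" "?C 0 b \<noteq> 0" using lcoef_axes[OF irr, of "\<eta> q"] by blast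
  have finpre: "finite {x \<in> P1_dom e. P1_coord e x \<in> Z}" if "finite Z" for e Z
    by (rule finite_imageD[of "P1_coord e"])
       (use that in \<open>auto intro: finite_subset[of _ Z] intro!: inj_onI P1_coord_inj\<close>)
  have unz: "\<exists>z\<in>?B. u z \<noteq> 0"
  proof (rule ccontr)
    assume "\<not> (\<exists>z\<in>?B. u z \<noteq> 0)"
    hence u0: "u z = 0" if "z \<in> ?B" for z using that by blast
    let ?Z = "{v. psum (msupp ?C) ?C 0 v = 0}"
    have sub: "\<eta> ` (param c ` ?B) \<subseteq> {fst (\<eta> q)} \<times> {y \<in> P1_dom (snd (\<eta> q)). P1_coord (snd (\<eta> q)) y \<in> ?Z}"
    proof
      fix y assume "y \<in> \<eta> ` (param c ` ?B)"
      then obtain z where z: "z \<in> ?B" "y = \<eta> (param c z)" by blast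
      have "fst y = fst (\<eta> q)"
        by (rule P1_coord_inj[of _ "fst (\<eta> q)"])
           (use dom[OF z(1)] u0[OF z(1)] corner z(2) in \<open>simp_all add: u_def\<close>)
      moreover have "v z \<in> ?Z" using loc[OF z(1)] u0[OF z(1)] by (simp add: local_equation_eq)
      ultimately show "y \<in> {fst (\<eta> q)} \<times> {y \<in> P1_dom (snd (\<eta> q)). P1_coord (snd (\<eta> q)) y \<in> ?Z}"
        using dom(2)[OF z(1)] z(2) by (simp add: mem_Times_iff v_def)
    qed
    show False
      using finite_subset[OF sub] inf finpre[OF finite_roots_psum_0_y[OF finite_msupp_lcoef ab(2)]]
      by simp
  qed
  have vnz: "\<exists>z\<in>?B. v z \<noteq> 0"
  proof (rule ccontr)
    assume "\<not> (\<exists>z\<in>?B. v z \<noteq> 0)"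
    hence v0: "v z = 0" if "z \<in> ?B" for z using that by blast
    let ?Z = "{u. psum (msupp ?C) ?C u 0 = 0}"
    have sub: "\<eta> ` (param c ` ?B) \<subseteq> {x \<in> P1_dom (fst (\<eta> q)). P1_coord (fst (\<eta> q)) x \<in> ?Z} \<times> {snd (\<eta> q)}"
    proof
      fix y assume "y \<in> \<eta> ` (param c ` ?B)"
      then obtain z where z: "z \<in> ?B" "y = \<eta> (param c z)" by blast
      have "snd y = snd (\<eta> q)"
        by (rule P1_coord_inj[of _ "snd (\<eta> q)"])
           (use dom[OF z(1)] v0[OF z(1)] corner z(2) in \<open>simp_all add: v_def\<close>)
      moreover have "u z \<in> ?Z" using loc[OF z(1)] v0[OF z(1)] by (simp add: local_equation_eq)
      ultimately show "y \<in> {x \<in> P1_dom (fst (\<eta> q)). P1_coord (fst (\<eta> q)) x \<in> ?Z} \<times> {snd (\<eta> q)}"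
        using dom(1)[OF z(1)] z(2) by (simp add: mem_Times_iff u_def)
    qed
    show False
      using finite_subset[OF sub] inf finpre[OF finite_roots_psum_0_x[OF finite_msupp_lcoef ab(1)]]
      by simp
  qed
  show ?thesis by (rule that[OF \<epsilon> im hol q0 unz vnz dom loc])
qed

section \<open>Branches\<close>

definition branch_at ::
    "'a surface \<Rightarrow> ('a \<Rightarrow> P1 \<times> P1) \<Rightarrow> 'a \<Rightarrow> 'a chart \<Rightarrow> nat \<Rightarrow> nat \<Rightarrow> (complex \<Rightarrow> complex) \<Rightarrow> real \<Rightarrow> bool" where
  "branch_at X \<eta> q c r m h \<epsilon> \<longleftrightarrow>
     c \<in> charts X \<and> q \<in> fst c \<and> snd c q = 0 \<and> r > 0 \<and> m > 0 \<and> \<epsilon> > 0 \<and>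
     ball 0 \<epsilon> \<subseteq> snd c ` fst c \<and> h holomorphic_on ball 0 \<epsilon> \<and>
     (\<forall>z\<in>ball 0 \<epsilon>. h z \<noteq> 0 \<and>
        fst (\<eta> (param c z)) \<in> P1_dom (fst (\<eta> q)) \<and> snd (\<eta> (param c z)) \<in> P1_dom (snd (\<eta> q)) \<and>
        P1_coord (fst (\<eta> q)) (fst (\<eta> (param c z))) = z ^ r \<and>
        P1_coord (snd (\<eta> q)) (snd (\<eta> (param c z))) = z ^ m * h z)"

text \<open>Nondegeneracy enters in its weight form, which passes to all corners by
  \<open>nondeg_lcoef\<close>.\<close>

locale normalised_curve =
  fixes P :: "complex poly poly" and X :: "'a surface" and \<eta> :: "'a \<Rightarrow> P1 \<times> P1" and B :: "'a bidiff"
  assumes irr: "irreducible P" and dx: "deg_x P > 0" and dy: "deg_y P > 0"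
    and nondeg_cf: "nondeg (cf P)"
    and norm: "normalisation P X \<eta>"
begin

abbreviation S :: "'a spectral_curve" where
  "S \<equiv> compact_spectral_curve X \<eta> B"

lemma surface: "riemann_surface X" and hol_x: "holomorphic_to_P1 X (fst \<circ> \<eta>)"
  and hol_y: "holomorphic_to_P1 X (snd \<circ> \<eta>)" and onto: "\<eta> ` topspace (surf_top X) = proj_curve P"
  and compact: "compact_space (surf_top X)"
  and inj: "inj_on \<eta> {q \<in> topspace (surf_top X). \<eta> q \<notin> singular_points P}"
  using norm unfolding normalisation_def by blast+

text \<open>At infinity \<open>aff\<close> takes its default value 0, which is also the coordinate
  of that point in its own chart. Vanishing of both \<open>aff\<close> values therefore describes
  exactly the four corners.\<close>

lemma singular_corner:
  assumes "p \<in> singular_points P"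
  shows "fst p \<in> {Aff 0, Inf_pt}" "snd p \<in> {Aff 0, Inf_pt}"
proof -
  obtain a b where ab: "lcoef P p a 0 \<noteq> 0" "lcoef P p 0 b \<noteq> 0" using lcoef_axes[OF irr dx dy, of p] by blast
  have "aff (fst p) = 0 \<and> aff (snd p) = 0"
    by (rule nondeg_singular_origin[OF nondeg_lcoef[OF nondeg_cf] finite_msupp_lcoef ab])
       (use assms in \<open>simp_all add: singular_points_def proj_curve_def local_equation_eq\<close>)
  thus "fst p \<in> {Aff 0, Inf_pt}" "snd p \<in> {Aff 0, Inf_pt}"
    by (cases "fst p"; cases "snd p"; simp)+
qed

text \<open>The first coordinate of z is then neither 0 nor infinite.\<close>

lemma not_singular:
  assumes "fst p \<in> {Aff 0, Inf_pt}" "fst z \<in> P1_dom (fst p)" "P1_coord (fst p) (fst z) \<noteq> 0"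
  shows "z \<notin> singular_points P"
proof
  assume "z \<in> singular_points P"
  hence "fst z \<in> {Aff 0, Inf_pt}" by (rule singular_corner)
  thus False using assms by auto
qed

text \<open>In any chart u is \<open>(z - z0) ^ n\<close> times a zero-free function, which is
  \<open>exp G\<close> on a disc. Then \<phi> = (z - z0) exp(G/n) is an n-th root of u with nonzero
  derivative at z0, and reparametrisation by \<phi> gives the standard coordinate.\<close>

lemma standard_coordinate_exists:
  assumes q: "q \<in> topspace (surf_top X)"
    and corner: "fst (\<eta> q) \<in> {Aff 0, Inf_pt}" "snd (\<eta> q) \<in> {Aff 0, Inf_pt}"
  shows "ram S q > 0" "\<exists>c. standard_coordinate S q c"
proof -
  \<comment> \<open>The same choice of chart as in \<open>ram\<close>, so that the order computed
    below is literally the ramification order.\<close>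
  define c where "c = (SOME c. c \<in> charts (surf S) \<and> q \<in> fst c)"
  have "\<exists>c. c \<in> charts X \<and> q \<in> fst c"
    using hol_x q unfolding holomorphic_to_P1_def by blast
  hence "\<exists>c. c \<in> charts (surf S) \<and> q \<in> fst c"
    by (simp add: compact_spectral_curve_def)
  hence "c \<in> charts (surf S) \<and> q \<in> fst c" unfolding c_def by (rule someI_ex)
  hence c: "c \<in> charts X" "q \<in> fst c" by (simp_all add: compact_spectral_curve_def)
  let ?z0 = "snd c q"
  define u where "u z = P1_coord (fst (\<eta> q)) (fst (\<eta> (param c z)))" for z
  obtain \<epsilon> where \<epsilon>: "\<epsilon> > 0" "ball ?z0 \<epsilon> \<subseteq> snd c ` fst c" "u holomorphic_on ball ?z0 \<epsilon>" "u ?z0 = 0"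
    "\<exists>z\<in>ball ?z0 \<epsilon>. u z \<noteq> 0" "\<forall>z\<in>ball ?z0 \<epsilon>. fst (\<eta> (param c z)) \<in> P1_dom (fst (\<eta> q))"
    using normalisation_local_coordinates[OF norm irr dx dy c corner] unfolding u_def by metis
  have ram_eq: "ram S q = nat (zorder u ?z0)"
    unfolding ram_def Let_def c_def[symmetric]
    using P1_coord_corner[OF corner(1)] by (simp add: compact_spectral_curve_def u_def[abs_def])
  obtain r where r: "zorder u ?z0 > 0" "r > 0" "cball ?z0 r \<subseteq> ball ?z0 \<epsilon>"
    "zor_poly u ?z0 holomorphic_on cball ?z0 r"
    "\<forall>w\<in>cball ?z0 r. u w = zor_poly u ?z0 w * (w - ?z0) ^ nat (zorder u ?z0) \<and> zor_poly u ?z0 w \<noteq> 0"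
    using zorder_exist_zero[OF \<epsilon>(3) open_ball connected_ball _ \<epsilon>(5), of ?z0] \<epsilon>(1,4)
    by auto
  define n where "n = ram S q"
  have n: "n > 0" "n = nat (zorder u ?z0)" using r(1) by (simp_all add: n_def ram_eq)
  show "ram S q > 0" using n by (simp add: n_def)
  have "zor_poly u ?z0 holomorphic_on ball ?z0 r"
    by (rule holomorphic_on_subset[OF r(4)]) auto
  moreover have "contractible (ball ?z0 r)" by (simp add: convex_imp_contractible)
  ultimately obtain G where G: "G holomorphic_on ball ?z0 r" "\<And>z. z \<in> ball ?z0 r \<Longrightarrow> zor_poly u ?z0 z = exp (G z)"
    using contractible_imp_holomorphic_log[of "zor_poly u ?z0" "ball ?z0 r"] r(5) by (metis ball_subset_cball subsetD)
  define \<phi> where "\<phi> z = (z - ?z0) * exp (G z / of_nat n)" for z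
  have \<phi>hol: "\<phi> holomorphic_on ball ?z0 r"
    unfolding \<phi>_def[abs_def] using n by (intro holomorphic_intros G) auto
  have \<phi>pow: "\<phi> z ^ n = u z" if "z \<in> ball ?z0 r" for z
  proof -
    have "exp (G z / of_nat n) ^ n = exp (G z)" using n by (simp flip: exp_of_nat_mult)
    moreover have "z \<in> cball ?z0 r" using that by simp
    ultimately show ?thesis using r(5) G(2)[OF that] n by (simp add: \<phi>_def power_mult_distrib mult.commute)
  qed
  have "(\<phi> has_field_derivative exp (G ?z0 / of_nat n)) (at ?z0)"
  proof -
    have "(\<lambda>z. exp (G z / of_nat n)) holomorphic_on ball ?z0 r"
      using n by (intro holomorphic_intros G) auto
    hence "((\<lambda>z. exp (G z / of_nat n)) has_field_derivative deriv (\<lambda>z. exp (G z / of_nat n)) ?z0) (at ?z0)"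
      using r(2) by (intro holomorphic_derivI[OF _ open_ball]) auto
    moreover have "((\<lambda>z. z - ?z0) has_field_derivative 1) (at ?z0)"
      by (auto intro!: derivative_eq_intros)
    ultimately have "((\<lambda>z. (z - ?z0) * exp (G z / of_nat n)) has_field_derivative
        1 * exp (G ?z0 / of_nat n) + deriv (\<lambda>z. exp (G z / of_nat n)) ?z0 * (?z0 - ?z0)) (at ?z0)"
      by (intro DERIV_mult)
    thus ?thesis unfolding \<phi>_def[abs_def] by simp
  qed
  hence "deriv \<phi> ?z0 \<noteq> 0" by (simp add: DERIV_imp_deriv)
  then obtain \<rho> where \<rho>: "\<rho> > 0" "ball ?z0 \<rho> \<subseteq> ball ?z0 r" "inj_on \<phi> (ball ?z0 \<rho>)"
    using has_complex_derivative_locally_injective[OF \<phi>hol _ open_ball, of ?z0] r(2) by (metis centre_in_ball)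
  let ?V = "ball ?z0 \<rho>"
  have V: "?V \<subseteq> ball ?z0 \<epsilon>" using \<rho>(2) r(3) ball_subset_cball[of ?z0 r] by blast
  define c' where "c' = ({p \<in> fst c. snd c p \<in> ?V}, \<phi> \<circ> snd c)"
  note c' = chart_reparametrise[OF surface c(1) open_ball _ holomorphic_on_subset[OF \<phi>hol \<rho>(2)] \<rho>(3), folded c'_def]
  have c'c: "c' \<in> charts X" using c'(1) V \<epsilon>(2) by blast
  have qc': "q \<in> fst c'" "snd c' q = 0" using c \<rho>(1) by (simp_all add: c'_def \<phi>_def)
  have "standard_coordinate S q c'"
    unfolding standard_coordinate_def
  proof (intro conjI ballI)
    show "c' \<in> charts (surf S)" using c'c by (simp add: compact_spectral_curve_def)
    show "q \<in> fst c'" "snd c' q = 0" by fact+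
    fix p assume p: "p \<in> fst c'"
    hence pc: "p \<in> fst c" "snd c p \<in> ?V" by (simp_all add: c'_def)
    have par: "param c (snd c p) = p" using param_snd[OF c(1) pc(1)] .
    have up: "P1_coord (fst (\<eta> q)) (fst (\<eta> p)) = snd c' p ^ n"
      using \<phi>pow[OF subsetD[OF \<rho>(2) pc(2)]] by (simp add: u_def par c'_def)
    have dom: "fst (\<eta> p) \<in> P1_dom (fst (\<eta> q))"
      using \<epsilon>(6) subsetD[OF V pc(2)] par by metis
    show "xmap S p = (case xmap S q of Aff a \<Rightarrow> Aff (a + snd c' p ^ ram S q)
         | Inf_pt \<Rightarrow> if p = q then Inf_pt else Aff (inverse (snd c' p ^ ram S q)))"
    proof (cases "fst (\<eta> q)")
      case (Aff a)
      hence "a = 0" using corner(1) by simp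
      thus ?thesis using up dom Aff n_def
        by (cases "fst (\<eta> p)") (auto simp: compact_spectral_curve_def)
    next
      case Inf_pt
      show ?thesis
      proof (cases "p = q")
        case True
        thus ?thesis using Inf_pt by (simp add: compact_spectral_curve_def)
      next
        \<comment> \<open>The centre is the only point of the new chart lying over infinity, because
          the chart is injective.\<close>
        case False
        have "snd c' p \<noteq> snd c' q"
          using inj_onD[OF chartsD(6)[OF c'c], of p q] False p qc'(1) by blast
        hence "snd c' p ^ n \<noteq> 0" unfolding qc'(2) by simp
        then obtain t where t: "fst (\<eta> p) = Aff t" "inverse t = snd c' p ^ n"
          using up dom Inf_pt by (cases "fst (\<eta> p)") auto
        have "t = inverse (snd c' p ^ n)" unfolding t(2)[symmetric] by simp
        thus ?thesis using Inf_pt n_def False t(1) by (simp add: compact_spectral_curve_def)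
      qed
    qed
  qed
  thus "\<exists>c. standard_coordinate S q c" by blast
qed

text \<open>With u = \<open>z ^ r\<close> secured by the standard coordinate, m is the order of v
  and h its zero-free cofactor.\<close>

lemma branch_exists:
  assumes q: "q \<in> topspace (surf_top X)"
    and corner: "fst (\<eta> q) \<in> {Aff 0, Inf_pt}" "snd (\<eta> q) \<in> {Aff 0, Inf_pt}"
  shows "\<exists>m h \<epsilon>. branch_at X \<eta> q (SOME c. standard_coordinate S q c) (ram S q) m h \<epsilon>"
proof -
  define c where "c = (SOME c. standard_coordinate S q c)"
  have std: "standard_coordinate S q c"
    unfolding c_def by (rule someI_ex) (rule standard_coordinate_exists[OF assms])
  have ram: "ram S q > 0" by (rule standard_coordinate_exists[OF assms])
  have c: "c \<in> charts X" "q \<in> fst c" "snd c q = 0"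
    using std by (simp_all add: standard_coordinate_def compact_spectral_curve_def)
  define v where "v z = P1_coord (snd (\<eta> q)) (snd (\<eta> (param c z)))" for z
  obtain \<epsilon> where \<epsilon>: "\<epsilon> > 0" "ball 0 \<epsilon> \<subseteq> snd c ` fst c" "v holomorphic_on ball 0 \<epsilon>" "v 0 = 0"
    "\<exists>z\<in>ball 0 \<epsilon>. v z \<noteq> 0" "\<forall>z\<in>ball 0 \<epsilon>. fst (\<eta> (param c z)) \<in> P1_dom (fst (\<eta> q))"
    "\<forall>z\<in>ball 0 \<epsilon>. snd (\<eta> (param c z)) \<in> P1_dom (snd (\<eta> q))"
    using normalisation_local_coordinates[OF norm irr dx dy c(1,2) corner] unfolding v_def c(3) by metis
  have "\<exists>r>0. cball (0::complex) r \<subseteq> ball 0 \<epsilon> \<and> zor_poly v 0 holomorphic_on cball 0 r \<and>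
    (\<forall>w\<in>cball 0 r. v w = zor_poly v 0 w * w ^ nat (zorder v 0) \<and> zor_poly v 0 w \<noteq> 0)"
    and "zorder v 0 > 0"
    using zorder_exist_zero[OF \<epsilon>(3) open_ball connected_ball _ \<epsilon>(5), of 0] \<epsilon>(1,4)
    unfolding diff_zero by auto
  then obtain r where r: "zorder v 0 > 0" "r > 0" "cball (0::complex) r \<subseteq> ball 0 \<epsilon>"
    "zor_poly v 0 holomorphic_on cball 0 r"
    "\<forall>w\<in>cball 0 r. v w = zor_poly v 0 w * w ^ nat (zorder v 0) \<and> zor_poly v 0 w \<noteq> 0"
    by blast
  have sub: "ball (0::complex) r \<subseteq> ball 0 \<epsilon>" using r(3) ball_subset_cball[of "0::complex" r] by blast
  have "branch_at X \<eta> q c (ram S q) (nat (zorder v 0)) (zor_poly v 0) r"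
    unfolding branch_at_def
  proof (intro conjI ballI)
    fix z :: complex assume z: "z \<in> ball 0 r"
    hence zc: "z \<in> cball 0 r" and z\<epsilon>: "z \<in> ball 0 \<epsilon>" using subsetD[OF sub z] by simp_all
    show "zor_poly v 0 z \<noteq> 0" using r(5) zc by blast
    show "fst (\<eta> (param c z)) \<in> P1_dom (fst (\<eta> q))" "snd (\<eta> (param c z)) \<in> P1_dom (snd (\<eta> q))"
      using \<epsilon>(6,7) z\<epsilon> by blast+
    show "P1_coord (snd (\<eta> q)) (snd (\<eta> (param c z))) = z ^ nat (zorder v 0) * zor_poly v 0 z"
      using r(5) zc by (simp add: v_def mult.commute)
    have pz: "param c z \<in> fst c" "snd c (param c z) = z" by (rule param_in[OF subsetD[OF \<epsilon>(2) z\<epsilon>]])+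
    have *: "fst (\<eta> (param c z)) = (case fst (\<eta> q) of Aff a \<Rightarrow> Aff (a + z ^ ram S q)
         | Inf_pt \<Rightarrow> if param c z = q then Inf_pt else Aff (inverse (z ^ ram S q)))"
    proof -
      have xm: "xmap S x = fst (\<eta> x)" for x by (simp add: compact_spectral_curve_def)
      have "\<forall>x\<in>fst c. xmap S x = (case xmap S q of Aff a \<Rightarrow> Aff (a + snd c x ^ ram S q)
         | Inf_pt \<Rightarrow> if x = q then Inf_pt else Aff (inverse (snd c x ^ ram S q)))"
        using std unfolding standard_coordinate_def by blast
      from bspec[OF this pz(1)] show ?thesis unfolding xm pz(2) .
    qed
    show "P1_coord (fst (\<eta> q)) (fst (\<eta> (param c z))) = z ^ ram S q"
    proof (cases "fst (\<eta> q)")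
      case (Aff a)
      thus ?thesis using * corner(1) by simp
    next
      case Inf_pt
      have "param c z = q \<Longrightarrow> z = 0" using pz c by simp
      thus ?thesis using * Inf_pt ram by auto
    qed
  next
    show "zor_poly v 0 holomorphic_on ball 0 r"
      by (rule holomorphic_on_subset[OF r(4) ball_subset_cball])
    show "ball 0 r \<subseteq> snd c ` fst c" using sub \<epsilon>(2) by blast
  qed (use c ram r in auto)
  thus ?thesis unfolding c_def by blast
qed

end

lemma continuous_zero_extend:
  fixes f :: "complex \<Rightarrow> complex"
  assumes "continuous_on (ball 0 \<epsilon>) f" "\<epsilon> > 0" "\<And>z. z \<in> ball 0 \<epsilon> \<Longrightarrow> z \<noteq> 0 \<Longrightarrow> f z = 0"
  shows "f 0 = 0"
proof -
  have "isCont f 0" using assms(1,2) by (simp add: continuous_on_eq_continuous_at)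
  hence 1: "(f \<longlongrightarrow> f 0) (at 0)" by (simp add: isCont_def)
  have "eventually (\<lambda>z. z \<in> ball 0 \<epsilon> - {0}) (at (0::complex))"
    using assms(2) by (intro eventually_at_in_open) auto
  hence "eventually (\<lambda>z. f z = 0) (at 0)"
    by eventually_elim (use assms(3) in auto)
  hence "(f \<longlongrightarrow> 0) (at 0)" by (rule tendsto_eventually)
  thus ?thesis using tendsto_unique[OF _ 1] by simp
qed

lemma P1_coord_surj:
  assumes "a \<in> {Aff 0, Inf_pt}"
  obtains x where "x \<in> P1_dom a" "P1_coord a x = t"
proof (cases "a = Inf_pt \<and> t = 0")
  case True
  thus ?thesis using that[of Inf_pt] by simp
next
  case False
  show ?thesis
  proof (cases "a = Inf_pt")
    case True
    thus ?thesis using that[of "Aff (inverse t)"] False by simp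
  next
    case False
    thus ?thesis using that[of "Aff t"] assms by simp
  qed
qed

lemma branch_atD:
  assumes "branch_at X \<eta> q c r m h \<epsilon>"
  shows "c \<in> charts X" "q \<in> fst c" "snd c q = 0" "r > 0" "m > 0" "\<epsilon> > 0" "ball 0 \<epsilon> \<subseteq> snd c ` fst c"
    "h holomorphic_on ball 0 \<epsilon>" "\<And>z. z \<in> ball 0 \<epsilon> \<Longrightarrow> h z \<noteq> 0"
    "\<And>z. z \<in> ball 0 \<epsilon> \<Longrightarrow> fst (\<eta> (param c z)) \<in> P1_dom (fst (\<eta> q))"
    "\<And>z. z \<in> ball 0 \<epsilon> \<Longrightarrow> snd (\<eta> (param c z)) \<in> P1_dom (snd (\<eta> q))"
    "\<And>z. z \<in> ball 0 \<epsilon> \<Longrightarrow> P1_coord (fst (\<eta> q)) (fst (\<eta> (param c z))) = z ^ r"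
    "\<And>z. z \<in> ball 0 \<epsilon> \<Longrightarrow> P1_coord (snd (\<eta> q)) (snd (\<eta> (param c z))) = z ^ m * h z"
  using assms unfolding branch_at_def by blast+

lemma isCont_small:
  fixes h :: "complex \<Rightarrow> complex"
  assumes "h holomorphic_on ball 0 \<epsilon>" "\<epsilon> > 0" "\<delta> > 0"
  obtains \<rho> where "\<rho> > 0" "\<rho> \<le> \<epsilon>" "\<And>z. norm z < \<rho> \<Longrightarrow> dist (h z) (h 0) < \<delta>"
proof -
  have "continuous_on (ball 0 \<epsilon>) h" by (rule holomorphic_on_imp_continuous_on) fact
  hence "isCont h 0" using assms(2) by (simp add: continuous_on_eq_continuous_at)
  then obtain d where "d > 0" "\<forall>z. dist z 0 < d \<longrightarrow> dist (h z) (h 0) < \<delta>"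
    using assms(3) unfolding continuous_at_eps_delta by blast
  thus ?thesis using that[of "min d \<epsilon>"] assms(2) by simp
qed

lemma param_near:
  assumes c: "c \<in> charts X" "q \<in> fst c" "snd c q = 0" and U: "openin (surf_top X) U" "q \<in> U"
  obtains \<rho> where "\<rho> > 0" "\<And>z. norm z < \<rho> \<Longrightarrow> param c z \<in> U"
proof -
  have "open (snd c ` (U \<inter> fst c))"
    by (rule chart_image_open[OF c(1) openin_Int[OF U(1) chartsD(1)[OF c(1)]]]) blast
  moreover have "0 \<in> snd c ` (U \<inter> fst c)" using c U by (metis IntI imageI)
  ultimately obtain \<rho> where \<rho>: "\<rho> > 0" "ball 0 \<rho> \<subseteq> snd c ` (U \<inter> fst c)"
    unfolding open_contains_ball by blast
  have "param c z \<in> U" if z: "norm z < \<rho>" for z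
  proof -
    have "z \<in> snd c ` (U \<inter> fst c)" using subsetD[OF \<rho>(2), of z] z by simp
    then obtain p where "p \<in> U" "p \<in> fst c" "z = snd c p" by auto
    thus ?thesis using param_snd[OF c(1)] by simp
  qed
  thus ?thesis using that \<rho>(1) by blast
qed

context normalised_curve
begin

lemma eta_proj_curve: "q \<in> topspace (surf_top X) \<Longrightarrow> \<eta> q \<in> proj_curve P"
  using onto by blast

lemma branch_psum:
  assumes br: "branch_at X \<eta> q c r m h \<epsilon>"
    and corner: "fst (\<eta> q) \<in> {Aff 0, Inf_pt}" "snd (\<eta> q) \<in> {Aff 0, Inf_pt}" and z: "z \<in> ball 0 \<epsilon>"
  shows "psum (msupp (lcoef P (\<eta> q))) (lcoef P (\<eta> q)) (z ^ r) (z ^ m * h z) = 0"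
proof -
  note D = branch_atD[OF br]
  have "param c z \<in> topspace (surf_top X)"
    using param_in(1)[OF subsetD[OF D(7) z]] chartsD(5)[OF D(1)] by blast
  hence "\<eta> (param c z) \<in> proj_curve P" by (rule eta_proj_curve)
  thus ?thesis
    using proj_curve_iff[OF corner D(10)[OF z] D(11)[OF z]]
    unfolding D(12)[OF z] D(13)[OF z] local_equation_eq by blast
qed

text \<open>The common factor k is left free for the coprimality argument: apart from h(z) the
  equation involves z only through \<open>z ^ k\<close>. For z \<noteq> 0 a power of z is cancelled,
  at 0 continuity takes over.\<close>

lemma branch_blowup:
  assumes br: "branch_at X \<eta> q c r m h \<epsilon>"
    and corner: "fst (\<eta> q) \<in> {Aff 0, Inf_pt}" "snd (\<eta> q) \<in> {Aff 0, Inf_pt}" and z: "z \<in> ball 0 \<epsilon>"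
    and k: "r = k * r'" "m = k * m'"
  shows "blowup (lcoef P (\<eta> q)) r' m' (z ^ k) (h z) = 0"
proof -
  let ?C = "lcoef P (\<eta> q)"
  note D = branch_atD[OF br]
  have nz: "blowup ?C r' m' (z ^ k) (h z) = 0" if "z \<in> ball 0 \<epsilon>" "z \<noteq> 0" for z
  proof -
    have "psum (msupp ?C) ?C ((z ^ k) ^ r') ((z ^ k) ^ m' * h z) = 0"
      using branch_psum[OF br corner that(1)] unfolding k power_mult .
    thus ?thesis unfolding psum_blowup[OF finite_msupp_lcoef] using that(2) by simp
  qed
  show ?thesis
  proof (cases "z = 0")
    case True
    have "continuous_on (ball 0 \<epsilon>) (\<lambda>z. blowup ?C r' m' (z ^ k) (h z))"
      unfolding blowup_def
      by (intro continuous_intros holomorphic_on_imp_continuous_on[OF D(8)])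
    from continuous_zero_extend[OF this D(6) nz] show ?thesis unfolding True by simp
  qed (rule nz[OF z])
qed

lemma branch_root:
  assumes br: "branch_at X \<eta> q c r m h \<epsilon>"
    and corner: "fst (\<eta> q) \<in> {Aff 0, Inf_pt}" "snd (\<eta> q) \<in> {Aff 0, Inf_pt}"
  shows "blowup (lcoef P (\<eta> q)) r m 0 (h 0) = 0" "h 0 \<noteq> 0"
  using branch_blowup[OF br corner, of 0 1 r m] branch_atD(6,9)[OF br] by simp_all

text \<open>Equal local coordinates give the same point of the curve, and u \<noteq> 0 keeps it away
  from the corners, hence from the singular points over which injectivity may fail.\<close>

lemma branch_inj:
  assumes br: "branch_at X \<eta> q1 c1 r m h1 \<epsilon>1" "branch_at X \<eta> q2 c2 r m h2 \<epsilon>2" and eq: "\<eta> q1 = \<eta> q2"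
    and corner: "fst (\<eta> q1) \<in> {Aff 0, Inf_pt}" "snd (\<eta> q1) \<in> {Aff 0, Inf_pt}"
    and z: "z1 \<in> ball 0 \<epsilon>1" "z2 \<in> ball 0 \<epsilon>2" "z1 \<noteq> 0" "z1 ^ r = z2 ^ r" "z1 ^ m * h1 z1 = z2 ^ m * h2 z2"
  shows "param c1 z1 = param c2 z2"
proof -
  note D1 = branch_atD[OF br(1)] and D2 = branch_atD[OF br(2)]
  have "fst (\<eta> (param c1 z1)) = fst (\<eta> (param c2 z2))"
  proof (rule P1_coord_inj)
    show "fst (\<eta> (param c1 z1)) \<in> P1_dom (fst (\<eta> q1))" by (rule D1(10)[OF z(1)])
    show "fst (\<eta> (param c2 z2)) \<in> P1_dom (fst (\<eta> q1))" unfolding eq by (rule D2(10)[OF z(2)])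
    show "P1_coord (fst (\<eta> q1)) (fst (\<eta> (param c1 z1))) = P1_coord (fst (\<eta> q1)) (fst (\<eta> (param c2 z2)))"
      using D1(12)[OF z(1)] D2(12)[OF z(2)] eq z(4) by simp
  qed
  moreover have "snd (\<eta> (param c1 z1)) = snd (\<eta> (param c2 z2))"
  proof (rule P1_coord_inj)
    show "snd (\<eta> (param c1 z1)) \<in> P1_dom (snd (\<eta> q1))" by (rule D1(11)[OF z(1)])
    show "snd (\<eta> (param c2 z2)) \<in> P1_dom (snd (\<eta> q1))" unfolding eq by (rule D2(11)[OF z(2)])
    show "P1_coord (snd (\<eta> q1)) (snd (\<eta> (param c1 z1))) = P1_coord (snd (\<eta> q1)) (snd (\<eta> (param c2 z2)))"
      using D1(13)[OF z(1)] D2(13)[OF z(2)] eq z(5) by simp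
  qed
  ultimately have same: "\<eta> (param c1 z1) = \<eta> (param c2 z2)" by (rule prod_eqI)
  have "\<eta> (param c1 z1) \<notin> singular_points P"
    by (rule not_singular[OF corner(1) D1(10)[OF z(1)]]) (use D1(12)[OF z(1)] z(3) in simp)
  moreover have "param c1 z1 \<in> topspace (surf_top X)"
    using param_in(1)[OF subsetD[OF D1(7) z(1)]] chartsD(5)[OF D1(1)] by blast
  moreover have "param c2 z2 \<in> topspace (surf_top X)"
    using param_in(1)[OF subsetD[OF D2(7) z(2)]] chartsD(5)[OF D2(1)] by blast
  ultimately show ?thesis using inj_onD[OF inj same] same by simp
qed

text \<open>If k is the gcd of r and m and \<omega> a k-th root of unity, then h(z) and h(\<omega>
  z) are roots of the same reduced blow-up at \<open>z ^ k\<close>, close to the simple root h(0),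
  so local uniqueness makes them equal.\<close>

lemma branch_coprime:
  assumes br: "branch_at X \<eta> q c r m h \<epsilon>"
    and corner: "fst (\<eta> q) \<in> {Aff 0, Inf_pt}" "snd (\<eta> q) \<in> {Aff 0, Inf_pt}"
  shows "coprime r m"
proof (rule ccontr)
  assume "\<not> coprime r m"
  let ?C = "lcoef P (\<eta> q)"
  note D = branch_atD[OF br]
  define k where "k = gcd r m"
  have k: "k > 1"
  proof -
    have "gcd r m \<noteq> 1" using \<open>\<not> coprime r m\<close> coprime_iff_gcd_eq_1 by blast
    moreover have "gcd r m \<noteq> 0" using D(4) by simp
    ultimately show ?thesis unfolding k_def by linarith
  qed
  obtain r' m' where rm: "r = k * r'" "m = k * m'"
    using dvdE[OF gcd_dvd1[of r m]] dvdE[OF gcd_dvd2[of r m]] unfolding k_def by metis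
  have r': "r' > 0" using D(4) rm by (cases r') auto
  have root: "blowup ?C r' m' 0 (h 0) = 0"
    using branch_blowup[OF br corner, of 0, OF _ rm] D(6) k by (simp add: zero_power)
  have h0: "h 0 \<noteq> 0" using D(6,9) by simp
  obtain \<delta> where \<delta>: "\<delta> > 0" "\<And>\<xi> w1 w2. norm \<xi> < \<delta> \<Longrightarrow> dist w1 (h 0) < \<delta> \<Longrightarrow> dist w2 (h 0) < \<delta> \<Longrightarrow>
       blowup ?C r' m' \<xi> w1 = 0 \<Longrightarrow> blowup ?C r' m' \<xi> w2 = 0 \<Longrightarrow> w1 = w2"
    by (rule blowup_root_unique[OF nondeg_lcoef[OF nondeg_cf] finite_msupp_lcoef r' h0 root]) (rule that)
  obtain \<rho> where \<rho>: "\<rho> > 0" "\<rho> \<le> \<epsilon>" "\<And>z. norm z < \<rho> \<Longrightarrow> dist (h z) (h 0) < \<delta>"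
    by (rule isCont_small[OF D(8,6) \<delta>(1)]) (rule that)
  \<comment> \<open>The bound by 1 ensures \<open>norm (z ^ k) \<le> norm z\<close>, so that
    \<delta> also controls the parameter \<open>z ^ k\<close>.\<close>
  define z :: complex where "z = of_real (min (min \<rho> \<delta>) 1 / 2)"
  have z: "norm z < \<rho>" "norm z < \<delta>" "norm z < 1" "z \<noteq> 0"
    using \<rho>(1) \<delta>(1) unfolding z_def by (auto simp: min_def)
  \<comment> \<open>As \<open>h\<close> is a function of \<open>z\<^sup>k\<close>, the points with coordinates \<open>z\<close> and \<open>\<omega>z\<close> have the same image.\<close>
  define \<omega> where "\<omega> = cis (2 * pi / of_nat k)"
  have \<omega>: "\<omega> ^ k = 1" "norm \<omega> = 1" "\<omega> \<noteq> 1"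
  proof -
    show "\<omega> ^ k = 1" using k by (simp add: \<omega>_def Complex.DeMoivre)
    show "norm \<omega> = 1" by (simp add: \<omega>_def)
    show "\<omega> \<noteq> 1"
    proof
      assume "\<omega> = 1"
      hence "cis (2 * pi * real 1 / real k) = cis (2 * pi * real 0 / real k)" by (simp add: \<omega>_def)
      moreover have "inj_on (\<lambda>j. cis (2 * pi * real j / real k)) {..<k}"
        using Complex.bij_betw_roots_unity[of k] k by (auto simp: bij_betw_def)
      ultimately have "1 = (0::nat)" using k by (elim inj_onD) auto
      thus False by simp
    qed
  qed
  have zz: "z \<in> ball 0 \<epsilon>" "\<omega> * z \<in> ball 0 \<epsilon>" using z \<rho>(2) \<omega>(2) by (auto simp: norm_mult)
  have pw: "(\<omega> * z) ^ k = z ^ k" using \<omega>(1) by (simp add: power_mult_distrib)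
  have "norm (z ^ k) \<le> norm z"
    using power_decreasing[of 1 k "norm z"] z(3) k by (simp add: norm_power)
  hence "h (\<omega> * z) = h z"
    using \<delta>(2)[of "z ^ k" "h (\<omega> * z)" "h z"] \<rho>(3) z \<omega>(2)
      branch_blowup[OF br corner zz(1) rm] branch_blowup[OF br corner zz(2) rm] unfolding pw
    by (simp add: norm_mult)
  hence "param c z = param c (\<omega> * z)"
    using branch_inj[OF br br refl corner zz z(4)] pw unfolding rm power_mult by simp
  hence "z = \<omega> * z"
    using param_in(2)[OF subsetD[OF D(7) zz(1)]] param_in(2)[OF subsetD[OF D(7) zz(2)]] by simp
  thus False using z(4) \<omega>(3) by simp
qed

lemma branch_distinct:
  assumes br: "branch_at X \<eta> q1 c1 r m h1 \<epsilon>1" "branch_at X \<eta> q2 c2 r m h2 \<epsilon>2" and eq: "\<eta> q1 = \<eta> q2"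
    and corner: "fst (\<eta> q1) \<in> {Aff 0, Inf_pt}" "snd (\<eta> q1) \<in> {Aff 0, Inf_pt}"
    and ne: "q1 \<noteq> q2"
  shows "h1 0 ^ r \<noteq> h2 0 ^ r"
proof
  assume hr: "h1 0 ^ r = h2 0 ^ r"
  let ?C = "lcoef P (\<eta> q2)"
  note D1 = branch_atD[OF br(1)] and D2 = branch_atD[OF br(2)]
  note corner2 = corner[unfolded eq]
  have h10: "h1 0 \<noteq> 0" using D1(6,9) by simp
  have cop: "coprime m r" using branch_coprime[OF br(1) corner] by (simp add: coprime_commute)
  \<comment> \<open>The two branches would differ only by the change of coordinate \<open>z \<mapsto> \<omega>z\<close>.\<close>
  obtain \<omega> where \<omega>: "\<omega> ^ r = 1" "\<omega> ^ m * h1 0 = h2 0"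
  proof -
    \<comment> \<open>Bezout: for \<rho> with \<open>\<rho> ^ r = 1\<close> the power
      \<open>\<rho> ^ a\<close> is an m-th root of \<rho> that is still an r-th root of
      unity.\<close>
    obtain a b where ab: "m * a = r * b + 1"
      using bezout_nat[of m r] D1(5) cop by auto
    let ?\<rho> = "h2 0 / h1 0"
    have \<rho>: "?\<rho> ^ r = 1" using h10 by (simp add: power_divide hr[symmetric])
    have "(?\<rho> ^ a) ^ r = 1" using \<rho> by (simp flip: power_mult add: mult.commute[of a]) (simp add: power_mult)
    moreover have "(?\<rho> ^ a) ^ m = ?\<rho>"
    proof -
      have "(?\<rho> ^ a) ^ m = ?\<rho> ^ (r * b + 1)" unfolding power_mult[symmetric] ab[symmetric] by (simp only: mult.commute)
      also have "\<dots> = (?\<rho> ^ r) ^ b * ?\<rho>" by (simp only: power_add power_mult power_one_right)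
      finally show ?thesis using \<rho> by simp
    qed
    ultimately show ?thesis using that[of "?\<rho> ^ a"] h10 by simp
  qed
  have n\<omega>: "norm \<omega> = 1" using power_eq_1_iff[OF \<omega>(1)] D1(4) by simp
  have root: "blowup ?C r m 0 (h2 0) = 0" "h2 0 \<noteq> 0" by (rule branch_root[OF br(2) corner2])+
  obtain \<delta> where \<delta>: "\<delta> > 0" "\<And>\<xi> w1 w2. norm \<xi> < \<delta> \<Longrightarrow> dist w1 (h2 0) < \<delta> \<Longrightarrow> dist w2 (h2 0) < \<delta> \<Longrightarrow>
       blowup ?C r m \<xi> w1 = 0 \<Longrightarrow> blowup ?C r m \<xi> w2 = 0 \<Longrightarrow> w1 = w2"
    by (rule blowup_root_unique[OF nondeg_lcoef[OF nondeg_cf] finite_msupp_lcoef D1(4) root(2,1)]) (rule that)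
  obtain \<rho>1 where \<rho>1: "\<rho>1 > 0" "\<rho>1 \<le> \<epsilon>1" "\<And>z. norm z < \<rho>1 \<Longrightarrow> dist (h1 z) (h1 0) < \<delta>"
    by (rule isCont_small[OF D1(8,6) \<delta>(1)]) (rule that)
  obtain \<rho>2 where \<rho>2: "\<rho>2 > 0" "\<rho>2 \<le> \<epsilon>2" "\<And>z. norm z < \<rho>2 \<Longrightarrow> dist (h2 z) (h2 0) < \<delta>"
    by (rule isCont_small[OF D2(8,6) \<delta>(1)]) (rule that)
  have top: "q1 \<in> topspace (surf_top X)" "q2 \<in> topspace (surf_top X)"
    using chartsD(5)[OF D1(1)] chartsD(5)[OF D2(1)] D1(2) D2(2) by blast+
  \<comment> \<open>Distinct points have disjoint neighbourhoods, yet the two parametrisations will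
    be shown to hit a common point inside both.\<close>
  have "Hausdorff_space (surf_top X)" using surface unfolding riemann_surface_def by blast
  then obtain U1 U2 where U: "openin (surf_top X) U1" "openin (surf_top X) U2" "q1 \<in> U1" "q2 \<in> U2" "disjnt U1 U2"
    using top ne unfolding Hausdorff_space_def by metis
  obtain \<sigma>1 where \<sigma>1: "\<sigma>1 > 0" "\<And>z. norm z < \<sigma>1 \<Longrightarrow> param c1 z \<in> U1"
    by (rule param_near[OF D1(1-3) U(1,3)]) (rule that)
  obtain \<sigma>2 where \<sigma>2: "\<sigma>2 > 0" "\<And>z. norm z < \<sigma>2 \<Longrightarrow> param c2 z \<in> U2"
    by (rule param_near[OF D2(1-3) U(2,4)]) (rule that)
  define s where "s = Min {\<delta>, \<rho>1, \<rho>2, \<sigma>1, \<sigma>2}"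
  have s: "s > 0" "s \<le> \<delta>" "s \<le> \<rho>1" "s \<le> \<rho>2" "s \<le> \<sigma>1" "s \<le> \<sigma>2"
    unfolding s_def using \<delta>(1) \<rho>1(1) \<rho>2(1) \<sigma>1(1) \<sigma>2(1) by simp_all
  define z :: complex where "z = of_real (s / 2)"
  have z: "norm z < s" "z \<noteq> 0" using s(1) by (simp_all add: z_def)
  have zz: "\<omega> * z \<in> ball 0 \<epsilon>1" "z \<in> ball 0 \<epsilon>2"
    using z s \<rho>1(2) \<rho>2(2) n\<omega> by (simp_all add: norm_mult)
  have pw: "(\<omega> * z) ^ r = z ^ r" using \<omega>(1) by (simp add: power_mult_distrib)
  have b1: "blowup ?C r m z (\<omega> ^ m * h1 (\<omega> * z)) = 0"
  proof -
    have "psum (msupp ?C) ?C (z ^ r) (z ^ m * (\<omega> ^ m * h1 (\<omega> * z))) = 0"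
      using branch_psum[OF br(1) corner zz(1)] unfolding eq pw
      by (simp add: power_mult_distrib mult.assoc mult.left_commute)
    thus ?thesis unfolding psum_blowup[OF finite_msupp_lcoef] using z(2) by simp
  qed
  have b2: "blowup ?C r m z (h2 z) = 0"
    using branch_blowup[OF br(2) corner2 zz(2), of 1 r m] by simp
  have d1: "dist (\<omega> ^ m * h1 (\<omega> * z)) (h2 0) < \<delta>"
  proof -
    have "dist (\<omega> ^ m * h1 (\<omega> * z)) (h2 0) = norm (\<omega> ^ m * (h1 (\<omega> * z) - h1 0))"
      unfolding \<omega>(2)[symmetric] dist_norm by (simp only: right_diff_distrib)
    also have "\<dots> = dist (h1 (\<omega> * z)) (h1 0)" by (simp add: norm_mult norm_power n\<omega> dist_norm)
    also have "\<dots> < \<delta>" using \<rho>1(3)[of "\<omega> * z"] z s n\<omega> by (simp add: norm_mult)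
    finally show ?thesis .
  qed
  have "\<omega> ^ m * h1 (\<omega> * z) = h2 z"
    by (rule \<delta>(2)[OF _ d1 _ b1 b2]) (use z s \<rho>2(3) in simp_all)
  hence "(\<omega> * z) ^ m * h1 (\<omega> * z) = z ^ m * h2 z"
    by (simp add: power_mult_distrib mult.assoc mult.left_commute)
  moreover have "\<omega> * z \<noteq> 0" using z n\<omega> by auto
  ultimately have "param c1 (\<omega> * z) = param c2 z"
    using branch_inj[OF br eq corner zz _ pw] by blast
  moreover have "param c1 (\<omega> * z) \<in> U1" using \<sigma>1(2)[of "\<omega> * z"] z s n\<omega> by (simp add: norm_mult)
  moreover have "param c2 z \<in> U2" using \<sigma>2(2)[of z] z s by simp
  ultimately show False using U(5) by (auto simp: disjnt_def)
qed

end

text \<open>Serves to show that a limit point lies over the expected corner. The coordinate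
  \<open>P1_coord a\<close> defaults to 0 at the point opposite to a as well, so the lower bound has
  to be restricted to \<open>P1_dom a\<close>.\<close>

lemma P1_separated:
  assumes X: "riemann_surface X" and f: "holomorphic_to_P1 X f" and q: "q \<in> topspace (surf_top X)"
    and a: "a \<in> {Aff 0, Inf_pt}" and ne: "f q \<noteq> a"
  obtains U \<delta> where "openin (surf_top X) U" "q \<in> U" "\<delta> > 0"
    "\<And>p. p \<in> U \<Longrightarrow> f p \<in> P1_dom a \<Longrightarrow> norm (P1_coord a (f p)) \<ge> \<delta>"
proof -
  obtain c where c: "c \<in> charts X" "q \<in> fst c"
    using f q unfolding holomorphic_to_P1_def by blast
  define g where "g = (\<lambda>z. P1_coord (f q) (f (param c z)))"
  obtain \<epsilon> where \<epsilon>: "\<epsilon> > 0" "ball (snd c q) \<epsilon> \<subseteq> snd c ` fst c"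
    "\<forall>z\<in>ball (snd c q) \<epsilon>. f (param c z) \<in> P1_dom (f q)" "g holomorphic_on ball (snd c q) \<epsilon>"
    by (rule holomorphic_to_P1_local[OF X f c, folded g_def]) (rule that; assumption)
  have "continuous_on (ball (snd c q) \<epsilon>) g" by (rule holomorphic_on_imp_continuous_on) fact
  hence cont: "isCont g (snd c q)" using \<epsilon>(1) by (simp add: continuous_on_eq_continuous_at)
  have nbhd: "\<exists>U. openin (surf_top X) U \<and> q \<in> U \<and>
      (\<forall>p\<in>U. f p \<in> P1_dom (f q) \<and> dist (P1_coord (f q) (f p)) (P1_coord (f q) (f q)) < e)" if "e > 0" for e
  proof -
    obtain d where d: "d > 0" "\<forall>z. dist z (snd c q) < d \<longrightarrow> dist (g z) (g (snd c q)) < e"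
      using mp[OF spec[OF cont[unfolded continuous_at_eps_delta], of e] \<open>e > 0\<close>] by auto
    let ?V = "ball (snd c q) (min d \<epsilon>)"
    let ?U = "{p \<in> fst c. snd c p \<in> ?V}"
    have "?V \<subseteq> snd c ` fst c" using \<epsilon>(2) by auto
    hence "openin (surf_top X) ?U" by (intro chart_preimage_open[OF c(1)]) auto
    moreover have "q \<in> ?U" using c d(1) \<epsilon>(1) by simp
    moreover have "f p \<in> P1_dom (f q) \<and> dist (P1_coord (f q) (f p)) (P1_coord (f q) (f q)) < e" if "p \<in> ?U" for p
    proof -
      have p: "p \<in> fst c" "dist (snd c p) (snd c q) < d" "snd c p \<in> ball (snd c q) \<epsilon>"
        using that by (auto simp: dist_commute)
      have "dist (g (snd c p)) (g (snd c q)) < e" using d(2) p(2) by blast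
      moreover have "f (param c (snd c p)) \<in> P1_dom (f q)" using bspec[OF \<epsilon>(3) p(3)] .
      ultimately show ?thesis unfolding g_def param_snd[OF c(1) p(1)] param_snd[OF c] by simp
    qed
    ultimately show ?thesis by blast
  qed
  show ?thesis
  proof (cases "f q")
    case Inf_pt
    hence a0: "a = Aff 0" using a ne by simp
    obtain U where U: "openin (surf_top X) U" "q \<in> U"
      "\<forall>p\<in>U. f p \<in> P1_dom (f q) \<and> dist (P1_coord (f q) (f p)) (P1_coord (f q) (f q)) < 1"
      using nbhd[of 1] by auto
    show ?thesis
    proof (rule that[OF U(1,2) zero_less_one])
      fix p assume p: "p \<in> U" "f p \<in> P1_dom a"
      obtain t where t: "f p = Aff t" "t \<noteq> 0"
        using p bspec[OF U(3) p(1)] Inf_pt a0 by (cases "f p") auto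
      have "norm (inverse t) < 1" using bspec[OF U(3) p(1)] Inf_pt t by (simp add: dist_norm)
      hence "norm t > 1" unfolding norm_inverse inverse_less_1_iff using t(2) by simp
      thus "norm (P1_coord a (f p)) \<ge> 1" using a0 t by simp
    qed
  next
    case (Aff b)
    show ?thesis
    proof (cases "a = Inf_pt")
      case False
      hence a0: "a = Aff 0" and b: "b \<noteq> 0" using a ne Aff by auto
      obtain U where U: "openin (surf_top X) U" "q \<in> U"
        "\<forall>p\<in>U. f p \<in> P1_dom (f q) \<and> dist (P1_coord (f q) (f p)) (P1_coord (f q) (f q)) < norm b / 2"
        using nbhd[of "norm b / 2"] b by auto
      show ?thesis
      proof (rule that[OF U(1,2)])
        show "norm b / 2 > 0" using b by simp
        fix p assume p: "p \<in> U" "f p \<in> P1_dom a"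
        have "dist (aff (f p)) b < norm b / 2" using bspec[OF U(3) p(1)] Aff by simp
        moreover have "norm b \<le> norm (aff (f p)) + dist (aff (f p)) b"
          unfolding dist_norm by (metis norm_minus_commute norm_triangle_sub)
        ultimately show "norm (P1_coord a (f p)) \<ge> norm b / 2" using a0 by simp
      qed
    next
      case True
      obtain U where U: "openin (surf_top X) U" "q \<in> U"
        "\<forall>p\<in>U. f p \<in> P1_dom (f q) \<and> dist (P1_coord (f q) (f p)) (P1_coord (f q) (f q)) < 1"
        using nbhd[of 1] by auto
      have pos: "norm b + 1 > 0" using norm_ge_zero[of b] by linarith
      show ?thesis
      proof (rule that[OF U(1,2)])
        show "1 / (norm b + 1) > 0" using pos by simp
        fix p assume p: "p \<in> U" "f p \<in> P1_dom a"
        obtain t where t: "f p = Aff t" "t \<noteq> 0"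
          using p bspec[OF U(3) p(1)] Aff True by (cases "f p") auto
        have "dist t b < 1" using bspec[OF U(3) p(1)] Aff t by simp
        moreover have "norm t \<le> norm b + dist t b"
          unfolding dist_norm by (metis norm_triangle_sub)
        ultimately have "norm t \<le> norm b + 1" by linarith
        thus "norm (P1_coord a (f p)) \<ge> 1 / (norm b + 1)"
          using le_imp_inverse_le[of "norm t" "norm b + 1"] True t
          by (simp add: norm_inverse inverse_eq_divide[of "norm b + 1", symmetric])
      qed
    qed
  qed
qed

text \<open>Compactness without sequences: the closures of K(1/(n+1)) are nested, closed and
  nonempty, so they have a common point.\<close>

lemma in_all_closures:
  assumes X: "compact_space T" and K: "\<And>e. e > 0 \<Longrightarrow> K e \<noteq> {}" "\<And>e. K e \<subseteq> topspace T"
    and mono: "\<And>d e. d \<le> e \<Longrightarrow> K d \<subseteq> K (e::real)"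
  obtains q where "q \<in> topspace T" "\<And>e U. e > 0 \<Longrightarrow> openin T U \<Longrightarrow> q \<in> U \<Longrightarrow> U \<inter> K e \<noteq> {}"
proof -
  let ?C = "\<lambda>n. T closure_of K (1 / real (Suc n))"
  have sub: "K e \<subseteq> T closure_of K e" for e by (rule closure_of_subset[OF K(2)])
  have "(\<Inter>n. ?C n) \<noteq> {}"
  proof (rule compact_space_imp_nest[OF X])
    show "closedin T (?C n)" for n by simp
    show "?C n \<noteq> {}" for n using sub[of "1 / real (Suc n)"] K(1)[of "1 / real (Suc n)"] by auto
    show "decseq ?C"
      unfolding decseq_def by (intro allI impI closure_of_mono mono) (simp add: field_simps)
  qed
  then obtain q where q: "\<And>n. q \<in> ?C n" by blast
  show ?thesis
  proof (rule that)
    show "q \<in> topspace T" using q[of 0] closure_of_subset_topspace by (metis subsetD)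
    fix e :: real and U assume e: "e > 0" and U: "openin T U" "q \<in> U"
    obtain n where "1 / real (Suc n) < e" using nat_approx_posE[OF e] by blast
    hence "K (1 / real (Suc n)) \<subseteq> K e" by (intro mono) simp
    moreover have "\<exists>y\<in>K (1 / real (Suc n)). y \<in> U"
      using q[of n] U unfolding in_closure_of by blast
    ultimately show "U \<inter> K e \<noteq> {}" by blast
  qed
qed

context normalised_curve
begin

text \<open>\<open>K e\<close> collects the points of the surface with coordinates
  \<open>\<xi> ^ r\<close> and \<open>\<xi> ^ m * w\<close>, where \<xi> is small and nonzero and w
  is near w0. It is nonempty because roots persist and the normalisation is onto. A point q in all
  closures lies over p. Eliminating \<xi> by \<open>v ^ r = u ^ m * w ^ r\<close> in a branch at q
  and letting z tend to 0 compares exponents and leading coefficients.\<close>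

lemma branch_over_root:
  assumes corner: "fst p \<in> {Aff 0, Inf_pt}" "snd p \<in> {Aff 0, Inf_pt}"
    and rm: "r > 0" "m > 0" "coprime r m"
    and w0: "w0 \<noteq> 0" "blowup (lcoef P p) r m 0 w0 = 0"
  obtains q where "q \<in> topspace (surf_top X)" "\<eta> q = p"
    "\<And>c r' m' h \<epsilon>. branch_at X \<eta> q c r' m' h \<epsilon> \<Longrightarrow> r' = r \<and> m' = m \<and> h 0 ^ r = w0 ^ r"
proof -
  let ?C = "lcoef P p"
  define K where "K e = {q \<in> topspace (surf_top X). \<exists>\<xi> w. \<xi> \<noteq> 0 \<and> norm \<xi> < e \<and> dist w w0 < e \<and>
     fst (\<eta> q) \<in> P1_dom (fst p) \<and> snd (\<eta> q) \<in> P1_dom (snd p) \<and>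
     P1_coord (fst p) (fst (\<eta> q)) = \<xi> ^ r \<and> P1_coord (snd p) (snd (\<eta> q)) = \<xi> ^ m * w}" for e
  have ne: "K e \<noteq> {}" if e: "e > 0" for e
  proof -
    obtain \<delta> where \<delta>: "\<delta> > 0" "\<And>\<xi>. norm \<xi> < \<delta> \<Longrightarrow> \<exists>w. dist w w0 < e \<and> blowup ?C r m \<xi> w = 0"
      by (rule blowup_root_exists[OF nondeg_lcoef[OF nondeg_cf] finite_msupp_lcoef rm(1) w0 e]) (rule that)
    define \<xi> :: complex where "\<xi> = of_real (min \<delta> e / 2)"
    have \<xi>: "norm \<xi> < \<delta>" "norm \<xi> < e" "\<xi> \<noteq> 0" using \<delta>(1) e by (auto simp: \<xi>_def min_def)
    obtain w where w: "dist w w0 < e" "blowup ?C r m \<xi> w = 0" using \<delta>(2)[OF \<xi>(1)] by blast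
    obtain x where x: "x \<in> P1_dom (fst p)" "P1_coord (fst p) x = \<xi> ^ r"
      by (rule P1_coord_surj[OF corner(1)]) (rule that)
    obtain y where y: "y \<in> P1_dom (snd p)" "P1_coord (snd p) y = \<xi> ^ m * w"
      by (rule P1_coord_surj[OF corner(2)]) (rule that)
    have "(x, y) \<in> proj_curve P"
      using proj_curve_iff[OF corner, of "(x, y)" P] x y
      by (simp add: local_equation_eq psum_blowup[OF finite_msupp_lcoef] w)
    then obtain q where "q \<in> topspace (surf_top X)" "\<eta> q = (x, y)"
      using onto by (metis imageE)
    hence "q \<in> K e" using x y \<xi> w unfolding K_def by auto
    thus ?thesis by blast
  qed
  have mono: "K d \<subseteq> K e" if "d \<le> e" for d e
  proof
    fix q assume "q \<in> K d"
    then obtain \<xi> w where "q \<in> topspace (surf_top X)" "\<xi> \<noteq> 0 \<and> norm \<xi> < d \<and> dist w w0 < d \<and>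
     fst (\<eta> q) \<in> P1_dom (fst p) \<and> snd (\<eta> q) \<in> P1_dom (snd p) \<and>
     P1_coord (fst p) (fst (\<eta> q)) = \<xi> ^ r \<and> P1_coord (snd p) (snd (\<eta> q)) = \<xi> ^ m * w"
      unfolding K_def by blast
    thus "q \<in> K e" unfolding K_def using that by (intro CollectI conjI exI[of _ \<xi>] exI[of _ w]) auto
  qed
  have Ksub: "K e \<subseteq> topspace (surf_top X)" for e unfolding K_def by blast
  obtain q where q: "q \<in> topspace (surf_top X)"
    "\<And>e U. e > 0 \<Longrightarrow> openin (surf_top X) U \<Longrightarrow> q \<in> U \<Longrightarrow> U \<inter> K e \<noteq> {}"
    by (rule in_all_closures[where K = K, OF compact ne Ksub mono]) (assumption, assumption, rule that)
  have fst_eq: "fst (\<eta> q) = fst p"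
  proof (rule ccontr)
    assume "fst (\<eta> q) \<noteq> fst p"
    hence "(fst \<circ> \<eta>) q \<noteq> fst p" by simp
    then obtain U \<delta> where U: "openin (surf_top X) U" "q \<in> U" "\<delta> > 0"
      "\<And>x. x \<in> U \<Longrightarrow> (fst \<circ> \<eta>) x \<in> P1_dom (fst p) \<Longrightarrow> norm (P1_coord (fst p) ((fst \<circ> \<eta>) x)) \<ge> \<delta>"
      by (rule P1_separated[OF surface hol_x q(1) corner(1)]) (rule that)
    have "min \<delta> 1 > 0" using U(3) by simp
    then obtain x where x: "x \<in> U" "x \<in> K (min \<delta> 1)" using q(2)[OF _ U(1,2)] by blast
    then obtain \<xi> where \<xi>: "norm \<xi> < \<delta>" "norm \<xi> < 1" "fst (\<eta> x) \<in> P1_dom (fst p)" "P1_coord (fst p) (fst (\<eta> x)) = \<xi> ^ r"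
      unfolding K_def by auto
    have "norm (\<xi> ^ r) \<le> norm \<xi>"
      using power_decreasing[of 1 r "norm \<xi>"] \<xi>(2) rm(1) by (simp add: norm_power)
    thus False using U(4)[OF x(1)] \<xi> by simp
  qed
  have snd_eq: "snd (\<eta> q) = snd p"
  proof (rule ccontr)
    assume "snd (\<eta> q) \<noteq> snd p"
    hence "(snd \<circ> \<eta>) q \<noteq> snd p" by simp
    then obtain U \<delta> where U: "openin (surf_top X) U" "q \<in> U" "\<delta> > 0"
      "\<And>x. x \<in> U \<Longrightarrow> (snd \<circ> \<eta>) x \<in> P1_dom (snd p) \<Longrightarrow> norm (P1_coord (snd p) ((snd \<circ> \<eta>) x)) \<ge> \<delta>"
      by (rule P1_separated[OF surface hol_y q(1) corner(2)]) (rule that)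
    have pos: "norm w0 + 1 > 0" using norm_ge_zero[of w0] by linarith
    hence "min (\<delta> / (norm w0 + 1)) 1 > 0" using U(3) by simp
    then obtain x where x: "x \<in> U" "x \<in> K (min (\<delta> / (norm w0 + 1)) 1)" using q(2)[OF _ U(1,2)] by blast
    then obtain \<xi> w where \<xi>: "norm \<xi> < \<delta> / (norm w0 + 1)" "norm \<xi> < 1" "dist w w0 < 1"
      "snd (\<eta> x) \<in> P1_dom (snd p)" "P1_coord (snd p) (snd (\<eta> x)) = \<xi> ^ m * w"
      unfolding K_def by auto
    have "norm (\<xi> ^ m) \<le> norm \<xi>"
      using power_decreasing[of 1 m "norm \<xi>"] \<xi>(2) rm(2) by (simp add: norm_power)
    moreover have "norm w \<le> norm w0 + dist w w0"
      unfolding dist_norm by (metis norm_triangle_sub)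
    hence "norm w \<le> norm w0 + 1" using \<xi>(3) by linarith
    ultimately have "norm (\<xi> ^ m * w) \<le> norm \<xi> * (norm w0 + 1)"
      unfolding norm_mult by (intro mult_mono) auto
    also have "\<dots> < \<delta>" using \<xi>(1) pos by (simp add: field_simps)
    finally show False using U(4)[OF x(1)] \<xi> by simp
  qed
  have eq: "\<eta> q = p" using fst_eq snd_eq by (rule prod_eqI)
  show ?thesis
  proof (rule that[OF q(1) eq])
    fix c r' m' h \<epsilon> assume br: "branch_at X \<eta> q c r' m' h \<epsilon>"
    note D = branch_atD[OF br]
    have cop: "coprime r' m'" by (rule branch_coprime[OF br]) (use corner eq in auto)
    have "\<exists>z w. z \<in> ball 0 \<epsilon> \<and> z \<noteq> 0 \<and> norm z < e \<and> dist w w0 < e \<and>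
        z ^ (m' * r) * h z ^ r = z ^ (r' * m) * w ^ r" if e: "e > 0" for e
    proof -
      let ?V = "ball 0 (min e \<epsilon>)"
      let ?U = "{x \<in> fst c. snd c x \<in> ?V}"
      have "?V \<subseteq> snd c ` fst c" using D(7) by auto
      hence "openin (surf_top X) ?U" by (intro chart_preimage_open[OF D(1)]) auto
      moreover have "q \<in> ?U" using D(2,3,6) e by simp
      ultimately obtain x where x: "x \<in> ?U" "x \<in> K e" using q(2)[OF e] by blast
      then obtain \<xi> w where \<xi>: "\<xi> \<noteq> 0" "dist w w0 < e"
        "P1_coord (fst p) (fst (\<eta> x)) = \<xi> ^ r" "P1_coord (snd p) (snd (\<eta> x)) = \<xi> ^ m * w"
        unfolding K_def by blast
      define z where "z = snd c x"
      have z: "z \<in> ball 0 \<epsilon>" "norm z < e" "param c z = x"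
        using x(1) param_snd[OF D(1)] by (auto simp: z_def)
      have u: "z ^ r' = \<xi> ^ r" and v: "z ^ m' * h z = \<xi> ^ m * w"
        using D(12)[OF z(1)] D(13)[OF z(1)] \<xi>(3,4) unfolding z(3) eq by simp_all
      have "z ^ r' \<noteq> 0" unfolding u using \<xi>(1) by simp
      hence "z \<noteq> 0" using D(4) by (auto simp: zero_power)
      moreover have "z ^ (m' * r) * h z ^ r = (\<xi> ^ m * w) ^ r"
        unfolding v[symmetric] power_mult_distrib power_mult ..
      hence "z ^ (m' * r) * h z ^ r = (\<xi> ^ r) ^ m * w ^ r"
        by (simp add: power_mult_distrib power_mult[symmetric] mult.commute)
      hence "z ^ (m' * r) * h z ^ r = z ^ (r' * m) * w ^ r"
        unfolding u[symmetric] power_mult .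
      ultimately show ?thesis using z \<xi> by blast
    qed
    hence "\<forall>n. \<exists>z w. z \<in> ball 0 \<epsilon> \<and> z \<noteq> 0 \<and> norm z < 1 / real (Suc n) \<and> dist w w0 < 1 / real (Suc n) \<and>
        z ^ (m' * r) * h z ^ r = z ^ (r' * m) * w ^ r" by simp
    then obtain z w where zw: "\<And>n. z n \<in> ball 0 \<epsilon>" "\<And>n. z n \<noteq> 0" "\<And>n. norm (z n) < 1 / real (Suc n)"
      "\<And>n. dist (w n) w0 < 1 / real (Suc n)"
      "\<And>n. z n ^ (m' * r) * h (z n) ^ r = z n ^ (r' * m) * w n ^ r"
      by metis
    have inv0: "(\<lambda>n. 1 / real (Suc n)) \<longlonglongrightarrow> 0" using LIMSEQ_inverse_real_of_nat by (simp add: inverse_eq_divide)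
    have z0: "z \<longlonglongrightarrow> 0"
      by (rule Lim_null_comparison[OF _ inv0]) (use zw(3) in \<open>auto intro!: always_eventually less_imp_le\<close>)
    have w0': "w \<longlonglongrightarrow> w0"
    proof -
      have "(\<lambda>n. dist (w n) w0) \<longlonglongrightarrow> 0"
        by (rule tendsto_sandwich[OF _ _ tendsto_const inv0]) (use zw(4) in \<open>auto intro!: always_eventually less_imp_le\<close>)
      thus ?thesis using tendsto_dist_iff by blast
    qed
    have "isCont h 0"
      using holomorphic_on_imp_continuous_on[OF D(8)] D(6) by (simp add: continuous_on_eq_continuous_at)
    hence hz: "(\<lambda>n. h (z n)) \<longlonglongrightarrow> h 0" using z0 by (rule isCont_tendsto_compose)
    have hr: "(\<lambda>n. h (z n) ^ r) \<longlonglongrightarrow> h 0 ^ r" and wr: "(\<lambda>n. w n ^ r) \<longlonglongrightarrow> w0 ^ r"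
      by (intro tendsto_intros hz w0')+
    have h0: "h 0 ^ r \<noteq> 0" using D(6,9) by simp
    \<comment> \<open>If one exponent were larger, dividing by the smaller power of z would leave a
      factor tending to 0 and force \<open>h 0 ^ r\<close> or \<open>w0 ^ r\<close> to
      vanish.\<close>
    have eqmr: "m' * r = r' * m"
    proof (rule linorder_cases[of "m' * r" "r' * m"])
      assume "m' * r < r' * m"
      then obtain d where d: "r' * m = m' * r + d" "d > 0" using less_imp_add_positive by metis
      have "h (z n) ^ r = z n ^ d * w n ^ r" for n
        using zw(5)[of n] zw(2)[of n] unfolding d by (simp add: power_add mult.assoc)
      moreover have "(\<lambda>n. z n ^ d * w n ^ r) \<longlonglongrightarrow> 0 ^ d * w0 ^ r" by (intro tendsto_intros z0 w0')
      ultimately have "h 0 ^ r = 0 ^ d * w0 ^ r" using LIMSEQ_unique[OF hr] by simp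
      thus ?thesis using h0 d(2) by (simp add: zero_power)
    next
      assume "r' * m < m' * r"
      then obtain d where d: "m' * r = r' * m + d" "d > 0" using less_imp_add_positive by metis
      have "w n ^ r = z n ^ d * h (z n) ^ r" for n
        using zw(5)[of n] zw(2)[of n] unfolding d by (simp add: power_add mult.assoc)
      moreover have "(\<lambda>n. z n ^ d * h (z n) ^ r) \<longlonglongrightarrow> 0 ^ d * h 0 ^ r" by (intro tendsto_intros z0 hz)
      ultimately have "w0 ^ r = 0 ^ d * h 0 ^ r" using LIMSEQ_unique[OF wr] by simp
      thus ?thesis using w0(1) d(2) by (simp add: zero_power)
    qed
    have "h (z n) ^ r = w n ^ r" for n using zw(5)[of n] zw(2)[of n] unfolding eqmr by simp
    hence "h 0 ^ r = w0 ^ r" using LIMSEQ_unique[OF hr] wr by simp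
    \<comment> \<open>Both pairs are coprime, so proportionality is equality.\<close>
    moreover have "r' = r \<and> m' = m"
      using coprime_crossproduct_nat[of m' r' m r] cop rm(3) eqmr by (simp add: coprime_commute mult.commute)
    ultimately show "r' = r \<and> m' = m \<and> h 0 ^ r = w0 ^ r" by blast
  qed
qed

end

section \<open>Fibres over the corners\<close>

text \<open>Only values off 0 enter, so an uninformative value of the 1-form at the centre is
  harmless.\<close>

lemma laurent_leading:
  assumes G: "G holomorphic_on ball 0 \<epsilon>" "\<epsilon> > 0" "G 0 \<noteq> 0"
    and f: "\<And>z. z \<in> ball 0 \<epsilon> \<Longrightarrow> z \<noteq> 0 \<Longrightarrow> f z = G z * z powi e"
  shows "fls_subdegree (laurent_expansion f 0) = e" "fls_nth (laurent_expansion f 0) e = G 0"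
proof -
  define F where "F = fps_expansion G 0"
  have F: "G has_fps_expansion F"
    unfolding F_def by (rule has_fps_expansion_fps_expansion[OF open_ball _ G(1)]) (use G(2) in simp)
  have F0: "fps_nth F 0 = G 0" by (simp add: F_def fps_expansion_def)
  have "(\<lambda>z. G z * z powi e) has_laurent_expansion fls_shift (- e) (fps_to_fls F)"
    by (intro laurent_expansion_intros has_laurent_expansion_fps[OF F])
  moreover have "eventually (\<lambda>z. f z = G z * z powi e) (at 0)"
  proof -
    have "eventually (\<lambda>z. z \<in> ball 0 \<epsilon> - {0}) (at (0::complex))"
      using G(2) by (intro eventually_at_in_open) auto
    thus ?thesis by eventually_elim (use f in auto)
  qed
  ultimately have "f has_laurent_expansion fls_shift (- e) (fps_to_fls F)"
    using has_laurent_expansion_cong[of f "\<lambda>z. G z * z powi e"] by blast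
  hence L: "laurent_expansion f 0 = fls_shift (- e) (fps_to_fls F)"
    by (rule laurent_expansion_0_eqI)
  show nth: "fls_nth (laurent_expansion f 0) e = G 0"
    unfolding L using F0 by simp
  have "F \<noteq> 0" "subdegree F = 0" using F0 G(3) by (auto intro: subdegreeI)
  thus "fls_subdegree (laurent_expansion f 0) = e"
    unfolding L by (subst fls_shift_subdegree) (auto simp: fls_subdegree_fls_to_fps)
qed

context normalised_curve
begin

definition orient :: "P1 \<Rightarrow> int" where
  "orient a = (if a = Inf_pt then -1 else 1)"

lemma aff_orient:
  assumes "a \<in> {Aff 0, Inf_pt}" "x \<in> P1_dom a" "P1_coord a x \<noteq> 0"
  shows "aff x = P1_coord a x powi orient a"
  using assms by (cases x) (auto simp: orient_def)

text \<open>In a branch x is a pure power of z, so h is never differentiated and the coefficient has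
  a closed form. The formula for x is used on the punctured disc only, because \<open>aff\<close>
  may take its default value at the centre.\<close>

lemma om01_branch:
  assumes br: "branch_at X \<eta> q c r m h \<epsilon>"
    and corner: "fst (\<eta> q) \<in> {Aff 0, Inf_pt}" "snd (\<eta> q) \<in> {Aff 0, Inf_pt}"
    and z: "z \<in> ball 0 \<epsilon>" "z \<noteq> 0"
  defines "\<sigma> \<equiv> orient (fst (\<eta> q))" and "\<tau> \<equiv> orient (snd (\<eta> q))"
  shows "om01 S c z = (of_int (\<sigma> * int r) * h z powi \<tau>) * z powi (\<sigma> * int r + \<tau> * int m - 1)"
proof -
  note D = branch_atD[OF br]
  have hz: "h z \<noteq> 0" by (rule D(9)[OF z(1)])
  have ay: "aff (snd (\<eta> (param c z))) = (z ^ m * h z) powi \<tau>"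
    unfolding \<tau>_def D(13)[OF z(1), symmetric]
    by (rule aff_orient[OF corner(2) D(11)[OF z(1)]]) (use D(13)[OF z(1)] z hz in simp)
  have ax: "aff (fst (\<eta> (param c w))) = w powi (\<sigma> * int r)" if "w \<in> ball 0 \<epsilon> - {0}" for w
  proof -
    have w: "w \<in> ball 0 \<epsilon>" "w \<noteq> 0" using that by auto
    have "aff (fst (\<eta> (param c w))) = (w ^ r) powi \<sigma>"
      unfolding \<sigma>_def D(12)[OF w(1), symmetric]
      by (rule aff_orient[OF corner(1) D(10)[OF w(1)]]) (use D(12)[OF w(1)] w in simp)
    also have "\<dots> = w powi (\<sigma> * int r)"
      by (simp add: power_int_power mult.commute)
    finally show ?thesis .
  qed
  have "((\<lambda>w. w powi (\<sigma> * int r)) has_field_derivative of_int (\<sigma> * int r) * z powi (\<sigma> * int r - 1)) (at z)"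
    using z(2) by (auto intro!: derivative_eq_intros)
  moreover have "open (ball (0::complex) \<epsilon> - {0})" by (rule open_delete[OF open_ball])
  ultimately have "((\<lambda>w. aff (fst (\<eta> (param c w)))) has_field_derivative of_int (\<sigma> * int r) * z powi (\<sigma> * int r - 1)) (at z)"
    by (rule has_field_derivative_transform_within_open) (use z ax in auto)
  hence "deriv (\<lambda>w. aff (fst (\<eta> (param c w)))) z = of_int (\<sigma> * int r) * z powi (\<sigma> * int r - 1)"
    by (rule DERIV_imp_deriv)
  hence "om01 S c z = (z ^ m * h z) powi \<tau> * (of_int (\<sigma> * int r) * z powi (\<sigma> * int r - 1))"
    by (simp add: compact_spectral_curve_def pullback_ydx_def ay)
  also have "(z ^ m * h z) powi \<tau> = z powi (\<tau> * int m) * h z powi \<tau>"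
    by (simp add: power_int_mult_distrib power_int_power mult.commute)
  also have "z powi (\<tau> * int m) * h z powi \<tau> * (of_int (\<sigma> * int r) * z powi (\<sigma> * int r - 1)) =
     (of_int (\<sigma> * int r) * h z powi \<tau>) * (z powi (\<sigma> * int r - 1) * z powi (\<tau> * int m))"
    by (simp only: ac_simps)
  also have "z powi (\<sigma> * int r - 1) * z powi (\<tau> * int m) = z powi (\<sigma> * int r + \<tau> * int m - 1)"
    using z(2) by (simp add: power_int_add[symmetric] algebra_simps)
  finally show ?thesis .
qed

definition std_chart :: "'a \<Rightarrow> 'a chart" where
  "std_chart q = (SOME c. standard_coordinate S q c)"

definition ymult :: "'a \<Rightarrow> nat" where
  "ymult q = (SOME m. \<exists>h \<epsilon>. branch_at X \<eta> q (std_chart q) (ram S q) m h \<epsilon>)"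

text \<open>The leading coefficient h(0). Multiplying the standard coordinate by an r-th root of
  unity may change it but not its r-th power, by which points are told apart.\<close>

definition ylead :: "'a \<Rightarrow> complex" where
  "ylead q = (SOME a. \<exists>h \<epsilon>. branch_at X \<eta> q (std_chart q) (ram S q) (ymult q) h \<epsilon> \<and> a = h 0)"

definition fibre :: "P1 \<times> P1 \<Rightarrow> 'a set" where
  "fibre p = {q \<in> topspace (surf_top X). \<eta> q = p}"

lemma fibre_branch:
  assumes q: "q \<in> fibre p" and corner: "fst p \<in> {Aff 0, Inf_pt}" "snd p \<in> {Aff 0, Inf_pt}"
  obtains h \<epsilon> where "branch_at X \<eta> q (std_chart q) (ram S q) (ymult q) h \<epsilon>" "ylead q = h 0"
proof -
  have "\<exists>m h \<epsilon>. branch_at X \<eta> q (std_chart q) (ram S q) m h \<epsilon>"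
    unfolding std_chart_def by (rule branch_exists) (use q corner in \<open>auto simp: fibre_def\<close>)
  hence "\<exists>h \<epsilon>. branch_at X \<eta> q (std_chart q) (ram S q) (ymult q) h \<epsilon>"
    unfolding ymult_def by (rule someI_ex)
  hence "\<exists>a h \<epsilon>. branch_at X \<eta> q (std_chart q) (ram S q) (ymult q) h \<epsilon> \<and> a = h 0" by blast
  hence "\<exists>h \<epsilon>. branch_at X \<eta> q (std_chart q) (ram S q) (ymult q) h \<epsilon> \<and> ylead q = h 0"
    unfolding ylead_def by (rule someI_ex)
  thus ?thesis using that by blast
qed

lemma fibre_props:
  assumes q: "q \<in> fibre p" and corner: "fst p \<in> {Aff 0, Inf_pt}" "snd p \<in> {Aff 0, Inf_pt}"
  shows "ram S q > 0" "ymult q > 0" "coprime (ram S q) (ymult q)" "ylead q \<noteq> 0"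
    "blowup (lcoef P p) (ram S q) (ymult q) 0 (ylead q) = 0"
    "sbar S q = orient (fst p) * int (ram S q) + orient (snd p) * int (ymult q)"
    "tau0 S q = of_int (orient (fst p) * int (ram S q)) * ylead q powi orient (snd p)"
    "tau0 S q \<noteq> 0"
    "\<And>l. l < sbar S q \<Longrightarrow> tau S q l = 0"
proof -
  obtain h \<epsilon> where br: "branch_at X \<eta> q (std_chart q) (ram S q) (ymult q) h \<epsilon>" and lead: "ylead q = h 0"
    by (rule fibre_branch[OF assms]) (rule that)
  have \<eta>q: "\<eta> q = p" using q by (simp add: fibre_def)
  note D = branch_atD[OF br] and corner' = corner[folded \<eta>q]
  show r: "ram S q > 0" and "ymult q > 0" by (rule D)+
  show "coprime (ram S q) (ymult q)" by (rule branch_coprime[OF br corner'])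
  show nz: "ylead q \<noteq> 0" "blowup (lcoef P p) (ram S q) (ymult q) 0 (ylead q) = 0"
    using branch_root[OF br corner'] unfolding lead \<eta>q by blast+
  let ?\<sigma> = "orient (fst p)" and ?\<tau> = "orient (snd p)"
  let ?e = "?\<sigma> * int (ram S q) + ?\<tau> * int (ymult q) - 1"
  let ?G = "\<lambda>z. of_int (?\<sigma> * int (ram S q)) * h z powi ?\<tau>"
  have G: "?G holomorphic_on ball 0 \<epsilon>"
    by (intro holomorphic_intros D(8)) (use D(9) in auto)
  have G0: "?G 0 \<noteq> 0" using r nz(1) lead by (simp add: orient_def)
  have om: "om01 S (std_chart q) z = ?G z * z powi ?e" if "z \<in> ball 0 \<epsilon>" "z \<noteq> 0" for z
    using om01_branch[OF br corner' that] unfolding \<eta>q .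
  have L: "fls_subdegree (om01_expansion S q) = ?e" "fls_nth (om01_expansion S q) ?e = ?G 0"
    using laurent_leading[OF G D(6) G0 om] unfolding om01_expansion_def std_chart_def[symmetric] by blast+
  show s: "sbar S q = ?\<sigma> * int (ram S q) + ?\<tau> * int (ymult q)"
    unfolding sbar_def L(1) by simp
  show t: "tau0 S q = of_int (?\<sigma> * int (ram S q)) * ylead q powi ?\<tau>"
    unfolding tau0_def tau_def s lead L(2)[symmetric] ..
  show "tau0 S q \<noteq> 0" unfolding t lead using G0 .
  show "tau S q l = 0" if "l < sbar S q" for l
    unfolding tau_def by (rule fls_eq0_below_subdegree) (use that in \<open>simp add: sbar_def\<close>)
qed

text \<open>Modulo the ramification index, \<open>sbar\<close> is \<plusminus>
  \<open>ymult\<close>.\<close>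

lemma gcd_sbar:
  assumes q: "q \<in> fibre p" and corner: "fst p \<in> {Aff 0, Inf_pt}" "snd p \<in> {Aff 0, Inf_pt}"
  shows "coprime (sbar S q) (int (ram S q))"
proof -
  note F = fibre_props[OF assms]
  have "coprime (int (ymult q)) (int (ram S q))" using F(3) by (simp add: coprime_commute)
  hence "coprime (orient (snd p) * int (ymult q)) (int (ram S q))" by (simp add: orient_def)
  thus ?thesis unfolding F(6)
    by (metis coprime_iff_gcd_eq_1 gcd_add_mult gcd.commute add.commute mult.commute)
qed

text \<open>For r \<ge> 2 coprimality prevents r from dividing \<open>sbar\<close>, so the first
  nonzero coefficient is also the first one that \<open>s_par\<close> counts. Thus s equals
  \<open>sbar\<close>, and both its coprimality to r and the position of \<open>sbar\<close>
  relative to s are automatic.\<close>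

lemma locally_admissible_iff:
  assumes q: "q \<in> fibre p" and corner: "fst p \<in> {Aff 0, Inf_pt}" "snd p \<in> {Aff 0, Inf_pt}"
  shows "locally_admissible S q \<longleftrightarrow> ram S q = 1 \<or> sbar S q \<le> -1 \<or>
    (sbar S q \<in> {1..int (ram S q) + 1} \<and> cong_pm1 (int (ram S q)) (sbar S q))"
proof (cases "ram S q = 1")
  case False
  note F = fibre_props[OF assms] and cop = gcd_sbar[OF assms]
  have r: "int (ram S q) \<ge> 2" using False F(1) by simp
  have nd: "\<not> int (ram S q) dvd sbar S q"
  proof
    assume "int (ram S q) dvd sbar S q"
    hence "is_unit (int (ram S q))" using cop by (metis coprime_common_divisor dvd_refl)
    thus False using r by simp
  qed
  have s: "s_par S q = Some (sbar S q)"
  proof -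
    have ex: "tau S q (sbar S q) \<noteq> 0 \<and> \<not> int (ram S q) dvd sbar S q"
      using F(8) nd unfolding tau0_def by blast
    \<comment> \<open>On the integers \<open>LEAST\<close> needs an exhibited minimum, which the
      vanishing of all coefficients below \<open>sbar\<close> provides.\<close>
    have "(LEAST l. tau S q l \<noteq> 0 \<and> \<not> int (ram S q) dvd l) = sbar S q"
    proof (rule Least_equality)
      show "tau S q (sbar S q) \<noteq> 0 \<and> \<not> int (ram S q) dvd sbar S q" by (rule ex)
      show "sbar S q \<le> y" if "tau S q y \<noteq> 0 \<and> \<not> int (ram S q) dvd y" for y
        using F(9)[of y] that by linarith
    qed
    thus ?thesis unfolding s_par_def using ex by auto
  qed
  show ?thesis unfolding locally_admissible_def Let_def s using False r cop by auto
qed (simp add: locally_admissible_def)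

lemma fibre_distinct:
  assumes "q1 \<in> fibre p" "q2 \<in> fibre p" "q1 \<noteq> q2"
    and corner: "fst p \<in> {Aff 0, Inf_pt}" "snd p \<in> {Aff 0, Inf_pt}"
    and same: "ram S q1 = ram S q2" "ymult q1 = ymult q2"
  shows "ylead q1 ^ ram S q1 \<noteq> ylead q2 ^ ram S q2"
proof -
  obtain h1 \<epsilon>1 where 1: "branch_at X \<eta> q1 (std_chart q1) (ram S q1) (ymult q1) h1 \<epsilon>1" "ylead q1 = h1 0"
    by (rule fibre_branch[OF assms(1) corner]) (rule that)
  obtain h2 \<epsilon>2 where 2: "branch_at X \<eta> q2 (std_chart q2) (ram S q2) (ymult q2) h2 \<epsilon>2" "ylead q2 = h2 0"
    by (rule fibre_branch[OF assms(2) corner]) (rule that)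
  have "\<eta> q1 = p" "\<eta> q2 = p" using assms by (simp_all add: fibre_def)
  thus ?thesis
    using branch_distinct[OF 1(1) 2(1)[folded same]] assms(3) corner unfolding 1(2) 2(2) same by simp
qed

lemma nu_eq:
  assumes q: "q \<in> fibre p" and corner: "fst p \<in> {Aff 0, Inf_pt}" "snd p \<in> {Aff 0, Inf_pt}"
  shows "nu S q = of_int (orient (fst p)) + of_int (orient (snd p)) * (real (ymult q) / real (ram S q))"
  unfolding nu_def fibre_props(6)[OF assms] using fibre_props(1)[OF assms]
  by (simp add: field_simps)

text \<open>Equal \<nu> means equal m/r, hence the same coprime pair (r, m). The exponent r' is r
  itself, and the quotient in question is the ratio of the two \<open>ylead\<close> values or its
  inverse, whose r-th power is not 1 by \<open>fibre_distinct\<close>.\<close>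

lemma fibre_non_resonant:
  assumes q: "q1 \<in> fibre p" "q2 \<in> fibre p" "q1 \<noteq> q2"
    and corner: "fst p \<in> {Aff 0, Inf_pt}" "snd p \<in> {Aff 0, Inf_pt}"
  shows "non_resonant S q1 q2"
proof (cases "nu S q1 = nu S q2")
  case True
  note F1 = fibre_props[OF q(1) corner] and F2 = fibre_props[OF q(2) corner]
  have "real (ymult q1) / real (ram S q1) = real (ymult q2) / real (ram S q2)"
    using True unfolding nu_eq[OF q(1) corner] nu_eq[OF q(2) corner] by (auto simp: orient_def split: if_splits)
  hence "real (ymult q1 * ram S q2) = real (ymult q2 * ram S q1)" using F1(1) F2(1) by (simp add: field_simps)
  hence "ymult q1 * ram S q2 = ymult q2 * ram S q1" by (simp only: of_nat_eq_iff)
  hence same: "ymult q1 = ymult q2" "ram S q1 = ram S q2"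
    using coprime_crossproduct_nat[of "ymult q1" "ram S q1" "ymult q2" "ram S q2"] F1(3) F2(3)
    by (simp_all add: coprime_commute mult.commute)
  have ne: "ylead q1 ^ ram S q1 \<noteq> ylead q2 ^ ram S q2" by (rule fibre_distinct[OF q corner same(2,1)])
  have "gcd (int (ram S q1)) (sbar S q1) = 1"
    using gcd_sbar[OF q(1) corner] by (simp add: coprime_iff_gcd_eq_1 gcd.commute)
  hence exp: "ram S q1 div nat (gcd (int (ram S q1)) (sbar S q1)) = ram S q1" by simp
  have "tau0 S q1 / of_nat (ram S q1) / (tau0 S q2 / of_nat (ram S q2)) =
     ylead q1 powi orient (snd p) / ylead q2 powi orient (snd p)"
    unfolding F1(7) F2(7) using F1(1) F2(1) by (simp add: orient_def)
  moreover have "(ylead q1 powi orient (snd p) / ylead q2 powi orient (snd p)) ^ ram S q1 \<noteq> 1"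
    using ne F1(4) F2(4) same by (auto simp: orient_def power_divide power_inverse field_simps)
  ultimately show ?thesis unfolding non_resonant_def exp by simp
qed (simp add: non_resonant_def)

text \<open>Injective by the distinctness of branches, surjective by compactness.\<close>

lemma fibre_roots_bij:
  assumes corner: "fst p \<in> {Aff 0, Inf_pt}" "snd p \<in> {Aff 0, Inf_pt}"
    and rm: "r > 0" "m > 0" "coprime r m"
  shows "bij_betw (\<lambda>q. ylead q ^ r) {q \<in> fibre p. ram S q = r \<and> ymult q = m}
           {w ^ r |w. w \<noteq> 0 \<and> blowup (lcoef P p) r m 0 w = 0}"
  unfolding bij_betw_def
proof
  show "inj_on (\<lambda>q. ylead q ^ r) {q \<in> fibre p. ram S q = r \<and> ymult q = m}"
  proof (rule inj_onI, rule ccontr)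
    fix q1 q2
    assume a: "q1 \<in> {q \<in> fibre p. ram S q = r \<and> ymult q = m}"
      "q2 \<in> {q \<in> fibre p. ram S q = r \<and> ymult q = m}" "ylead q1 ^ r = ylead q2 ^ r" "q1 \<noteq> q2"
    hence "q1 \<in> fibre p" "q2 \<in> fibre p" "ram S q1 = ram S q2" "ymult q1 = ymult q2" by simp_all
    from fibre_distinct[OF this(1,2) a(4) corner this(3,4)] show False using a by simp
  qed
  show "(\<lambda>q. ylead q ^ r) ` {q \<in> fibre p. ram S q = r \<and> ymult q = m} =
      {w ^ r |w. w \<noteq> 0 \<and> blowup (lcoef P p) r m 0 w = 0}"
  proof (intro equalityI subsetI)
    fix a assume "a \<in> (\<lambda>q. ylead q ^ r) ` {q \<in> fibre p. ram S q = r \<and> ymult q = m}"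
    then obtain q where q: "q \<in> fibre p" "ram S q = r" "ymult q = m" "a = ylead q ^ r" by blast
    show "a \<in> {w ^ r |w. w \<noteq> 0 \<and> blowup (lcoef P p) r m 0 w = 0}"
      using fibre_props(4,5)[OF q(1) corner] q by blast
  next
    fix a assume "a \<in> {w ^ r |w. w \<noteq> 0 \<and> blowup (lcoef P p) r m 0 w = 0}"
    then obtain w where w: "a = w ^ r" "w \<noteq> 0" "blowup (lcoef P p) r m 0 w = 0" by blast
    obtain q where q: "q \<in> topspace (surf_top X)" "\<eta> q = p"
      "\<And>c r' m' h \<epsilon>. branch_at X \<eta> q c r' m' h \<epsilon> \<Longrightarrow> r' = r \<and> m' = m \<and> h 0 ^ r = w ^ r"
      using branch_over_root[OF corner rm w(2,3)] by metis
    have qf: "q \<in> fibre p" using q by (simp add: fibre_def)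
    obtain h \<epsilon> where br: "branch_at X \<eta> q (std_chart q) (ram S q) (ymult q) h \<epsilon>" "ylead q = h 0"
      by (rule fibre_branch[OF qf corner]) (rule that)
    have "ram S q = r" "ymult q = m" "ylead q ^ r = a" using q(3)[OF br(1)] br(2) w(1) by simp_all
    thus "a \<in> (\<lambda>q. ylead q ^ r) ` {q \<in> fibre p. ram S q = r \<and> ymult q = m}" using qf by blast
  qed
qed

end

section \<open>Lattice segments and Newton diagrams\<close>

text \<open>In a convex combination attaining the minimum of a linear form, every point above the
  minimum has coefficient 0.\<close>

lemma mem_convex_hull_face:
  fixes S :: "'a::euclidean_space set"
  assumes fin: "finite S" and z: "z \<in> convex hull S"
    and le: "\<And>s. s \<in> S \<Longrightarrow> N \<le> w \<bullet> s" and eq: "w \<bullet> z = N"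
  shows "z \<in> convex hull {s \<in> S. w \<bullet> s = N}"
proof -
  obtain u where u: "\<forall>x\<in>S. 0 \<le> u x" "sum u S = 1" "(\<Sum>x\<in>S. u x *\<^sub>R x) = z"
    using z unfolding convex_hull_finite[OF fin] by blast
  let ?F = "{s \<in> S. w \<bullet> s = N}"
  have "(\<Sum>x\<in>S. u x * (w \<bullet> x - N)) = w \<bullet> z - N"
    unfolding u(3)[symmetric] inner_sum_right
    using u(2) by (simp add: right_diff_distrib sum_subtractf sum_distrib_right[symmetric])
  hence "(\<Sum>x\<in>S. u x * (w \<bullet> x - N)) = 0" using eq by simp
  hence "\<forall>x\<in>S. u x * (w \<bullet> x - N) = 0"
    using fin u(1) le by (subst (asm) sum_nonneg_eq_0_iff) auto
  hence off: "u x = 0" if "x \<in> S - ?F" for x using that by auto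
  have "sum u ?F = 1"
    unfolding u(2)[symmetric] by (rule sum.mono_neutral_left) (use fin off in auto)
  moreover have "(\<Sum>x\<in>?F. u x *\<^sub>R x) = z"
    unfolding u(3)[symmetric] by (rule sum.mono_neutral_left) (use fin off in auto)
  moreover have "\<forall>x\<in>?F. 0 \<le> u x" using u(1) by blast
  moreover have "finite ?F" using fin by simp
  ultimately show ?thesis unfolding convex_hull_finite[OF \<open>finite ?F\<close>] by blast
qed

lemma convex_hull_inner_ge:
  fixes S :: "'a::euclidean_space set"
  assumes "z \<in> convex hull S" "\<And>s. s \<in> S \<Longrightarrow> N \<le> w \<bullet> s"
  shows "N \<le> w \<bullet> z"
proof -
  have "convex hull S \<subseteq> {z. w \<bullet> z \<ge> N}"
    by (rule hull_minimal) (use assms(2) convex_halfspace_ge in auto)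
  thus ?thesis using assms(1) by blast
qed

text \<open>Any ball around z contains points with a smaller value of the form, obtained by moving
  against w.\<close>

lemma convex_hull_frontier:
  fixes S :: "'a::euclidean_space set"
  assumes z: "z \<in> convex hull S" and w: "w \<noteq> 0" and le: "\<And>s. s \<in> S \<Longrightarrow> w \<bullet> z \<le> w \<bullet> s"
  shows "z \<in> frontier (convex hull S)"
proof -
  have "z \<notin> interior (convex hull S)"
  proof
    assume "z \<in> interior (convex hull S)"
    then obtain e where e: "e > 0" "ball z e \<subseteq> convex hull S"
      unfolding mem_interior by blast
    let ?y = "z - (e / (2 * norm w)) *\<^sub>R w"
    have "dist z ?y = e / 2" using w e(1) by (simp add: dist_norm)
    hence "?y \<in> convex hull S" using subsetD[OF e(2), of ?y] e(1) by simp
    hence "w \<bullet> z \<le> w \<bullet> ?y" by (rule convex_hull_inner_ge) (rule le)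
    moreover have "w \<bullet> w > 0" using w by simp
    ultimately show False using e(1) w
      by (simp add: inner_diff_right mult_le_0_iff divide_le_0_iff)
  qed
  thus ?thesis using z closure_subset[of "convex hull S"] unfolding frontier_def by blast
qed

section \<open>Primitive lattice segments\<close>

definition rpt :: "int \<times> int \<Rightarrow> real \<times> real" where
  "rpt a = (of_int (fst a), of_int (snd a))"

lemma rpt_in_Ints: "rpt a \<in> \<int> \<times> \<int>"
  by (simp add: rpt_def)

lemma Ints_rpt:
  assumes "z \<in> \<int> \<times> \<int>"
  obtains a where "z = rpt a"
proof -
  obtain i j where "fst z = of_int i" "snd z = of_int j"
    using assms by (metis Ints_cases mem_Times_iff)
  thus ?thesis using that[of "(i, j)"] by (simp add: rpt_def prod_eq_iff)
qed

lemma rpt_inject: "rpt a = rpt b \<longleftrightarrow> a = b"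
  by (auto simp: rpt_def prod_eq_iff)

lemma mem_closed_segment_pair:
  "z \<in> closed_segment a (b :: real \<times> real) \<longleftrightarrow>
    (\<exists>u. 0 \<le> u \<and> u \<le> 1 \<and> z = (fst a + u * (fst b - fst a), snd a + u * (snd b - snd a)))"
proof -
  have "(1 - u) *\<^sub>R a + u *\<^sub>R b = (fst a + u * (fst b - fst a), snd a + u * (snd b - snd a))" for u
    by (simp add: prod_eq_iff algebra_simps)
  thus ?thesis unfolding closed_segment_def by auto
qed

text \<open>Bezout coefficients for d express the parameter of a lattice point on the segment as an
  integer, so it is 0 or 1.\<close>

lemma primitive_segment_Ints:
  assumes "coprime (fst d) (snd d)"
  shows "closed_segment (rpt a) (rpt (a + d)) \<inter> \<int> \<times> \<int> = {rpt a, rpt (a + d)}"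
proof (intro equalityI subsetI)
  fix z assume "z \<in> closed_segment (rpt a) (rpt (a + d)) \<inter> \<int> \<times> \<int>"
  hence zs: "z \<in> closed_segment (rpt a) (rpt (a + d))" and zi: "z \<in> \<int> \<times> \<int>" by blast+
  obtain b where b: "z = rpt b" using Ints_rpt[OF zi] .
  obtain u where u: "0 \<le> u" "u \<le> 1" and
    z: "z = (of_int (fst a) + u * of_int (fst d), of_int (snd a) + u * of_int (snd d))"
    using zs unfolding mem_closed_segment_pair by (auto simp: rpt_def)
  have ud: "u * of_int (fst d) = of_int (fst b - fst a)" "u * of_int (snd d) = of_int (snd b - snd a)"
    using z b by (simp_all add: rpt_def)
  obtain x y where xy: "fst d * x + snd d * y = 1"
    using assms bezout_int[of "fst d" "snd d"] by (auto simp: coprime_iff_gcd_eq_1 mult.commute)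
  have "u = u * of_int (fst d * x + snd d * y)" unfolding xy by simp
  also have "\<dots> = (u * of_int (fst d)) * of_int x + (u * of_int (snd d)) * of_int y"
    by (simp add: algebra_simps)
  also have "\<dots> = of_int ((fst b - fst a) * x + (snd b - snd a) * y)" unfolding ud by simp
  finally obtain n where n: "u = of_int n" by blast
  hence "n = 0 \<or> n = 1" using u by auto
  thus "z \<in> {rpt a, rpt (a + d)}" using z n by (auto simp: rpt_def)
next
  fix z assume "z \<in> {rpt a, rpt (a + d)}"
  thus "z \<in> closed_segment (rpt a) (rpt (a + d)) \<inter> \<int> \<times> \<int>"
    using rpt_in_Ints[of a] rpt_in_Ints[of "a + d"] by (elim insertE) simp_all
qed

text \<open>Dividing d by a gcd above 1 would give a lattice point strictly inside the
  segment.\<close>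

lemma coprime_if_primitive_segment:
  assumes ne: "d \<noteq> 0" and prim: "closed_segment (rpt a) (rpt (a + d)) \<inter> \<int> \<times> \<int> = {rpt a, rpt (a + d)}"
  shows "coprime (fst d) (snd d)"
proof (rule ccontr)
  assume nc: "\<not> coprime (fst d) (snd d)"
  define g where "g = gcd (fst d) (snd d)"
  have "g \<noteq> 1" using nc unfolding g_def coprime_iff_gcd_eq_1 .
  moreover have "g \<noteq> 0" using ne unfolding g_def by (auto simp: prod_eq_iff)
  moreover have "g \<ge> 0" unfolding g_def by simp
  ultimately have g: "g > 1" by linarith
  obtain d1 where d1: "fst d = g * d1" unfolding g_def by (metis dvdE gcd_dvd1)
  obtain d2 where d2: "snd d = g * d2" unfolding g_def by (metis dvdE gcd_dvd2)
  let ?z = "rpt (a + (d1, d2))"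
  have "?z \<in> closed_segment (rpt a) (rpt (a + d))"
    unfolding mem_closed_segment_pair using g
    by (intro exI[of _ "1 / of_int g"]) (auto simp: rpt_def d1 d2)
  hence "?z \<in> {rpt a, rpt (a + d)}" using prim rpt_in_Ints by blast
  hence "(d1, d2) = 0 \<or> (d1, d2) = d" unfolding insert_iff rpt_inject by auto
  thus False using ne g d1 d2 by (auto simp: prod_eq_iff)
qed

lemma closed_segment_subdivide:
  fixes A D :: "real \<times> real"
  assumes n: "n > 0"
  shows "closed_segment A (A + real n *\<^sub>R D) =
     (\<Union>k<n. closed_segment (A + real k *\<^sub>R D) (A + real (Suc k) *\<^sub>R D))"
proof (intro equalityI subsetI)
  fix z assume "z \<in> closed_segment A (A + real n *\<^sub>R D)"
  then obtain u where u: "0 \<le> u" "u \<le> 1" "z = (fst A + u * (real n * fst D), snd A + u * (real n * snd D))"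
    unfolding mem_closed_segment_pair by auto
  \<comment> \<open>Clipping at n - 1 matters only at the right end u = 1, where the floor is
    n.\<close>
  define k where "k = min (n - 1) (nat \<lfloor>u * real n\<rfloor>)"
  have un: "0 \<le> u * real n" "u * real n \<le> real n" using u by (simp_all add: mult_left_le_one_le)
  have k: "k < n" using n by (simp add: k_def)
  have "real k \<le> u * real n"
  proof -
    have "real k \<le> real (nat \<lfloor>u * real n\<rfloor>)" by (simp add: k_def)
    also have "\<dots> \<le> u * real n" using un(1) by simp
    finally show ?thesis .
  qed
  moreover have "u * real n \<le> real k + 1"
  proof (cases "nat \<lfloor>u * real n\<rfloor> \<le> n - 1")
    case True
    hence "k = nat \<lfloor>u * real n\<rfloor>" by (simp add: k_def)
    moreover have "u * real n < of_int \<lfloor>u * real n\<rfloor> + 1" by linarith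
    ultimately show ?thesis using un(1) by simp
  next
    case False
    hence "real k + 1 = real n" using n by (simp add: k_def of_nat_diff)
    thus ?thesis using un by simp
  qed
  ultimately have "z \<in> closed_segment (A + real k *\<^sub>R D) (A + real (Suc k) *\<^sub>R D)"
    unfolding mem_closed_segment_pair u(3)
    by (intro exI[of _ "u * real n - real k"]) (auto simp: algebra_simps)
  thus "z \<in> (\<Union>k<n. closed_segment (A + real k *\<^sub>R D) (A + real (Suc k) *\<^sub>R D))" using k by blast
next
  fix z assume "z \<in> (\<Union>k<n. closed_segment (A + real k *\<^sub>R D) (A + real (Suc k) *\<^sub>R D))"
  then obtain k u where k: "k < n" and u: "0 \<le> u" "u \<le> 1"
    "z = (fst A + real k * fst D + u * fst D, snd A + real k * snd D + u * snd D)"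
    unfolding UN_iff mem_closed_segment_pair by (auto simp: algebra_simps)
  have "real k + u \<le> real n" using k u by linarith
  thus "z \<in> closed_segment A (A + real n *\<^sub>R D)"
    unfolding mem_closed_segment_pair u(3) using n u
    by (intro exI[of _ "(real k + u) / real n"]) (auto simp: field_simps)
qed

section \<open>Newton diagrams of finite supports\<close>

definition pt :: "nat \<times> nat \<Rightarrow> real \<times> real" where
  "pt p = (real (fst p), real (snd p))"

lemma supp_eq: "supp P = pt ` msupp (cf P)"
  by (auto simp: supp_def msupp_def pt_def image_def)

lemma newton_polygon_eq: "newton_polygon P = convex hull (pt ` msupp (cf P))"
  by (simp add: newton_polygon_def supp_eq)

text \<open>\<open>Gamma\<close> as a function of the support alone, applicable to the support of
  \<open>lcoef\<close> at every corner.\<close>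

definition Gamma_of :: "(nat \<times> nat) set \<Rightarrow> (real \<times> real) set" where
  "Gamma_of S = closure ({0..} \<times> {0..} - convex hull (\<Union>p\<in>S. {real (fst p)..} \<times> {real (snd p)..}))"

lemma Gamma_eq: "Gamma P = Gamma_of (msupp (cf P))"
  unfolding Gamma_def Gamma_plus_def Gamma_of_def supp_eq by (simp add: pt_def case_prod_beta)

abbreviation Gplus :: "(nat \<times> nat) set \<Rightarrow> (real \<times> real) set" where
  "Gplus S \<equiv> convex hull (\<Union>p\<in>S. {real (fst p)..} \<times> {real (snd p)..})"

lemma Gplus_inner_ge:
  assumes w: "w1 \<ge> 0" "w2 \<ge> 0" and z: "z \<in> Gplus S" and le: "\<And>p. p \<in> S \<Longrightarrow> N \<le> (w1, w2) \<bullet> pt p"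
  shows "N \<le> (w1, w2) \<bullet> z"
proof (rule convex_hull_inner_ge[OF z])
  fix s assume "s \<in> (\<Union>p\<in>S. {real (fst p)..} \<times> {real (snd p)..})"
  then obtain p where p: "p \<in> S" "real (fst p) \<le> fst s" "real (snd p) \<le> snd s" by auto
  have "w1 * real (fst p) + w2 * real (snd p) \<le> w1 * fst s + w2 * snd s"
    using p w by (intro add_mono mult_left_mono) auto
  thus "N \<le> (w1, w2) \<bullet> s" using le[OF p(1)] by (simp add: pt_def inner_prod_def)
qed

lemma hull_subset_Gplus: "convex hull (pt ` S) \<subseteq> Gplus S"
  by (rule hull_mono) (auto simp: pt_def)

lemma Gplus_add:
  assumes "z \<in> Gplus S" "fst v \<ge> 0" "snd v \<ge> 0"
  shows "z + v \<in> Gplus S"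
proof -
  let ?U = "\<Union>p\<in>S. {real (fst p)..} \<times> {real (snd p)..}"
  have "v + z \<in> (\<lambda>x. v + x) ` (convex hull ?U)" using assms(1) by blast
  also have "\<dots> = convex hull ((\<lambda>x. v + x) ` ?U)" by (rule convex_hull_translation[symmetric])
  also have "\<dots> \<subseteq> Gplus S"
  proof (intro hull_mono subsetI)
    fix y assume "y \<in> (\<lambda>x. v + x) ` ?U"
    then obtain x p where "p \<in> S" "y = v + x" "real (fst p) \<le> fst x" "real (snd p) \<le> snd x" by auto
    thus "y \<in> ?U" using assms(2,3) by (intro UN_I[of p]) (auto simp: mem_Times_iff)
  qed
  finally show ?thesis by (simp add: add.commute)
qed

text \<open>Shrinking z towards the origin takes the positive value of the form below its minimum on
  \<open>Gplus S\<close>, so points of the complement accumulate at z.\<close>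

lemma mem_Gamma_of_face:
  assumes w: "w1 > 0" "w2 > 0" and z: "z \<in> convex hull (pt ` S)" and N: "(w1, w2) \<bullet> z > 0"
    and le: "\<And>p. p \<in> S \<Longrightarrow> (w1, w2) \<bullet> z \<le> (w1, w2) \<bullet> pt p"
  shows "z \<in> Gamma_of S"
  unfolding Gamma_of_def closure_approachable
proof (intro allI impI)
  fix e :: real assume e: "e > 0"
  have "0 \<le> (1, 0) \<bullet> z" "0 \<le> (0, 1) \<bullet> z"
    by (rule convex_hull_inner_ge[OF z]; auto simp: pt_def)+
  hence z0: "0 \<le> fst z" "0 \<le> snd z" by (simp_all add: inner_prod_def)
  define t where "t = min (1 / 2) (e / (2 * (norm z + 1)))"
  have t: "0 < t" "t < 1" "t * norm z < e"
  proof -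
    have n: "norm z + 1 > 0" using norm_ge_zero[of z] by linarith
    show "0 < t" "t < 1" using e n by (auto simp: t_def)
    have "t * norm z \<le> e / (2 * (norm z + 1)) * norm z" by (intro mult_right_mono) (auto simp: t_def)
    also have "\<dots> < e" using e n by (simp add: divide_simps)
    finally show "t * norm z < e" .
  qed
  let ?y = "(1 - t) *\<^sub>R z"
  have "?y \<notin> Gplus S"
  proof
    assume "?y \<in> Gplus S"
    hence "(w1, w2) \<bullet> z \<le> (w1, w2) \<bullet> ?y" by (rule Gplus_inner_ge[rotated 2]) (use w le in auto)
    hence "t * ((w1, w2) \<bullet> z) \<le> 0" by (simp only: inner_scaleR_right) (simp add: algebra_simps)
    thus False using t(1) N by (simp add: mult_le_0_iff)
  qed
  moreover have "?y \<in> {0..} \<times> {0..}" using z0 t by (simp add: mem_Times_iff)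
  ultimately have y: "?y \<in> {0..} \<times> {0..} - Gplus S" by (intro DiffI)
  have "dist ?y z < e"
  proof -
    have "?y - z = - (t *\<^sub>R z)" by (simp add: algebra_simps)
    thus ?thesis using t by (simp add: dist_norm)
  qed
  thus "\<exists>y\<in>{0..} \<times> {0..} - Gplus S. dist y z < e" using y by (rule bexI)
qed

text \<open>A supporting line of \<open>Gplus S\<close> at the midpoint z supplies the weight. Its
  entries are nonnegative because \<open>Gplus S\<close> absorbs the quadrant, and positive because
  the support meets both axes while z lies off them. The form attains its minimum at the midpoint,
  hence at both ends.\<close>

lemma Gamma_of_segment:
  assumes S: "(a0, 0) \<in> S" "(0, b0) \<in> S" and ab: "a \<noteq> b" "a \<in> convex hull (pt ` S)" "b \<in> convex hull (pt ` S)"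
    and sub: "closed_segment a b \<subseteq> Gamma_of S"
  obtains w1 w2 where "w1 > 0" "w2 > 0" "(w1, w2) \<bullet> a = (w1, w2) \<bullet> b"
    "\<And>p. p \<in> S \<Longrightarrow> (w1, w2) \<bullet> a \<le> (w1, w2) \<bullet> pt p"
proof -
  define z where "z = midpoint a b"
  have zseg: "z \<in> closed_segment a b" unfolding z_def by simp
  have zG: "z \<in> Gplus S"
    using zseg closed_segment_subset[OF ab(2,3) convex_convex_hull] hull_subset_Gplus by blast
  have nonneg: "0 \<le> fst y" "0 \<le> snd y" if "y \<in> convex hull (pt ` S)" for y
  proof -
    have "0 \<le> (1, 0) \<bullet> y" "0 \<le> (0, 1) \<bullet> y"
      by (rule convex_hull_inner_ge[OF that]; auto simp: pt_def)+
    thus "0 \<le> fst y" "0 \<le> snd y" by (simp_all add: inner_prod_def)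
  qed
  have zcl: "z \<in> closure ({0..} \<times> {0..} - Gplus S)" using zseg sub unfolding Gamma_of_def by blast
  \<comment> \<open>If a point of \<open>Gplus S\<close> were below z in each coordinate, strictly
    or by being 0, all quadrant points near z would dominate it and lie in \<open>Gplus S\<close>,
    although z is a limit of the complement.\<close>
  have meet: False if y0: "y0 \<in> Gplus S" and below: "fst y0 < fst z \<or> fst y0 = 0" "snd y0 < snd z \<or> snd y0 = 0" for y0
  proof -
    \<comment> \<open>The set comprehensions contribute a difference only when it is positive, which
      keeps e positive.\<close>
    define e where "e = Min ({1} \<union> {fst z - fst y0 | x::nat. fst y0 < fst z} \<union> {snd z - snd y0 | x::nat. snd y0 < snd z})"
    have fin: "finite ({1} \<union> {fst z - fst y0 | x::nat. fst y0 < fst z} \<union> {snd z - snd y0 | x::nat. snd y0 < snd z})"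
      by (rule finite_subset[of _ "{1, fst z - fst y0, snd z - snd y0}"]) auto
    have e: "e > 0" "fst y0 < fst z \<Longrightarrow> e \<le> fst z - fst y0" "snd y0 < snd z \<Longrightarrow> e \<le> snd z - snd y0"
      unfolding e_def using fin by (auto intro!: Min_le simp: Min_gr_iff)
    obtain y where y: "y \<in> {0..} \<times> {0..} - Gplus S" "dist y z < e"
      using zcl e(1) unfolding closure_approachable by blast
    have d: "\<bar>fst y - fst z\<bar> < e" "\<bar>snd y - snd z\<bar> < e"
      using y(2) dist_fst_le[of y z] dist_snd_le[of y z] by (simp_all add: dist_real_def)
    have "fst y0 \<le> fst y" using below(1) e(2) d(1) y(1) by (auto simp: mem_Times_iff)
    moreover have "snd y0 \<le> snd y" using below(2) e(3) d(2) y(1) by (auto simp: mem_Times_iff)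
    ultimately have "y0 + (y - y0) \<in> Gplus S" by (intro Gplus_add[OF y0]) auto
    thus False using y(1) by simp
  qed
  \<comment> \<open>If z were on an axis, the whole segment would be, and the end nearer to the
    origin would lie below z.\<close>
  have zpos: "fst z > 0" "snd z > 0"
  proof -
    have hullG: "a \<in> Gplus S" "b \<in> Gplus S" using ab hull_subset_Gplus by blast+
    have mid: "fst z = (fst a + fst b) / 2" "snd z = (snd a + snd b) / 2"
      by (simp_all add: z_def midpoint_def)
    show "fst z > 0"
    proof (rule ccontr)
      assume "\<not> fst z > 0"
      hence f: "fst a = 0" "fst b = 0" using nonneg(1)[OF ab(2)] nonneg(1)[OF ab(3)] unfolding mid by auto
      hence "snd a \<noteq> snd b" using ab(1) by (auto simp: prod_eq_iff)
      hence "snd a < snd z \<or> snd b < snd z" unfolding mid by auto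
      thus False using meet[OF hullG(1)] meet[OF hullG(2)] f by blast
    qed
    show "snd z > 0"
    proof (rule ccontr)
      assume "\<not> snd z > 0"
      hence f: "snd a = 0" "snd b = 0" using nonneg(2)[OF ab(2)] nonneg(2)[OF ab(3)] unfolding mid by auto
      hence "fst a \<noteq> fst b" using ab(1) by (auto simp: prod_eq_iff)
      hence "fst a < fst z \<or> fst b < fst z" unfolding mid by auto
      thus False using meet[OF hullG(1)] meet[OF hullG(2)] f by blast
    qed
  qed
  have GS: "(real a0, 0) \<in> Gplus S" "(0, real b0) \<in> Gplus S"
    using S by (auto intro!: hull_inc bexI[of _ "(a0, 0)"] bexI[of _ "(0, b0)"])
  \<comment> \<open>The open quadrant beyond (a0, 0) makes the interior nonempty, so that it equals
    the relative interior; z is outside it as a limit of the complement.\<close>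
  have notint: "z \<notin> rel_interior (Gplus S)"
  proof -
    let ?B = "{real a0<..} \<times> {0::real<..}"
    have "?B \<subseteq> Gplus S"
    proof
      fix y assume "y \<in> ?B"
      hence "(real a0, 0) + (y - (real a0, 0)) \<in> Gplus S" by (intro Gplus_add[OF GS(1)]) auto
      thus "y \<in> Gplus S" by simp
    qed
    hence "?B \<subseteq> interior (Gplus S)" by (intro interior_maximal open_Times) auto
    moreover have "(real a0 + 1, 1) \<in> ?B" by simp
    ultimately have "interior (Gplus S) \<noteq> {}" by blast
    hence "rel_interior (Gplus S) = interior (Gplus S)" by (rule rel_interior_nonempty_interior)
    moreover have "z \<in> closure (- Gplus S)" by (rule subsetD[OF closure_mono zcl]) blast
    ultimately show ?thesis unfolding closure_complement by blast
  qed
  obtain w where w: "w \<noteq> 0" "\<And>y. y \<in> Gplus S \<Longrightarrow> w \<bullet> z \<le> w \<bullet> y"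
    by (rule supporting_hyperplane_rel_boundary[OF convex_convex_hull zG notint]) (rule that)
  have wge: "fst w \<ge> 0" "snd w \<ge> 0"
    using w(2)[OF Gplus_add[OF zG, of "(1, 0)"]] w(2)[OF Gplus_add[OF zG, of "(0, 1)"]]
    by (simp_all add: inner_prod_def distrib_left)
  have w1: "fst w > 0"
  proof (rule ccontr)
    assume "\<not> fst w > 0"
    hence f: "fst w = 0" using wge by simp
    hence "snd w > 0" using w(1) wge by (auto simp: prod_eq_iff order_less_le)
    moreover have "snd w * snd z \<le> 0" using w(2)[OF GS(1)] f by (simp add: inner_prod_def)
    ultimately show False using zpos by (simp add: mult_le_0_iff)
  qed
  have w2: "snd w > 0"
  proof (rule ccontr)
    assume "\<not> snd w > 0"
    hence f: "snd w = 0" using wge by simp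
    have "fst w * fst z \<le> 0" using w(2)[OF GS(2)] f by (simp add: inner_prod_def)
    thus False using zpos w1 by (simp add: mult_le_0_iff)
  qed
  have wa: "w \<bullet> z \<le> w \<bullet> a" "w \<bullet> z \<le> w \<bullet> b" using ab hull_subset_Gplus w(2) by blast+
  have "w \<bullet> z = (w \<bullet> a + w \<bullet> b) / 2" by (simp add: z_def midpoint_def inner_add_right)
  hence "w \<bullet> a = w \<bullet> b \<and> w \<bullet> a = w \<bullet> z" using wa by auto
  hence eq: "w \<bullet> a = w \<bullet> b" "w \<bullet> a = w \<bullet> z" by blast+
  show ?thesis
  proof (rule that[of "fst w" "snd w"])
    show "fst w > 0" "snd w > 0" by fact+
    show "(fst w, snd w) \<bullet> a = (fst w, snd w) \<bullet> b" using eq by simp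
    show "(fst w, snd w) \<bullet> a \<le> (fst w, snd w) \<bullet> pt p" if "p \<in> S" for p
    proof -
      have "pt p \<in> Gplus S" using that by (intro hull_inc) (auto simp: pt_def)
      from w(2)[OF this] show ?thesis unfolding eq(2)[symmetric] by simp
    qed
  qed
qed

section \<open>Edges at a corner\<close>

definition rflip :: "complex poly poly \<Rightarrow> P1 \<times> P1 \<Rightarrow> real \<times> real \<Rightarrow> real \<times> real" where
  "rflip P p z = (if fst p = Inf_pt then real (deg_x P) - fst z else fst z,
                  if snd p = Inf_pt then real (deg_y P) - snd z else snd z)"

lemma rflip_rflip [simp]: "rflip P p (rflip P p z) = z"
  by (simp add: rflip_def)

lemma rflip_image_iff: "z \<in> rflip P p ` A \<longleftrightarrow> rflip P p z \<in> A"
  by (metis imageE image_eqI rflip_rflip)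

lemma rflip_eq_iff: "rflip P p a = rflip P p b \<longleftrightarrow> a = b"
  by (metis rflip_rflip)

lemma rflip_inner:
  "(w1, w2) \<bullet> rflip P p z = (w1, w2) \<bullet> rflip P p 0 +
     ((if fst p = Inf_pt then - w1 else w1), (if snd p = Inf_pt then - w2 else w2)) \<bullet> z"
  by (simp add: rflip_def inner_prod_def algebra_simps)

lemma rflip_closed_segment: "rflip P p ` closed_segment a b = closed_segment (rflip P p a) (rflip P p b)"
proof -
  have sub: "rflip P p z \<in> closed_segment (rflip P p a) (rflip P p b)" if "z \<in> closed_segment a b" for z a b
  proof -
    obtain u where "0 \<le> u" "u \<le> 1" "z = (fst a + u * (fst b - fst a), snd a + u * (snd b - snd a))"
      using iffD1[OF mem_closed_segment_pair \<open>z \<in> closed_segment a b\<close>] by (elim exE conjE) (rule that)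
    moreover have "rflip P p (fst a + u * (fst b - fst a), snd a + u * (snd b - snd a)) =
        (fst (rflip P p a) + u * (fst (rflip P p b) - fst (rflip P p a)),
         snd (rflip P p a) + u * (snd (rflip P p b) - snd (rflip P p a)))"
      by (simp add: rflip_def right_diff_distrib)
    ultimately show ?thesis unfolding mem_closed_segment_pair by blast
  qed
  show ?thesis
  proof (intro equalityI subsetI)
    fix z assume "z \<in> rflip P p ` closed_segment a b"
    thus "z \<in> closed_segment (rflip P p a) (rflip P p b)" using sub by (elim imageE) simp
  next
    fix z assume "z \<in> closed_segment (rflip P p a) (rflip P p b)"
    from sub[OF this] show "z \<in> rflip P p ` closed_segment a b"
      unfolding rflip_image_iff rflip_rflip .
  qed
qed

lemma rflip_convex_hull:
  assumes "z \<in> convex hull A"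
  shows "rflip P p z \<in> convex hull (rflip P p ` A)"
proof -
  let ?B = "{z. rflip P p z \<in> convex hull (rflip P p ` A)}"
  have "convex ?B"
  proof (rule convexI)
    fix x y :: "real \<times> real" and u v :: real
    assume a: "x \<in> ?B" "y \<in> ?B" "0 \<le> u" "0 \<le> v" "u + v = 1"
    have v: "v = 1 - u" using a by simp
    have "rflip P p (u *\<^sub>R x + v *\<^sub>R y) = u *\<^sub>R rflip P p x + v *\<^sub>R rflip P p y"
      unfolding v by (auto simp: rflip_def prod_eq_iff algebra_simps)
    thus "u *\<^sub>R x + v *\<^sub>R y \<in> ?B"
      using convexD[OF convex_convex_hull, of "rflip P p x" "rflip P p ` A" "rflip P p y" u v] a by simp
  qed
  moreover have "A \<subseteq> ?B" by (auto intro: hull_inc)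
  ultimately have "convex hull A \<subseteq> ?B" by (intro hull_minimal)
  thus ?thesis using assms by blast
qed

lemma rflip_pt: "q \<in> msupp (cf P) \<Longrightarrow> rflip P p (pt q) = pt (flip2 P p q)"
  using cf_nonzero_le[of P "fst q" "snd q"]
  by (auto simp: msupp_def rflip_def pt_def flip2_def flip_def of_nat_diff)

lemma rflip_supp: "rflip P p ` pt ` msupp (cf P) = pt ` msupp (lcoef P p)"
  unfolding msupp_lcoef image_image using rflip_pt by (intro image_cong) auto

lemma mem_newton_polygon_rflip:
  "z \<in> newton_polygon P \<longleftrightarrow> rflip P p z \<in> convex hull (pt ` msupp (lcoef P p))"
proof
  assume "z \<in> newton_polygon P"
  thus "rflip P p z \<in> convex hull (pt ` msupp (lcoef P p))"
    using rflip_convex_hull[of z "pt ` msupp (cf P)" P p] unfolding newton_polygon_eq rflip_supp by simp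
next
  assume "rflip P p z \<in> convex hull (pt ` msupp (lcoef P p))"
  from rflip_convex_hull[OF this, of P p] show "z \<in> newton_polygon P"
    unfolding rflip_supp[symmetric] image_image rflip_rflip newton_polygon_eq by simp
qed

lemma rflip_Ints: "rflip P p z \<in> \<int> \<times> \<int> \<longleftrightarrow> z \<in> \<int> \<times> \<int>"
proof -
  have "rflip P p z \<in> \<int> \<times> \<int>" if "z \<in> \<int> \<times> \<int>" for z
    using that by (auto simp: rflip_def mem_Times_iff)
  from this[of z] this[of "rflip P p z"] show ?thesis by auto
qed

lemma rflip_Int_Ints: "rflip P p ` A \<inter> \<int> \<times> \<int> = rflip P p ` (A \<inter> \<int> \<times> \<int>)"
  by (rule set_eqI) (simp only: Int_iff rflip_image_iff rflip_Ints)

text \<open>One definition for all corners; at the two mixed corners it gives the edges contained in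
  \<open>E_0inf\<close> and in \<open>E_inf0\<close>.\<close>

definition corner_edges :: "complex poly poly \<Rightarrow> P1 \<times> P1 \<Rightarrow> (real \<times> real) set set" where
  "corner_edges P p = {e \<in> edges P. e \<subseteq> rflip P p ` Gamma_of (msupp (lcoef P p)) \<inter> newton_polygon P}"

text \<open>Edges are drawn in corner coordinates, where the diagram descends in direction (m, -r),
  and then reflected back.\<close>

definition prim_edge :: "complex poly poly \<Rightarrow> P1 \<times> P1 \<Rightarrow> int \<times> int \<Rightarrow> nat \<Rightarrow> nat \<Rightarrow> (real \<times> real) set" where
  "prim_edge P p a r m = rflip P p ` closed_segment (rpt a) (rpt (a + (int m, - int r)))"

lemma inner_pt: "(real r, real m) \<bullet> pt q = real (wt r m q)"
  by (simp add: pt_def wt_def inner_prod_def)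

text \<open>The form from \<open>Gamma_of_segment\<close> has positive entries and equal values at
  the ends of the reflected edge, so the edge descends. Its direction is primitive because the edge
  contains no further lattice points, and the form is proportional to (r, m).\<close>

lemma corner_edge_form:
  assumes e: "e \<in> corner_edges P p" and S: "(a0, 0) \<in> msupp (lcoef P p)" "(0, b0) \<in> msupp (lcoef P p)"
  obtains a r m where "r > 0" "m > 0" "coprime r m" "e = prim_edge P p a r m"
    "rpt a \<in> convex hull (pt ` msupp (lcoef P p))"
    "rpt (a + (int m, - int r)) \<in> convex hull (pt ` msupp (lcoef P p))"
    "\<And>q. q \<in> msupp (lcoef P p) \<Longrightarrow> (real r, real m) \<bullet> rpt a \<le> (real r, real m) \<bullet> pt q"
proof -
  note conclude = that
  let ?T = "convex hull (pt ` msupp (lcoef P p))"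
  have e': "e \<in> edges P" and sub: "e \<subseteq> rflip P p ` Gamma_of (msupp (lcoef P p))" "e \<subseteq> newton_polygon P"
    using e unfolding corner_edges_def by simp_all
  obtain A B where AB: "A \<noteq> B" "e = closed_segment A B" "e \<inter> \<int> \<times> \<int> = {A, B}"
    using e' unfolding edges_def mem_Collect_eq by (elim exE conjE) (rule that)
  have AZ: "A \<in> \<int> \<times> \<int>" and BZ: "B \<in> \<int> \<times> \<int>" using AB(3) by blast+
  obtain a' where a': "rflip P p A = rpt a'"
    by (rule Ints_rpt[of "rflip P p A"]) (simp only: rflip_Ints AZ, rule that)
  obtain b' where b': "rflip P p B = rpt b'"
    by (rule Ints_rpt[of "rflip P p B"]) (simp only: rflip_Ints BZ, rule that)
  have seg: "closed_segment (rpt a') (rpt b') = rflip P p ` e"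
    unfolding AB(2) rflip_closed_segment a' b' ..
  have ine: "A \<in> e" "B \<in> e" unfolding AB(2) by auto
  have ne: "a' \<noteq> b'" using AB(1) a' b' rflip_eq_iff by metis
  have hull: "rpt a' \<in> ?T" "rpt b' \<in> ?T"
    unfolding a'[symmetric] b'[symmetric] using ine sub(2) mem_newton_polygon_rflip by blast+
  have gam: "closed_segment (rpt a') (rpt b') \<subseteq> Gamma_of (msupp (lcoef P p))"
    unfolding seg
  proof (rule image_subsetI)
    fix x assume "x \<in> e"
    thus "rflip P p x \<in> Gamma_of (msupp (lcoef P p))"
      using subsetD[OF sub(1)] unfolding rflip_image_iff by blast
  qed
  have prim: "closed_segment (rpt a') (rpt b') \<inter> \<int> \<times> \<int> = {rpt a', rpt b'}"
  proof -
    have "closed_segment (rpt a') (rpt b') \<inter> \<int> \<times> \<int> = rflip P p ` (e \<inter> \<int> \<times> \<int>)"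
      unfolding seg by (rule rflip_Int_Ints)
    thus ?thesis unfolding AB(3) using a' b' by simp
  qed
  obtain w1 w2 where w: "w1 > 0" "w2 > 0" "(w1, w2) \<bullet> rpt a' = (w1, w2) \<bullet> rpt b'"
    "\<And>q. q \<in> msupp (lcoef P p) \<Longrightarrow> (w1, w2) \<bullet> rpt a' \<le> (w1, w2) \<bullet> pt q"
    by (rule Gamma_of_segment[OF S _ hull gam]) (use ne rpt_inject in blast, rule that)
  \<comment> \<open>The ends may come in either order; the argument is given for the order with
    increasing first coordinate.\<close>
  have main: thesis if ord: "fst a < fst b" and ab: "{a, b} = {a', b'}" for a b
  proof -
    have sw: "(w1, w2) \<bullet> rpt a = (w1, w2) \<bullet> rpt b"
      "\<And>q. q \<in> msupp (lcoef P p) \<Longrightarrow> (w1, w2) \<bullet> rpt a \<le> (w1, w2) \<bullet> pt q"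
      "rpt a \<in> ?T" "rpt b \<in> ?T" "closed_segment (rpt a) (rpt b) = closed_segment (rpt a') (rpt b')"
      using ab w(3,4) hull by (auto simp: doubleton_eq_iff closed_segment_commute)
    define d where "d = b - a"
    have b: "b = a + d" by (simp add: d_def)
    have dpos: "fst d > 0" using ord by (simp add: d_def)
    have wd: "w1 * of_int (fst d) + w2 * of_int (snd d) = 0"
      using sw(1) unfolding b by (simp add: rpt_def inner_prod_def algebra_simps)
    have "w1 * of_int (fst d) > 0" using w(1) dpos by simp
    hence "w2 * of_int (snd d) < 0" using wd by linarith
    hence dneg: "snd d < 0" using w(2) by (simp add: mult_less_0_iff)
    have "closed_segment (rpt a) (rpt (a + d)) \<inter> \<int> \<times> \<int> = {rpt a, rpt (a + d)}"
      unfolding b[symmetric] sw(5) prim using ab by (auto simp: doubleton_eq_iff)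
    hence cop: "coprime (fst d) (snd d)"
      by (rule coprime_if_primitive_segment[rotated]) (use dpos in auto)
    define m where "m = nat (fst d)"
    define r where "r = nat (- snd d)"
    have mr: "m > 0" "r > 0" "fst d = int m" "snd d = - int r"
      using dpos dneg by (simp_all add: m_def r_def)
    have cop': "coprime m r" using cop unfolding mr(3,4) by simp
    have d: "d = (int m, - int r)" using mr by (simp add: prod_eq_iff)
    have "w1 * real m = w2 * real r" using wd mr by simp
    hence wrm: "(real r, real m) = (real r / w1) *\<^sub>R (w1, w2)"
      using w(1) by (simp add: field_simps)
    show thesis
    proof (rule conclude[of r m a])
      show "e = prim_edge P p a r m"
      proof -
        have "prim_edge P p a r m = rflip P p ` rflip P p ` e"
          unfolding prim_edge_def seg[symmetric] sw(5)[symmetric] b d ..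
        thus ?thesis by (simp add: image_image)
      qed
      show "(real r, real m) \<bullet> rpt a \<le> (real r, real m) \<bullet> pt q" if "q \<in> msupp (lcoef P p)" for q
        unfolding wrm inner_scaleR_left using sw(2)[OF that] w(1) by (intro mult_left_mono) auto
    qed (use mr cop' sw d b in \<open>auto simp: coprime_commute\<close>)
  qed
  have "fst a' \<noteq> fst b'"
  proof
    assume f: "fst a' = fst b'"
    hence "w2 * of_int (snd a') = w2 * of_int (snd b')" using w(3) by (simp add: rpt_def inner_prod_def)
    hence "snd a' = snd b'" using w(2) by simp
    thus False using ne f by (simp add: prod_eq_iff)
  qed
  thus ?thesis using main[of a' b'] main[of b' a'] by (cases "fst a' < fst b'") auto
qed

lemma slope_closed_segment:
  assumes "fst A \<noteq> fst B" "of_rat \<mu> = (snd B - snd A) / (fst B - fst A)"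
  shows "slope (closed_segment A B) = \<mu>"
  unfolding slope_def
proof (rule the_equality)
  show "\<exists>a b. closed_segment A B = closed_segment a b \<and> fst a \<noteq> fst b \<and>
      real_of_rat \<mu> = (snd b - snd a) / (fst b - fst a)" using assms by blast
  fix \<mu>' assume "\<exists>a b. closed_segment A B = closed_segment a b \<and> fst a \<noteq> fst b \<and>
      real_of_rat \<mu>' = (snd b - snd a) / (fst b - fst a)"
  then obtain a b where ab: "closed_segment A B = closed_segment a b" "fst a \<noteq> fst b"
    "real_of_rat \<mu>' = (snd b - snd a) / (fst b - fst a)" by blast
  have "(A = a \<and> B = b) \<or> (A = b \<and> B = a)"
    using ab(1) unfolding closed_segment_eq doubleton_eq_iff .
  hence "(snd b - snd a) / (fst b - fst a) = (snd B - snd A) / (fst B - fst A)"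
    using assms(1) by (auto simp: field_simps)
  thus "\<mu>' = \<mu>" using assms(2) ab(3) by (metis of_rat_eq_iff)
qed

text \<open>Reflecting exactly one coordinate turns the slope -r/m into r/m, and coprimality makes
  (r, m) the normalised fraction.\<close>

lemma slope_prim_edge:
  assumes rm: "r > 0" "m > 0" "coprime r m" and p: "(fst p = Inf_pt) \<noteq> (snd p = Inf_pt)"
  shows "slope (prim_edge P p a r m) = of_nat r / of_nat m"
    "edge_r (prim_edge P p a r m) = int r" "edge_k (prim_edge P p a r m) = int m"
proof -
  let ?A = "rflip P p (rpt a)" and ?B = "rflip P p (rpt (a + (int m, - int r)))"
  show s: "slope (prim_edge P p a r m) = of_nat r / of_nat m"
    unfolding prim_edge_def rflip_closed_segment
  proof (rule slope_closed_segment)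
    show "fst ?A \<noteq> fst ?B" using rm by (simp add: rflip_def rpt_def)
    show "real_of_rat (of_nat r / of_nat m) = (snd ?B - snd ?A) / (fst ?B - fst ?A)"
      using p by (auto simp: rflip_def rpt_def of_rat_divide)
  qed
  have "of_nat r / of_nat m = Rat.Fract (int r) (int m)"
    by (simp add: Fract_of_int_quotient)
  hence "quotient_of (of_nat r / of_nat m) = (int r, int m)"
    using rm by (simp add: quotient_of_Fract normalize_stable)
  thus "edge_r (prim_edge P p a r m) = int r" "edge_k (prim_edge P p a r m) = int m"
    unfolding edge_r_def edge_k_def s by simp_all
qed

text \<open>Every such edge lies on the face of weight (r, m), which has lattice length g, and is
  one of its g unit pieces. Conversely each piece is an edge in the Newton diagram, because the form
  takes its minimum there and this minimum is positive.\<close>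

lemma corner_edges_direction:
  assumes S: "(a0, 0) \<in> msupp (lcoef P p)" "(0, b0) \<in> msupp (lcoef P p)"
    and rm: "r > 0" "m > 0" "coprime r m" and p: "(fst p = Inf_pt) \<noteq> (snd p = Inf_pt)"
    and s: "(i0, j0 + g * r) \<in> msupp (lcoef P p)" and t: "(i0 + g * m, j0) \<in> msupp (lcoef P p)"
    and F: "\<And>q. q \<in> face (int r) (int m) (msupp (lcoef P p)) \<longleftrightarrow>
              q \<in> msupp (lcoef P p) \<and> (\<exists>k\<le>g. q = (i0 + (g - k) * m, j0 + k * r))"
  defines "E \<equiv> {e \<in> corner_edges P p. edge_r e = int r \<and> edge_k e = int m}"
  shows "finite E" "card E = g"
proof -
  let ?S = "msupp (lcoef P p)"
  let ?T = "convex hull (pt ` ?S)"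
  let ?w = "(real r, real m)"
  \<comment> \<open>Lattice points of the face from its upper left end downwards, computed in the
    integers so that the successor rule holds for every k.\<close>
  define A where "A k = (int i0 + int k * int m, int j0 + (int g - int k) * int r)" for k :: nat
  have fin: "finite ?S" by (rule finite_msupp_lcoef)
  have sF: "(i0, j0 + g * r) \<in> face (int r) (int m) ?S"
    unfolding F using s by (intro conjI exI[of _ g]) auto
  define N where "N = wt_ord r m ?S"
  have Nle: "real N \<le> ?w \<bullet> z" if "z \<in> pt ` ?S" for z
    using that wt_ord_le[OF fin] by (auto simp: inner_pt N_def)
  have NF: "q \<in> face (int r) (int m) ?S \<longleftrightarrow> q \<in> ?S \<and> ?w \<bullet> pt q = real N" for q
    unfolding face_eq_wt[OF fin] inner_pt N_def by auto
  have wA: "?w \<bullet> rpt (A k) = real N" for k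
  proof -
    have "?w \<bullet> rpt (A k) = ?w \<bullet> pt (i0, j0 + g * r)"
      by (simp add: A_def rpt_def pt_def inner_prod_def algebra_simps)
    thus ?thesis using sF NF by simp
  qed
  have AT: "rpt (A k) \<in> ?T" if "k \<le> g" for k
  proof -
    have "rpt (A k) \<in> closed_segment (pt (i0, j0 + g * r)) (pt (i0 + g * m, j0))"
    proof (cases "g = 0")
      case True
      thus ?thesis using that by (simp add: A_def rpt_def pt_def)
    next
      case False
      thus ?thesis unfolding mem_closed_segment_pair using that
        by (intro exI[of _ "real k / real g"]) (auto simp: A_def rpt_def pt_def field_simps)
    qed
    moreover have "pt (i0, j0 + g * r) \<in> ?T" "pt (i0 + g * m, j0) \<in> ?T"
      using s t by (auto intro: hull_inc)
    ultimately show ?thesis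
      using closed_segment_subset[OF _ _ convex_convex_hull] by blast
  qed
  have step: "A k + (int m, - int r) = A (Suc k)" for k
    by (simp add: A_def algebra_simps)
  let ?e = "\<lambda>k. prim_edge P p (A k) r m"
  have E: "E = ?e ` {..<g}"
  proof (intro equalityI subsetI)
    fix e assume e: "e \<in> E"
    have ec: "e \<in> corner_edges P p" using e by (simp add: E_def)
    obtain a r' m' where f: "r' > 0" "m' > 0" "coprime r' m'" "e = prim_edge P p a r' m'"
      "rpt a \<in> ?T" "rpt (a + (int m', - int r')) \<in> ?T"
      "\<And>q. q \<in> ?S \<Longrightarrow> (real r', real m') \<bullet> rpt a \<le> (real r', real m') \<bullet> pt q"
      by (rule corner_edge_form[OF ec S]) (rule that)
    have rm': "r' = r" "m' = m"
      using e slope_prim_edge(2,3)[OF f(1-3) p] unfolding E_def f(4) by simp_all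
    note f = f[unfolded rm']
    let ?b = "a + (int m, - int r)"
    \<comment> \<open>The edge minimises the form over the support, and the minimum N is attained on
      the face.\<close>
    have Na: "?w \<bullet> rpt a = real N"
    proof (rule antisym)
      show "?w \<bullet> rpt a \<le> real N" using f(7)[OF s] NF sF by simp
      show "real N \<le> ?w \<bullet> rpt a" by (rule convex_hull_inner_ge[OF f(5) Nle])
    qed
    have Nb: "?w \<bullet> rpt ?b = real N"
      unfolding Na[symmetric] by (simp add: rpt_def inner_prod_def algebra_simps)
    \<comment> \<open>Minimal points of the hull are convex combinations of face points, which
      bounds their first coordinate by those of the two ends.\<close>
    have range: "real i0 \<le> fst z \<and> fst z \<le> real (i0 + g * m)" if z: "z \<in> ?T" "?w \<bullet> z = real N" for z
    proof -
      have zF: "z \<in> convex hull {x \<in> pt ` ?S. ?w \<bullet> x = real N}"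
        by (rule mem_convex_hull_face[OF _ z(1) Nle z(2)]) (use fin in simp)
      have pts: "real i0 \<le> fst x \<and> fst x \<le> real (i0 + g * m)" if x: "x \<in> {x \<in> pt ` ?S. ?w \<bullet> x = real N}" for x
      proof -
        obtain q where q: "q \<in> ?S" "x = pt q" "?w \<bullet> pt q = real N" using x by auto
        hence "q \<in> face (int r) (int m) ?S" using NF by blast
        then obtain k where k: "q = (i0 + (g - k) * m, j0 + k * r)" unfolding F by blast
        have "(g - k) * m \<le> g * m" by (intro mult_right_mono) auto
        hence "i0 \<le> fst q" "fst q \<le> i0 + g * m" unfolding k by simp_all
        thus ?thesis unfolding q(2) pt_def fst_conv of_nat_le_iff by blast
      qed
      have "real i0 \<le> (1, 0) \<bullet> z"
        by (rule convex_hull_inner_ge[OF zF], drule pts) (simp add: inner_prod_def)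
      moreover have "- real (i0 + g * m) \<le> (- 1, 0) \<bullet> z"
        by (rule convex_hull_inner_ge[OF zF], drule pts) (simp add: inner_prod_def)
      ultimately show ?thesis by (simp add: inner_prod_def)
    qed
    have "real i0 \<le> of_int (fst a)" "of_int (fst a + int m) \<le> real (i0 + g * m)"
      using range[OF f(5) Na] range[OF f(6) Nb] by (simp_all add: rpt_def)
    hence "real_of_int (int i0) \<le> real_of_int (fst a)"
      "real_of_int (fst a + int m) \<le> real_of_int (int i0 + int g * int m)" by simp_all
    hence ia: "int i0 \<le> fst a" "fst a + int m \<le> int i0 + int g * int m"
      unfolding of_int_le_iff by blast+
    have "real_of_int (int r * fst a + int m * snd a) = real_of_int (int r * int i0 + int m * (int j0 + int g * int r))"
      using Na NF[of "(i0, j0 + g * r)"] sF by (simp add: rpt_def pt_def inner_prod_def)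
    hence "int r * fst a + int m * snd a = int r * int i0 + int m * (int j0 + int g * int r)"
      by (simp only: of_int_eq_iff)
    hence lin: "int r * (fst a - int i0) = int m * (int j0 + int g * int r - snd a)"
      by (simp add: algebra_simps)
    hence "int m dvd int r * (fst a - int i0)" by simp
    moreover have "coprime (int m) (int r)" using rm(3) by (simp add: coprime_commute)
    ultimately have "int m dvd fst a - int i0" by (simp add: coprime_dvd_mult_right_iff)
    then obtain k where k: "fst a - int i0 = int m * k" by (elim dvdE)
    have k0: "k \<ge> 0"
    proof (rule ccontr)
      assume "\<not> k \<ge> 0"
      hence "int m * k < 0" using rm(2) by (simp add: mult_less_0_iff)
      thus False using k ia by linarith
    qed
    have kg: "k < int g"
    proof (rule ccontr)
      assume "\<not> k < int g"
      hence "int m * int g \<le> int m * k" by (intro mult_left_mono) auto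
      moreover have "int m * k + int m \<le> int m * int g" using k ia(2) by (simp add: mult.commute)
      moreover have "int m > 0" using rm(2) by simp
      ultimately show False by linarith
    qed
    have "int m * (int r * k) = int m * (int j0 + int g * int r - snd a)"
      unfolding lin[symmetric] k by (simp only: ac_simps)
    hence "int r * k = int j0 + int g * int r - snd a" using rm(2) by simp
    hence "a = A (nat k)" using k k0 by (simp add: A_def prod_eq_iff algebra_simps)
    moreover have "nat k < g" using k0 kg by simp
    ultimately show "e \<in> ?e ` {..<g}" using f(4) by blast
  next
    fix e assume "e \<in> ?e ` {..<g}"
    then obtain k where k: "k < g" "e = prim_edge P p (A k) r m" by blast
    let ?a = "rpt (A k)" and ?b = "rpt (A (Suc k))"
    have e: "e = rflip P p ` closed_segment ?a ?b" unfolding k(2) prim_edge_def step ..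
    have segT: "closed_segment ?a ?b \<subseteq> ?T"
      using AT[of k] AT[of "Suc k"] k by (intro closed_segment_subset convex_convex_hull) auto
    have segN: "?w \<bullet> z = real N" if z: "z \<in> closed_segment ?a ?b" for z
    proof -
      obtain u where "z = (1 - u) *\<^sub>R ?a + u *\<^sub>R ?b" using z unfolding closed_segment_def by auto
      thus ?thesis by (simp only: inner_add_right inner_scaleR_right wA) (simp add: algebra_simps)
    qed
    \<comment> \<open>An index k < g exists only for g > 0, and then the upper end (i0, j0 + g r) is
      not the origin.\<close>
    have Npos: "real N > 0"
    proof -
      have "real N = ?w \<bullet> pt (i0, j0 + g * r)" using sF NF by simp
      also have "\<dots> > 0" using rm k by (simp add: pt_def inner_prod_def add_nonneg_pos)
      finally show ?thesis .
    qed
    have "e \<in> edges P"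
      unfolding edges_def
    proof (intro CollectI exI conjI)
      show "rflip P p ?a \<noteq> rflip P p ?b" unfolding rflip_eq_iff rpt_inject using rm by (simp add: A_def)
      show "e = closed_segment (rflip P p ?a) (rflip P p ?b)" unfolding e rflip_closed_segment ..
      show "e \<subseteq> frontier (newton_polygon P)"
      proof
        fix z assume "z \<in> e"
        then obtain y where y: "y \<in> closed_segment ?a ?b" "z = rflip P p y" unfolding e by blast
        let ?v = "((if fst p = Inf_pt then - real r else real r), (if snd p = Inf_pt then - real m else real m))"
        have vz: "?v \<bullet> x = ?w \<bullet> rflip P p x - ?w \<bullet> rflip P p 0" for x
          using rflip_inner[of "real r" "real m" P p x] by simp
        show "z \<in> frontier (newton_polygon P)"
          unfolding newton_polygon_eq
        proof (rule convex_hull_frontier)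
          show "z \<in> convex hull (pt ` msupp (cf P))"
            unfolding newton_polygon_eq[symmetric] mem_newton_polygon_rflip[of _ _ p] y(2) rflip_rflip
            using y(1) segT by blast
          show "?v \<noteq> 0" using rm by (simp add: prod_eq_iff)
          fix x assume "x \<in> pt ` msupp (cf P)"
          hence "rflip P p x \<in> pt ` ?S" unfolding rflip_supp[symmetric] by blast
          thus "?v \<bullet> z \<le> ?v \<bullet> x" unfolding vz y(2) rflip_rflip segN[OF y(1)] using Nle by fastforce
        qed
      qed
      show "e \<inter> \<int> \<times> \<int> = {rflip P p ?a, rflip P p ?b}"
      proof -
        have "e \<inter> \<int> \<times> \<int> = rflip P p ` (closed_segment ?a ?b \<inter> \<int> \<times> \<int>)"
          unfolding e by (rule rflip_Int_Ints)
        also have "closed_segment ?a ?b \<inter> \<int> \<times> \<int> = {?a, ?b}"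
          using primitive_segment_Ints[of "(int m, - int r)" "A k"] rm(3)
          unfolding step by (simp add: coprime_commute)
        finally show ?thesis by simp
      qed
    qed
    moreover have "e \<subseteq> rflip P p ` Gamma_of ?S \<inter> newton_polygon P"
    proof
      fix z assume "z \<in> e"
      then obtain y where y: "y \<in> closed_segment ?a ?b" "z = rflip P p y" unfolding e by blast
      have yT: "y \<in> ?T" using y(1) segT by blast
      have "y \<in> Gamma_of ?S"
      proof (rule mem_Gamma_of_face[where ?w1.0 = "real r" and ?w2.0 = "real m", OF _ _ yT])
        show "?w \<bullet> y > 0" using segN[OF y(1)] Npos by simp
        show "?w \<bullet> y \<le> ?w \<bullet> pt q" if "q \<in> ?S" for q using segN[OF y(1)] Nle[of "pt q"] that by simp
      qed (use rm in auto)
      moreover have "z \<in> newton_polygon P" unfolding mem_newton_polygon_rflip[of _ _ p] y(2) rflip_rflip by (rule yT)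
      ultimately show "z \<in> rflip P p ` Gamma_of ?S \<inter> newton_polygon P" using y(2) by blast
    qed
    ultimately have "e \<in> corner_edges P p" unfolding corner_edges_def by blast
    thus "e \<in> E" unfolding E_def k(2) using slope_prim_edge(2,3)[OF rm p] by simp
  qed
  have inj: "inj_on ?e {..<g}"
  proof (rule inj_onI)
    fix k l assume "prim_edge P p (A k) r m = prim_edge P p (A l) r m"
    hence "(A k = A l \<and> A (Suc k) = A (Suc l)) \<or> (A k = A (Suc l) \<and> A (Suc k) = A l)"
      unfolding prim_edge_def step rflip_closed_segment closed_segment_eq doubleton_eq_iff rflip_eq_iff rpt_inject .
    thus "k = l"
    proof
      assume "A k = A l \<and> A (Suc k) = A (Suc l)"
      thus ?thesis using rm by (auto simp: A_def)
    next
      assume "A k = A (Suc l) \<and> A (Suc k) = A l"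
      hence "int k * int m = int (Suc l) * int m" "int (Suc k) * int m = int l * int m"
        by (simp_all add: A_def)
      hence "int k = int (Suc l)" "int (Suc k) = int l" using rm(2) unfolding mult_cancel_right by simp_all
      thus ?thesis by simp
    qed
  qed
  show "finite E" unfolding E by simp
  show "card E = g" unfolding E card_image[OF inj] by simp
qed

section \<open>Nondegeneracy and the origin\<close>

lemma face_hull_inner:
  fixes \<alpha> \<beta> :: int
  assumes z: "z \<in> convex hull (pt ` face \<alpha> \<beta> S)" and s: "s \<in> face \<alpha> \<beta> S"
  shows "(real_of_int \<alpha>, real_of_int \<beta>) \<bullet> z = (real_of_int \<alpha>, real_of_int \<beta>) \<bullet> pt s"
proof -
  let ?w = "(real_of_int \<alpha>, real_of_int \<beta>)"
  have eq: "?w \<bullet> x = ?w \<bullet> pt s" if x: "x \<in> pt ` face \<alpha> \<beta> S" for x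
  proof -
    obtain q where q: "q \<in> face \<alpha> \<beta> S" "x = pt q" using x by blast
    have "\<alpha> * int (fst q) + \<beta> * int (snd q) = \<alpha> * int (fst s) + \<beta> * int (snd s)"
      using q(1) s unfolding face_def by (intro antisym) blast+
    hence "real_of_int (\<alpha> * int (fst q) + \<beta> * int (snd q)) = real_of_int (\<alpha> * int (fst s) + \<beta> * int (snd s))"
      by (simp only:)
    thus ?thesis unfolding q(2) by (simp add: pt_def inner_prod_def)
  qed
  have "?w \<bullet> pt s \<le> ?w \<bullet> z" by (rule convex_hull_inner_ge[OF z]) (simp only: eq order_refl)
  moreover have "- (?w \<bullet> pt s) \<le> (- ?w) \<bullet> z"
    by (rule convex_hull_inner_ge[OF z]) (simp only: inner_minus_left eq order_refl)
  ultimately show ?thesis by (simp only: inner_minus_left)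
qed

lemma face_inner_le:
  fixes \<alpha> \<beta> :: int
  assumes "s \<in> face \<alpha> \<beta> S" "q \<in> S"
  shows "(real_of_int \<alpha>, real_of_int \<beta>) \<bullet> pt s \<le> (real_of_int \<alpha>, real_of_int \<beta>) \<bullet> pt q"
proof -
  have "\<alpha> * int (fst s) + \<beta> * int (snd s) \<le> \<alpha> * int (fst q) + \<beta> * int (snd q)"
    using assms unfolding face_def by blast
  hence "real_of_int (\<alpha> * int (fst s) + \<beta> * int (snd s)) \<le> real_of_int (\<alpha> * int (fst q) + \<beta> * int (snd q))"
    by (simp only: of_int_le_iff)
  thus ?thesis by (simp add: pt_def inner_prod_def)
qed

lemma face_mem_iff:
  fixes \<alpha> \<beta> :: int
  assumes "s \<in> face \<alpha> \<beta> S"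
  shows "q \<in> face \<alpha> \<beta> S \<longleftrightarrow> q \<in> S \<and> (real_of_int \<alpha>, real_of_int \<beta>) \<bullet> pt q = (real_of_int \<alpha>, real_of_int \<beta>) \<bullet> pt s"
proof
  assume q: "q \<in> face \<alpha> \<beta> S"
  hence "pt q \<in> convex hull (pt ` face \<alpha> \<beta> S)" by (intro hull_inc imageI)
  from face_hull_inner[OF this assms] show "q \<in> S \<and> (real_of_int \<alpha>, real_of_int \<beta>) \<bullet> pt q = (real_of_int \<alpha>, real_of_int \<beta>) \<bullet> pt s"
    using subsetD[OF face_subset q] by blast
next
  assume q: "q \<in> S \<and> (real_of_int \<alpha>, real_of_int \<beta>) \<bullet> pt q = (real_of_int \<alpha>, real_of_int \<beta>) \<bullet> pt s"
  hence "real_of_int (\<alpha> * int (fst q) + \<beta> * int (snd q)) = real_of_int (\<alpha> * int (fst s) + \<beta> * int (snd s))"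
    by (simp add: pt_def inner_prod_def)
  hence "\<alpha> * int (fst q) + \<beta> * int (snd q) = \<alpha> * int (fst s) + \<beta> * int (snd s)"
    by (simp only: of_int_eq_iff)
  thus "q \<in> face \<alpha> \<beta> S" using q assms unfolding face_def by simp
qed

text \<open>A support point in the hull of a face has minimal weight, so the hull picks up no
  further monomials.\<close>

lemma face_poly_hull:
  assumes "s \<in> face \<alpha> \<beta> (msupp (cf P))"
  shows "face_poly P (convex hull (pt ` face \<alpha> \<beta> (msupp (cf P)))) x y =
    psum (face \<alpha> \<beta> (msupp (cf P))) (cf P) x y"
proof -
  let ?F = "face \<alpha> \<beta> (msupp (cf P))"
  have "{(i, j). cf P i j \<noteq> 0 \<and> (real i, real j) \<in> convex hull (pt ` ?F)} = ?F"
  proof (intro equalityI subsetI)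
    fix q assume "q \<in> {(i, j). cf P i j \<noteq> 0 \<and> (real i, real j) \<in> convex hull (pt ` ?F)}"
    hence q: "q \<in> msupp (cf P)" "pt q \<in> convex hull (pt ` ?F)" by (auto simp: msupp_def pt_def)
    show "q \<in> ?F" unfolding face_mem_iff[OF assms] using q(1) face_hull_inner[OF q(2) assms] by blast
  next
    fix q assume q: "q \<in> ?F"
    hence "pt q \<in> convex hull (pt ` ?F)" by (intro hull_inc imageI)
    moreover have "q \<in> msupp (cf P)" using subsetD[OF face_subset q] .
    ultimately show "q \<in> {(i, j). cf P i j \<noteq> 0 \<and> (real i, real j) \<in> convex hull (pt ` ?F)}"
      by (simp add: msupp_def pt_def case_prod_beta)
  qed
  thus ?thesis unfolding face_poly_def psum_def by (simp add: case_prod_beta)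
qed

text \<open>The face lies on a line whose primitive direction d is the reduced weight, rotated. Its
  hull is the segment between the extreme points, cut into unit edges. It is maximal because the
  weight form stays constant on any segment containing it.\<close>

lemma face_hull_maximal_edge:
  assumes \<alpha>\<beta>: "\<alpha> \<noteq> 0 \<or> \<beta> \<noteq> 0" and two: "s1 \<in> face \<alpha> \<beta> (msupp (cf P))" "s2 \<in> face \<alpha> \<beta> (msupp (cf P))" "s1 \<noteq> s2"
  shows "convex hull (pt ` face \<alpha> \<beta> (msupp (cf P))) \<in> maximal_edges P"
proof -
  let ?S = "msupp (cf P)"
  let ?F = "face \<alpha> \<beta> ?S"
  let ?H = "convex hull (pt ` ?F)"
  let ?w = "(real_of_int \<alpha>, real_of_int \<beta>)"
  have finF: "finite ?F" by (rule finite_subset[OF face_subset finite_msupp_cf])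
  define \<gamma> where "\<gamma> = gcd \<alpha> \<beta>"
  have \<gamma>: "\<gamma> \<noteq> 0" using \<alpha>\<beta> by (simp add: \<gamma>_def)
  obtain \<alpha>' \<beta>' where ab: "\<alpha> = \<alpha>' * \<gamma>" "\<beta> = \<beta>' * \<gamma>" "coprime \<alpha>' \<beta>'"
    using gcd_coprime_exists[of \<alpha> \<beta>] \<gamma> unfolding \<gamma>_def by blast
  define d where "d = (\<beta>', - \<alpha>')"
  have copd: "coprime (fst d) (snd d)" using ab(3) by (simp add: d_def coprime_commute)
  obtain x y where xy: "fst d * x + snd d * y = 1"
    using copd bezout_int[of "fst d" "snd d"] by (auto simp: coprime_iff_gcd_eq_1 mult.commute)
  \<comment> \<open>By Bezout \<kappa> increases by 1 along d, so it numbers the lattice points of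
    the line.\<close>
  define \<kappa> where "\<kappa> q = x * int (fst q) + y * int (snd q)" for q :: "nat \<times> nat"
  have line: "int (fst t) = int (fst s) + (\<kappa> t - \<kappa> s) * fst d" "int (snd t) = int (snd s) + (\<kappa> t - \<kappa> s) * snd d"
    if "s \<in> ?F" "t \<in> ?F" for s t
  proof -
    have "\<alpha> * int (fst s) + \<beta> * int (snd s) = \<alpha> * int (fst t) + \<beta> * int (snd t)"
      using that unfolding face_def by (intro antisym) blast+
    hence "\<gamma> * (\<alpha>' * (int (fst t) - int (fst s)) + \<beta>' * (int (snd t) - int (snd s))) = 0"
      unfolding ab(1,2) by (simp add: algebra_simps)
    hence "\<alpha>' * (int (fst t) - int (fst s)) + \<beta>' * (int (snd t) - int (snd s)) = 0"
      using \<gamma> unfolding mult_eq_0_iff by blast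
    hence par: "fst d * (int (snd t) - int (snd s)) = snd d * (int (fst t) - int (fst s))"
      by (simp add: d_def algebra_simps)
    have "(\<kappa> t - \<kappa> s) * fst d = x * fst d * (int (fst t) - int (fst s)) + y * (fst d * (int (snd t) - int (snd s)))"
      by (simp add: \<kappa>_def algebra_simps)
    also have "\<dots> = (fst d * x + snd d * y) * (int (fst t) - int (fst s))"
      unfolding par by (simp add: algebra_simps)
    finally show "int (fst t) = int (fst s) + (\<kappa> t - \<kappa> s) * fst d" unfolding xy by simp
    have "(\<kappa> t - \<kappa> s) * snd d = x * (snd d * (int (fst t) - int (fst s))) + y * snd d * (int (snd t) - int (snd s))"
      by (simp add: \<kappa>_def algebra_simps)
    also have "\<dots> = (fst d * x + snd d * y) * (int (snd t) - int (snd s))"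
      unfolding par[symmetric] by (simp add: algebra_simps)
    finally show "int (snd t) = int (snd s) + (\<kappa> t - \<kappa> s) * snd d" unfolding xy by simp
  qed
  have neF: "\<kappa> ` ?F \<noteq> {}" using two by blast
  have "Min (\<kappa> ` ?F) \<in> \<kappa> ` ?F" by (rule Min_in) (use finF neF in auto)
  then obtain s where s: "s \<in> ?F" "Min (\<kappa> ` ?F) = \<kappa> s" by (elim imageE) simp
  have smin: "\<kappa> s \<le> \<kappa> q" if "q \<in> ?F" for q unfolding s(2)[symmetric] using finF that by (intro Min_le) auto
  have "Max (\<kappa> ` ?F) \<in> \<kappa> ` ?F" by (rule Max_in) (use finF neF in auto)
  then obtain t where t: "t \<in> ?F" "Max (\<kappa> ` ?F) = \<kappa> t" by (elim imageE) simp
  have tmax: "\<kappa> q \<le> \<kappa> t" if "q \<in> ?F" for q unfolding t(2)[symmetric] using finF that by (intro Max_ge) auto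
  define g where "g = nat (\<kappa> t - \<kappa> s)"
  have g: "g > 0"
  proof (rule ccontr)
    assume "\<not> g > 0"
    hence "\<kappa> s1 = \<kappa> s2"
      using smin[OF two(1)] smin[OF two(2)] tmax[OF two(1)] tmax[OF two(2)] by (simp add: g_def)
    thus False using line[OF two(1,2)] two(3) by (simp add: prod_eq_iff)
  qed
  have gi: "int g = \<kappa> t - \<kappa> s" using g by (simp add: g_def)
  let ?A = "pt s" and ?D = "rpt d"
  have ptq: "pt q = ?A + of_int (\<kappa> q - \<kappa> s) *\<^sub>R ?D" if "q \<in> ?F" for q
  proof -
    have "real_of_int (int (fst q)) = real_of_int (int (fst s) + (\<kappa> q - \<kappa> s) * fst d)"
      "real_of_int (int (snd q)) = real_of_int (int (snd s) + (\<kappa> q - \<kappa> s) * snd d)"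
      using line[OF s(1) that] by simp_all
    thus ?thesis by (simp add: pt_def rpt_def)
  qed
  have pt_t: "pt t = ?A + real g *\<^sub>R ?D" unfolding ptq[OF t(1)] gi[symmetric] by simp
  have H: "?H = closed_segment ?A (?A + real g *\<^sub>R ?D)"
  proof (rule antisym)
    show "?H \<subseteq> closed_segment ?A (?A + real g *\<^sub>R ?D)"
    proof (rule hull_minimal)
      show "pt ` ?F \<subseteq> closed_segment ?A (?A + real g *\<^sub>R ?D)"
      proof (rule image_subsetI)
        fix q assume q: "q \<in> ?F"
        define k where "k = nat (\<kappa> q - \<kappa> s)"
        have k: "\<kappa> q - \<kappa> s = int k" "k \<le> g" using smin[OF q] tmax[OF q] by (simp_all add: k_def g_def)
        show "pt q \<in> closed_segment ?A (?A + real g *\<^sub>R ?D)"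
          unfolding ptq[OF q] k(1) mem_closed_segment_pair using k(2) g
          by (intro exI[of _ "real k / real g"]) (auto simp: prod_eq_iff)
      qed
    qed (rule convex_closed_segment)
    show "closed_segment ?A (?A + real g *\<^sub>R ?D) \<subseteq> ?H"
      unfolding pt_t[symmetric] using s(1) t(1)
      by (intro closed_segment_subset convex_convex_hull hull_inc imageI)
  qed
  let ?e = "\<lambda>k. closed_segment (?A + real k *\<^sub>R ?D) (?A + real (Suc k) *\<^sub>R ?D)"
  have Hun: "?H = \<Union> (?e ` {..<g})" unfolding H using closed_segment_subdivide[OF g] by blast
  have HN: "?w \<bullet> z = ?w \<bullet> ?A" if "z \<in> ?H" for z by (rule face_hull_inner[OF that s(1)])
  have Hsub: "?H \<subseteq> newton_polygon P" unfolding newton_polygon_eq by (intro hull_mono image_mono face_subset)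
  have Hfr: "?H \<subseteq> frontier (newton_polygon P)"
  proof
    fix z assume z: "z \<in> ?H"
    show "z \<in> frontier (newton_polygon P)"
      unfolding newton_polygon_eq
    proof (rule convex_hull_frontier)
      show "z \<in> convex hull (pt ` ?S)" using Hsub z unfolding newton_polygon_eq by blast
      show "?w \<noteq> 0" using \<alpha>\<beta> by (auto simp: prod_eq_iff)
      fix x assume "x \<in> pt ` ?S"
      thus "?w \<bullet> z \<le> ?w \<bullet> x" unfolding HN[OF z] using face_inner_le[OF s(1)] by blast
    qed
  qed
  have edge: "?e k \<in> edges P" if "k < g" for k
  proof -
    let ?a = "(int (fst s) + int k * fst d, int (snd s) + int k * snd d)"
    have a: "?A + real k *\<^sub>R ?D = rpt ?a" "?A + real (Suc k) *\<^sub>R ?D = rpt (?a + d)"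
      by (simp_all add: pt_def rpt_def algebra_simps)
    have "d \<noteq> 0" using copd by (auto simp: prod_eq_iff)
    hence "rpt ?a \<noteq> rpt (?a + d)" unfolding rpt_inject by simp
    moreover have "?e k \<subseteq> frontier (newton_polygon P)" using Hfr Hun that by blast
    moreover have "?e k \<inter> \<int> \<times> \<int> = {rpt ?a, rpt (?a + d)}"
      unfolding a by (rule primitive_segment_Ints[OF copd])
    ultimately show ?thesis unfolding edges_def a by blast
  qed
  have ne: "?A \<noteq> ?A + real g *\<^sub>R ?D"
    using g copd by (auto simp: rpt_def prod_eq_iff)
  have union: "edge_union_segment P ?H"
    unfolding edge_union_segment_def
  proof (intro conjI exI)
    show "?A \<noteq> ?A + real g *\<^sub>R ?D" by (rule ne)
    show "?H = closed_segment ?A (?A + real g *\<^sub>R ?D)" by (rule H)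
    show "?e ` {..<g} \<subseteq> edges P" using edge by blast
    show "?H = \<Union> (?e ` {..<g})" by (rule Hun)
  qed
  \<comment> \<open>An affine function on \<sigma> with equal values at two distinct points is
    constant, so \<sigma> lies in the minimal set of the form.\<close>
  have "\<sigma> \<subseteq> ?H" if \<sigma>: "edge_union_segment P \<sigma>" "?H \<subseteq> \<sigma>" for \<sigma>
  proof
    fix z assume z: "z \<in> \<sigma>"
    obtain a b where \<sigma>ab: "\<sigma> = closed_segment a b" using \<sigma>(1) unfolding edge_union_segment_def by blast
    have "\<sigma> \<subseteq> frontier (newton_polygon P)"
      using \<sigma>(1) unfolding edge_union_segment_def edges_def by blast
    moreover have "closed (newton_polygon P)"
      unfolding newton_polygon_eq
      by (intro compact_imp_closed compact_convex_hull finite_imp_compact finite_imageI finite_msupp_cf)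
    ultimately have \<sigma>N: "\<sigma> \<subseteq> newton_polygon P" unfolding frontier_def by (auto simp: closure_closed)
    have ends: "?A \<in> ?H" "?A + real g *\<^sub>R ?D \<in> ?H" unfolding H by simp_all
    obtain u1 where u1: "?A = (1 - u1) *\<^sub>R a + u1 *\<^sub>R b"
      using subsetD[OF \<sigma>(2) ends(1)] unfolding \<sigma>ab closed_segment_def by blast
    obtain u2 where u2: "?A + real g *\<^sub>R ?D = (1 - u2) *\<^sub>R a + u2 *\<^sub>R b"
      using subsetD[OF \<sigma>(2) ends(2)] unfolding \<sigma>ab closed_segment_def by blast
    have "u1 \<noteq> u2" using ne u1 u2 by auto
    have f: "?w \<bullet> ((1 - u) *\<^sub>R a + u *\<^sub>R b) = ?w \<bullet> a + u * (?w \<bullet> b - ?w \<bullet> a)" for u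
      by (simp only: inner_add_right inner_scaleR_right) (simp add: algebra_simps)
    have f1: "?w \<bullet> a + u1 * (?w \<bullet> b - ?w \<bullet> a) = ?w \<bullet> ?A"
      using f[of u1] unfolding u1[symmetric] by simp
    have "?w \<bullet> a + u2 * (?w \<bullet> b - ?w \<bullet> a) = ?w \<bullet> ?A"
      using f[of u2] HN[OF ends(2)] unfolding u2[symmetric] by simp
    hence "u1 * (?w \<bullet> b - ?w \<bullet> a) = u2 * (?w \<bullet> b - ?w \<bullet> a)" using f1 by linarith
    hence c: "?w \<bullet> b - ?w \<bullet> a = 0" using \<open>u1 \<noteq> u2\<close> unfolding mult_cancel_right by blast
    obtain u where u: "z = (1 - u) *\<^sub>R a + u *\<^sub>R b" using z unfolding \<sigma>ab closed_segment_def by blast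
    have wz: "?w \<bullet> z = ?w \<bullet> ?A" unfolding u f using f1 unfolding c by simp
    have "z \<in> convex hull {x \<in> pt ` ?S. ?w \<bullet> x = ?w \<bullet> ?A}"
    proof (rule mem_convex_hull_face[OF _ _ _ wz])
      show "finite (pt ` ?S)" by (intro finite_imageI finite_msupp_cf)
      show "z \<in> convex hull (pt ` ?S)" using \<sigma>N z unfolding newton_polygon_eq by blast
      show "?w \<bullet> ?A \<le> ?w \<bullet> x" if "x \<in> pt ` ?S" for x using that face_inner_le[OF s(1)] by blast
    qed
    also have "{x \<in> pt ` ?S. ?w \<bullet> x = ?w \<bullet> ?A} = pt ` ?F" using face_mem_iff[OF s(1)] by blast
    finally show "z \<in> ?H" .
  qed
  thus ?thesis unfolding maximal_edges_def using union by blast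
qed

text \<open>Faces are of three kinds: the whole polygon for the weight (0, 0), maximal edges, and
  vertices, where the face polynomial is a monomial without zeros in the torus.\<close>

lemma nondeg_cf_if_nondegenerate:
  assumes nd: "nondegenerate P" and ne: "msupp (cf P) \<noteq> {}"
  shows "nondeg (cf P)"
  unfolding nondeg_def
proof (intro allI impI notI)
  fix \<alpha> \<beta> :: int and x y :: complex
  let ?S = "msupp (cf P)"
  let ?F = "face \<alpha> \<beta> ?S"
  assume xy: "x \<noteq> 0" "y \<noteq> 0" and z: "psum ?F (cf P) x y = 0 \<and>
    psum ?F (\<lambda>i j. of_nat i * cf P i j) x y = 0 \<and> psum ?F (\<lambda>i j. of_nat j * cf P i j) x y = 0"
  let ?f = "\<lambda>q. \<alpha> * int (fst q) + \<beta> * int (snd q)"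
  have finF: "finite ?F" by (rule finite_subset[OF face_subset finite_msupp_cf])
  have "Min (?f ` ?S) \<in> ?f ` ?S" using finite_msupp_cf ne by (intro Min_in) auto
  then obtain s where s: "s \<in> ?S" "Min (?f ` ?S) = ?f s" by (elim imageE) simp
  have "?f s \<le> ?f q" if "q \<in> ?S" for q
    unfolding s(2)[symmetric] using finite_msupp_cf that by (intro Min_le) auto
  hence sF: "s \<in> ?F" using s(1) unfolding face_def by blast
  show False
  proof (cases "(\<alpha> = 0 \<and> \<beta> = 0) \<or> (\<exists>t\<in>?F. s \<noteq> t)")
    case True
    have mem: "convex hull (pt ` ?F) \<in> insert (newton_polygon P) (maximal_edges P)"
    proof (cases "\<alpha> = 0 \<and> \<beta> = 0")
      case True
      hence "?F = ?S" by (auto simp: face_def)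
      thus ?thesis unfolding newton_polygon_eq by simp
    next
      case False
      then obtain t where "t \<in> ?F" "s \<noteq> t" using True by blast
      thus ?thesis using face_hull_maximal_edge[OF _ sF] False by blast
    qed
    have "x * deriv (\<lambda>u. psum ?F (cf P) u y) x = 0" "y * deriv (\<lambda>v. psum ?F (cf P) x v) y = 0"
      unfolding deriv_psum_x[OF finF] deriv_psum_y[OF finF] using z by blast+
    hence der: "deriv (\<lambda>u. psum ?F (cf P) u y) x = 0" "deriv (\<lambda>v. psum ?F (cf P) x v) y = 0"
      using xy by simp_all
    have "\<not> (\<exists>x y. x \<noteq> 0 \<and> y \<noteq> 0 \<and> psum ?F (cf P) x y = 0 \<and>
        deriv (\<lambda>u. psum ?F (cf P) u y) x = 0 \<and> deriv (\<lambda>v. psum ?F (cf P) x v) y = 0)"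
      using bspec[OF nd[unfolded nondegenerate_def] mem] unfolding face_poly_hull[OF sF] .
    thus False
      by (elim notE) (intro exI[of _ x] exI[of _ y] conjI xy der conjunct1[OF z])
  next
    case False
    hence "\<forall>t\<in>?F. s = t" unfolding de_Morgan_disj bex_simps(8)[symmetric] by (elim conjE) simp
    hence eqs: "t \<in> ?F \<Longrightarrow> t = s" for t using bspec by metis
    have "?F = {s}"
    proof (intro equalityI subsetI)
      fix t assume "t \<in> ?F"
      thus "t \<in> {s}" unfolding singleton_iff by (rule eqs)
    next
      fix t assume "t \<in> {s}"
      thus "t \<in> ?F" unfolding singleton_iff using sF by (rule ssubst)
    qed
    hence "psum ?F (cf P) x y = cf P (fst s) (snd s) * x ^ fst s * y ^ snd s" by (simp add: psum_def)
    thus False using z xy s(1) by (simp add: msupp_def)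
  qed
qed

section \<open>Lattice points of the Newton diagram at the origin\<close>

lemma Gamma_of_quadrant: "z \<in> Gamma_of S \<Longrightarrow> 0 \<le> fst z \<and> 0 \<le> snd z"
proof -
  assume "z \<in> Gamma_of S"
  also have "Gamma_of S \<subseteq> closure ({0..} \<times> {0..})" unfolding Gamma_of_def by (intro closure_mono) blast
  also have "\<dots> = {0..} \<times> {0..}" by (intro closure_closed closed_Times) auto
  finally show ?thesis by (simp add: mem_Times_iff)
qed

text \<open>A quadrant point beyond the line through (a, 0) and (0, b) dominates some point of the
  segment between them and so lies in \<open>Gplus S\<close>.\<close>

lemma Gamma_of_triangle:
  assumes S: "(a, 0) \<in> S" "(0, b) \<in> S" and ab: "a > 0" "b > 0" and z: "z \<in> Gamma_of S"
  shows "real b * fst z + real a * snd z \<le> real a * real b"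
proof -
  let ?H = "{z. (real b, real a) \<bullet> z \<le> real a * real b}"
  have GS: "(real a, 0) \<in> Gplus S" "(0, real b) \<in> Gplus S"
    using S by (auto intro!: hull_inc bexI[of _ "(a, 0)"] bexI[of _ "(0, b)"])
  have "y \<in> ?H" if y: "y \<in> {0..} \<times> {0..} - Gplus S" for y
  proof (rule ccontr)
    assume n: "y \<notin> ?H"
    have y0: "0 \<le> fst y" "0 \<le> snd y" "y \<notin> Gplus S" using y by (auto simp: mem_Times_iff)
    have gt: "real b * fst y + real a * snd y > real a * real b" using n by (simp add: inner_prod_def)
    show False
    proof (cases "fst y \<ge> real a")
      case True
      hence "(real a, 0) + (y - (real a, 0)) \<in> Gplus S" using y0 by (intro Gplus_add[OF GS(1)]) auto
      thus False using y0(3) by simp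
    next
      case False
      let ?u = "fst y / real a"
      have u: "0 \<le> ?u" "?u \<le> 1" using False y0 ab by simp_all
      \<comment> \<open>The point of the segment with the same first coordinate as y.\<close>
      let ?v = "(1 - ?u) *\<^sub>R (0, real b) + ?u *\<^sub>R (real a, 0)"
      have v: "?v \<in> Gplus S" using u by (intro convexD[OF convex_convex_hull GS(2,1)]) auto
      have "?v + (y - ?v) \<in> Gplus S"
      proof (rule Gplus_add[OF v])
        show "fst (y - ?v) \<ge> 0" using ab by simp
        have "real a * ((1 - ?u) * real b) = real a * real b - real b * fst y"
          using ab by (simp add: field_simps)
        also have "\<dots> \<le> real a * snd y" using gt by linarith
        finally have "(1 - ?u) * real b \<le> snd y" using ab by simp
        thus "snd (y - ?v) \<ge> 0" by simp
      qed
      thus False using y0(3) by simp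
    qed
  qed
  hence "Gamma_of S \<subseteq> ?H"
    unfolding Gamma_of_def by (intro closure_minimal closed_halfspace_le) blast
  thus ?thesis using z by (auto simp: inner_prod_def)
qed

lemma frontier_square: "frontier (square P) = square P - {0<..<real (deg_x P)} \<times> {0<..<real (deg_y P)}"
proof -
  have "closed (square P)" unfolding square_def by (intro closed_Times) auto
  thus ?thesis unfolding frontier_def closure_closed square_def interior_Times interior_atLeastAtMost_real by simp
qed

text \<open>A constant term makes the diagram empty. Otherwise a linear term confines it to a
  triangle with a leg of length 1, whose lattice points are on the axes and hence on the frontier of
  the square. Without either, i + j \<ge> 2 on the support and (1, 1) is counted.\<close>

lemma lattice_count_Gamma_hat:
  assumes a: "cf P a 0 \<noteq> 0" and b: "cf P 0 b \<noteq> 0"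
  shows "lattice_count (Gamma_hat P) = 0 \<longleftrightarrow> cf P 0 0 \<noteq> 0 \<or> cf P 1 0 \<noteq> 0 \<or> cf P 0 1 \<noteq> 0"
proof -
  let ?S = "msupp (cf P)"
  have S: "(a, 0) \<in> ?S" "(0, b) \<in> ?S" using a b by (simp_all add: msupp_def)
  have le: "a \<le> deg_x P" "b \<le> deg_y P" using cf_nonzero_le[OF a] cf_nonzero_le[OF b] by simp_all
  show ?thesis
  proof (cases "cf P 0 0 = 0")
    case False
    hence "(0, 0) \<in> Gplus ?S" by (intro hull_inc) (auto simp: msupp_def intro!: bexI[of _ "(0, 0)"])
    hence "y \<in> Gplus ?S" if "y \<in> {0..} \<times> {0..}" for y
      using Gplus_add[of "(0, 0)" ?S y] that by (simp add: mem_Times_iff zero_prod_def[symmetric])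
    hence "{0..} \<times> {0..} - Gplus ?S = {}" by blast
    hence "Gamma P = {}" unfolding Gamma_eq Gamma_of_def by simp
    thus ?thesis using False by (simp add: Gamma_hat_def lattice_count_def)
  next
    case c00: True
    have ab: "a > 0" "b > 0" using a b c00 by (auto intro: gr0I)
    show ?thesis
    proof (cases "cf P 1 0 \<noteq> 0 \<or> cf P 0 1 \<noteq> 0")
      case True
      have "z \<in> frontier (square P)" if z: "z \<in> Gamma P" "z \<in> \<int> \<times> \<int>" for z
      proof -
        obtain q where q: "z = rpt q" using Ints_rpt[OF z(2)] .
        have zG: "z \<in> Gamma_of ?S" using z(1) unfolding Gamma_eq .
        have q0: "0 \<le> fst q" "0 \<le> snd q" using Gamma_of_quadrant[OF zG] by (simp_all add: q rpt_def)
        have tri: "int b' * fst q + int a' * snd q \<le> int a' * int b'"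
          if "(a', 0) \<in> ?S" "(0, b') \<in> ?S" "a' > 0" "b' > 0" for a' b'
        proof -
          have "real_of_int (int b' * fst q + int a' * snd q) \<le> real_of_int (int a' * int b')"
            using Gamma_of_triangle[OF that zG] by (simp add: q rpt_def)
          thus ?thesis by (simp only: of_int_le_iff)
        qed
        have t: "int b * fst q + int a * snd q \<le> int a * int b" by (rule tri[OF S ab])
        have ax: "fst q \<le> int a"
        proof -
          have "int b * fst q \<le> int b * int a" using t q0 ab by (smt (verit) mult.commute mult_nonneg_nonneg of_nat_0_le_iff)
          thus ?thesis using ab by simp
        qed
        have ay: "snd q \<le> int b"
        proof -
          have "int a * snd q \<le> int a * int b" using t q0 ab by (smt (verit) mult_nonneg_nonneg of_nat_0_le_iff)
          thus ?thesis using ab by simp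
        qed
        have axis: "fst q = 0 \<or> snd q = 0"
        proof (rule ccontr)
          assume "\<not> (fst q = 0 \<or> snd q = 0)"
          hence pos: "fst q \<ge> 1" "snd q \<ge> 1" using q0 by simp_all
          show False
          proof (cases "cf P 1 0 \<noteq> 0")
            case True
            hence "(1, 0) \<in> ?S" by (simp add: msupp_def)
            from tri[OF this S(2) _ ab(2)] have "int b * fst q + snd q \<le> int b" by simp
            moreover have "int b * 1 \<le> int b * fst q" by (rule mult_left_mono) (use pos in auto)
            ultimately show False using pos by linarith
          next
            case False
            hence "(0, 1) \<in> ?S" using \<open>cf P 1 0 \<noteq> 0 \<or> cf P 0 1 \<noteq> 0\<close> by (simp add: msupp_def)
            from tri[OF S(1) this ab(1)] have "fst q + int a * snd q \<le> int a" by simp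
            moreover have "int a * 1 \<le> int a * snd q" by (rule mult_left_mono) (use pos in auto)
            ultimately show False using pos by linarith
          qed
        qed
        show ?thesis unfolding frontier_square q using q0 ax ay axis le by (auto simp: square_def rpt_def)
      qed
      hence "Gamma_hat P \<inter> \<int> \<times> \<int> = {}" unfolding Gamma_hat_def by blast
      thus ?thesis using True by (simp add: lattice_count_def)
    next
      case False
      hence c: "cf P 1 0 = 0" "cf P 0 1 = 0" by simp_all
      \<comment> \<open>The axis monomials have exponents at least 2, which makes (1, 1) interior to
        the square.\<close>
      have deg2: "deg_x P \<ge> 2" "deg_y P \<ge> 2"
      proof -
        have "a \<noteq> 1" "b \<noteq> 1" using a b c by auto
        thus "deg_x P \<ge> 2" "deg_y P \<ge> 2" using ab le by linarith+
      qed
      have S2: "2 \<le> (1, 1) \<bullet> pt q" if "q \<in> ?S" for q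
      proof -
        have "q \<noteq> (0, 0)" "q \<noteq> (1, 0)" "q \<noteq> (0, 1)" using that c00 c by (auto simp: msupp_def)
        hence "fst q + snd q \<ge> 2" by (cases q) auto
        thus ?thesis by (simp add: pt_def inner_prod_def flip: of_nat_add)
      qed
      \<comment> \<open>The points (1 - t, 1 - t) have coordinate sum below 2, hence lie in the
        complement, and tend to (1, 1).\<close>
      have "(1, 1) \<in> Gamma_of ?S"
        unfolding Gamma_of_def closure_approachable
      proof (intro allI impI)
        fix e :: real assume e: "e > 0"
        define t where "t = min (1 / 2) (e / 4)"
        have t: "0 < t" "t < 1" "2 * t < e" using e by (auto simp: t_def)
        have "(1 - t, 1 - t) \<notin> Gplus ?S"
        proof
          assume "(1 - t, 1 - t) \<in> Gplus ?S"
          hence "2 \<le> (1, 1) \<bullet> (1 - t, 1 - t)" by (rule Gplus_inner_ge[rotated 2]) (use S2 in auto)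
          thus False using t by (simp add: inner_prod_def)
        qed
        moreover have "dist (1 - t, 1 - t) (1, 1) \<le> dist (1 - t) 1 + dist (1 - t) (1::real)"
          unfolding dist_Pair_Pair by (rule sqrt_sum_squares_le_sum) auto
        hence "dist (1 - t, 1 - t) (1, 1) < e" using t by (simp add: dist_real_def)
        ultimately show "\<exists>y\<in>{0..} \<times> {0..} - Gplus ?S. dist y (1, 1) < e"
          using t by (intro bexI[of _ "(1 - t, 1 - t)"]) auto
      qed
      hence mem: "(1, 1) \<in> Gamma_hat P \<inter> \<int> \<times> \<int>"
        unfolding Gamma_hat_def Gamma_eq frontier_square using deg2 by simp
      \<comment> \<open>\<open>card\<close> is 0 on infinite sets, so finiteness has to be known
        before (1, 1) refutes a zero count.\<close>
      have "finite (Gamma_hat P \<inter> \<int> \<times> \<int>)"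
      proof (rule finite_subset)
        show "Gamma_hat P \<inter> \<int> \<times> \<int> \<subseteq> rpt ` ({0..int a} \<times> {0..int b})"
        proof
          fix z assume z: "z \<in> Gamma_hat P \<inter> \<int> \<times> \<int>"
          hence zi: "z \<in> \<int> \<times> \<int>" by blast
          obtain q where q: "z = rpt q" using Ints_rpt[OF zi] .
          have zG: "z \<in> Gamma_of ?S" using z unfolding Gamma_hat_def Gamma_eq by blast
          have q0: "0 \<le> fst q" "0 \<le> snd q" using Gamma_of_quadrant[OF zG] by (simp_all add: q rpt_def)
          have "real_of_int (int b * fst q + int a * snd q) \<le> real_of_int (int a * int b)"
            using Gamma_of_triangle[OF S ab zG] by (simp add: q rpt_def)
          hence t: "int b * fst q + int a * snd q \<le> int a * int b" by (simp only: of_int_le_iff)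
          have "int b * fst q \<le> int b * int a" using t q0 ab by (smt (verit) mult.commute mult_nonneg_nonneg of_nat_0_le_iff)
          hence "fst q \<le> int a" using ab by simp
          moreover have "int a * snd q \<le> int a * int b" using t q0 ab by (smt (verit) mult_nonneg_nonneg of_nat_0_le_iff)
          hence "snd q \<le> int b" using ab by simp
          ultimately show "z \<in> rpt ` ({0..int a} \<times> {0..int b})"
            unfolding q using q0 by (intro imageI) (simp add: mem_Times_iff)
        qed
      qed simp
      hence "lattice_count (Gamma_hat P) \<noteq> 0" unfolding lattice_count_def using mem by (metis card_0_eq empty_iff)
      thus ?thesis using c00 c by simp
    qed
  qed
qed

section \<open>Global admissibility\<close>

text \<open>Glued from arbitrary bijections between the classes of equal key. It matches points with
  edges, which are compared only by their numbers for each pair (r, m).\<close>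

lemma bij_betw_by_key:
  assumes "\<And>k. finite {a \<in> A. f a = k}" "\<And>k. finite {b \<in> B. g b = k}"
    and "\<And>k. card {a \<in> A. f a = k} = card {b \<in> B. g b = k}"
  obtains \<phi> where "bij_betw \<phi> A B" "\<And>a. a \<in> A \<Longrightarrow> g (\<phi> a) = f a"
proof -
  have "\<forall>k. \<exists>h. bij_betw h {a \<in> A. f a = k} {b \<in> B. g b = k}"
    using finite_same_card_bij[OF assms] by blast
  then obtain h where h: "\<And>k. bij_betw (h k) {a \<in> A. f a = k} {b \<in> B. g b = k}" by metis
  define \<phi> where "\<phi> a = h (f a) a" for a
  have key: "\<phi> a \<in> B" "g (\<phi> a) = f a" if "a \<in> A" for a
    using bij_betwE[OF h[of "f a"]] that by (auto simp: \<phi>_def)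
  have "bij_betw \<phi> A B"
    unfolding bij_betw_def
  proof
    show "inj_on \<phi> A"
    proof (rule inj_onI)
      fix x y assume a: "x \<in> A" "y \<in> A" "\<phi> x = \<phi> y"
      hence "f x = f y" using key(2)[of x] key(2)[of y] by simp
      thus "x = y" using a bij_betw_imp_inj_on[OF h[of "f x"]] by (auto simp: \<phi>_def inj_on_def)
    qed
    show "\<phi> ` A = B"
    proof (intro equalityI subsetI)
      fix b assume b: "b \<in> B"
      have "b \<in> h (g b) ` {a \<in> A. f a = g b}" using bij_betw_imp_surj_on[OF h[of "g b"]] b by blast
      then obtain x where x: "x \<in> A" "f x = g b" "b = h (g b) x" by auto
      have "b = \<phi> x" unfolding \<phi>_def x(2) by (rule x(3))
      thus "b \<in> \<phi> ` A" using x(1) by blast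
    qed (use key in auto)
  qed
  thus ?thesis using that key(2) by blast
qed

section \<open>Comparison of edge conditions with point conditions\<close>

lemma corner_edges_0inf: "{e \<in> edges P. e \<subseteq> E_0inf P} = corner_edges P (Aff 0, Inf_pt)"
proof -
  have "cf (reflect_poly P) = lcoef P (Aff 0, Inf_pt)" by (intro ext) (rule cf_reflect_poly)
  hence "Gamma (reflect_poly P) = Gamma_of (msupp (lcoef P (Aff 0, Inf_pt)))" by (simp only: Gamma_eq)
  moreover have "(\<lambda>(i, j). (i, real (deg_y P) - j)) = rflip P (Aff 0, Inf_pt)"
    by (auto simp: rflip_def)
  ultimately show ?thesis unfolding corner_edges_def E_0inf_def Gamma_0inf_def by simp
qed

lemma corner_edges_inf0: "{e \<in> edges P. e \<subseteq> E_inf0 P} = corner_edges P (Inf_pt, Aff 0)"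
proof -
  have "cf (reflect_x P) = lcoef P (Inf_pt, Aff 0)" by (intro ext) (rule cf_reflect_x)
  hence "Gamma (reflect_x P) = Gamma_of (msupp (lcoef P (Inf_pt, Aff 0)))" by (simp only: Gamma_eq)
  moreover have "(\<lambda>(i, j). (real (deg_x P) - i, j)) = rflip P (Inf_pt, Aff 0)"
    by (auto simp: rflip_def)
  ultimately show ?thesis unfolding corner_edges_def E_inf0_def Gamma_inf0_def by simp
qed

text \<open>Common ground for the real quotients \<nu> and the rational slopes: inequalities of both
  kinds are reduced to the integers.\<close>

lemma of_int_divide_le_iff:
  assumes "b > 0" "d > 0"
  shows "(of_int a / of_int b :: 'a :: linordered_field) \<le> of_int c / of_int d \<longleftrightarrow> a * d \<le> c * b"
proof -
  have "(of_int a / of_int b :: 'a) \<le> of_int c / of_int d \<longleftrightarrow> (of_int a * of_int d :: 'a) \<le> of_int c * of_int b"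
    using assms by (simp add: pos_divide_le_eq pos_le_divide_eq)
  thus ?thesis by (simp flip: of_int_mult)
qed

text \<open>Here \<open>sbar\<close> is r - m, so the upper bound r + 1 is automatic, and r = m
  occurs only for r = 1.\<close>

lemma local_admissibility_0inf:
  fixes r m :: int
  assumes "r > 0" "m > 0" "r = m \<Longrightarrow> r = 1"
  shows "(r \<le> m \<or> c) \<longleftrightarrow> (r = 1 \<or> r - m \<le> -1 \<or> (r - m \<in> {1..r + 1} \<and> c))"
  using assms by (cases r m rule: linorder_cases) auto

text \<open>Here \<open>sbar\<close> is m - r, which may exceed r + 1. The point condition then
  fails unless r = 1, and the edge condition agrees because the congruence modulo so large a number
  forces r = 1; the hypotheses on c record this.\<close>

lemma local_admissibility_inf0:
  fixes r m :: int
  assumes "r > 0" "m > 0" "r = m \<Longrightarrow> r = 1" "r = 1 \<Longrightarrow> c" "c \<Longrightarrow> m - r > r + 1 \<Longrightarrow> r = 1"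
  shows "(m \<le> r \<or> c) \<longleftrightarrow> (r = 1 \<or> m - r \<le> -1 \<or> (m - r \<in> {1..r + 1} \<and> c))"
proof (cases r m rule: linorder_cases)
  case less
  thus ?thesis using assms by (cases "m - r > r + 1") auto
qed (use assms in auto)

context normalised_curve
begin

lemma corner_support:
  obtains a b where "(a, 0) \<in> msupp (lcoef P p)" "(0, b) \<in> msupp (lcoef P p)"
  using lcoef_axes[OF irr dx dy, of p] by (auto simp: msupp_def)

lemma corner_face:
  assumes "r > 0" "m > 0" "coprime r m"
  obtains i0 j0 g where "(i0, j0 + g * r) \<in> msupp (lcoef P p)" "(i0 + g * m, j0) \<in> msupp (lcoef P p)"
    "\<And>q. q \<in> face (int r) (int m) (msupp (lcoef P p)) \<longleftrightarrow>
       q \<in> msupp (lcoef P p) \<and> (\<exists>k\<le>g. q = (i0 + (g - k) * m, j0 + k * r))"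
    "card {w ^ r |w. w \<noteq> 0 \<and> blowup (lcoef P p) r m 0 w = 0} = g"
    "finite {w ^ r |w. w \<noteq> 0 \<and> blowup (lcoef P p) r m 0 w = 0}"
proof -
  obtain a b where "(a, 0) \<in> msupp (lcoef P p)" "(0, b) \<in> msupp (lcoef P p)" by (rule corner_support)
  hence ne: "msupp (lcoef P p) \<noteq> {}" by blast
  obtain i0 j0 g where f: "(i0, j0 + g * r) \<in> msupp (lcoef P p)" "(i0 + g * m, j0) \<in> msupp (lcoef P p)"
    "\<And>q. q \<in> face (int r) (int m) (msupp (lcoef P p)) \<longleftrightarrow>
       q \<in> msupp (lcoef P p) \<and> (\<exists>k\<le>g. q = (i0 + (g - k) * m, j0 + k * r))"
    by (rule face_points[OF finite_msupp_lcoef ne assms(3,1,2)]) (rule that)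
  show ?thesis
    by (rule that[OF f card_blowup_roots[OF nondeg_lcoef[OF nondeg_cf] finite_msupp_lcoef assms(1,2) f]])
qed

lemma corner_edge_slope:
  assumes e: "e \<in> corner_edges P p" and p: "(fst p = Inf_pt) \<noteq> (snd p = Inf_pt)"
  shows "slope e = of_int (edge_r e) / of_int (edge_k e)"
proof -
  obtain a0 b0 where supp: "(a0, 0) \<in> msupp (lcoef P p)" "(0, b0) \<in> msupp (lcoef P p)" by (rule corner_support)
  obtain a r m where rm: "r > 0" "m > 0" "coprime r m" "e = prim_edge P p a r m"
    by (rule corner_edge_form[OF e supp]) (rule that)
  show ?thesis unfolding rm(4) slope_prim_edge[OF rm(1-3) p] by simp
qed

text \<open>For each coprime pair (r, m) the number of points, the number of r-th powers of nonzero
  roots of the face polynomial and the number of primitive edges are all the lattice length g of the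
  same face.\<close>

lemma fibre_edges_bij:
  assumes corner: "fst p \<in> {Aff 0, Inf_pt}" "snd p \<in> {Aff 0, Inf_pt}" and p: "(fst p = Inf_pt) \<noteq> (snd p = Inf_pt)"
  obtains \<phi> where "inj_on \<phi> (fibre p)" "corner_edges P p = \<phi> ` fibre p"
    "\<And>q. q \<in> fibre p \<Longrightarrow> edge_r (\<phi> q) = int (ram S q)"
    "\<And>q. q \<in> fibre p \<Longrightarrow> edge_k (\<phi> q) = int (ymult q)"
    "\<And>q. q \<in> fibre p \<Longrightarrow> slope (\<phi> q) = of_int (int (ram S q)) / of_int (int (ymult q))"
proof -
  obtain a0 b0 where supp: "(a0, 0) \<in> msupp (lcoef P p)" "(0, b0) \<in> msupp (lcoef P p)" by (rule corner_support)
  let ?f = "\<lambda>q. (int (ram S q), int (ymult q))" and ?g = "\<lambda>e. (edge_r e, edge_k e)"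
  have key: "finite {q \<in> fibre p. ?f q = k} \<and> finite {e \<in> corner_edges P p. ?g e = k} \<and>
      card {q \<in> fibre p. ?f q = k} = card {e \<in> corner_edges P p. ?g e = k}" for k
  proof (cases "\<exists>r m. r > 0 \<and> m > 0 \<and> coprime r m \<and> k = (int r, int m)")
    case True
    then obtain r m where rm: "r > 0" "m > 0" "coprime r m" and k: "k = (int r, int m)" by blast
    obtain i0 j0 g where f: "(i0, j0 + g * r) \<in> msupp (lcoef P p)" "(i0 + g * m, j0) \<in> msupp (lcoef P p)"
      "\<And>q. q \<in> face (int r) (int m) (msupp (lcoef P p)) \<longleftrightarrow>
         q \<in> msupp (lcoef P p) \<and> (\<exists>k\<le>g. q = (i0 + (g - k) * m, j0 + k * r))"
      "card {w ^ r |w. w \<noteq> 0 \<and> blowup (lcoef P p) r m 0 w = 0} = g"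
      "finite {w ^ r |w. w \<noteq> 0 \<and> blowup (lcoef P p) r m 0 w = 0}"
      by (rule corner_face[OF rm]) (rule that)
    note bij = fibre_roots_bij[OF corner rm]
    note E = corner_edges_direction[OF supp rm p f(1-3)]
    have 1: "{q \<in> fibre p. ?f q = k} = {q \<in> fibre p. ram S q = r \<and> ymult q = m}" by (auto simp: k)
    have 2: "{e \<in> corner_edges P p. ?g e = k} = {e \<in> corner_edges P p. edge_r e = int r \<and> edge_k e = int m}"
      by (auto simp: k)
    show ?thesis unfolding 1 2
      using E bij_betw_same_card[OF bij] bij_betw_finite[OF bij] f(4,5) by simp
  next
    \<comment> \<open>Keys that are not pairs of coprime positive numbers occur on neither
      side.\<close>
    case False
    have e1: "{q \<in> fibre p. ?f q = k} = {}"
      using False fibre_props(1-3)[OF _ corner] by blast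
    have e2: "{e \<in> corner_edges P p. ?g e = k} = {}"
    proof (rule ccontr)
      assume "{e \<in> corner_edges P p. ?g e = k} \<noteq> {}"
      then obtain e where e: "e \<in> corner_edges P p" "?g e = k" by blast
      obtain a r m where rm: "r > 0" "m > 0" "coprime r m" "e = prim_edge P p a r m"
        by (rule corner_edge_form[OF e(1) supp]) (rule that)
      have "k = (int r, int m)" using e(2) slope_prim_edge(2,3)[OF rm(1-3) p] rm(4) by simp
      thus False using False rm(1-3) by blast
    qed
    show ?thesis unfolding e1 e2 by simp
  qed
  obtain \<phi> where \<phi>: "bij_betw \<phi> (fibre p) (corner_edges P p)" "\<And>q. q \<in> fibre p \<Longrightarrow> ?g (\<phi> q) = ?f q"
    by (rule bij_betw_by_key[of "fibre p" ?f "corner_edges P p" ?g]) (use key in blast, use key in blast, use key in blast, rule that)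
  have im: "corner_edges P p = \<phi> ` fibre p" using bij_betw_imp_surj_on[OF \<phi>(1)] by simp
  show ?thesis
  proof (rule that[OF bij_betw_imp_inj_on[OF \<phi>(1)] im])
    show r: "edge_r (\<phi> q) = int (ram S q)" and k: "edge_k (\<phi> q) = int (ymult q)" if "q \<in> fibre p" for q
      using \<phi>(2)[OF that] by simp_all
    show "slope (\<phi> q) = of_int (int (ram S q)) / of_int (int (ymult q))" if "q \<in> fibre p" for q
      using corner_edge_slope[OF _ p, of "\<phi> q"] r[OF that] k[OF that] that unfolding im by simp
  qed
qed

definition fibre_admissible :: "P1 \<times> P1 \<Rightarrow> bool" where
  "fibre_admissible p \<longleftrightarrow> (\<forall>q\<in>fibre p. locally_admissible S q) \<and>
     (\<forall>q1\<in>fibre p. \<forall>q2\<in>fibre p. q1 \<noteq> q2 \<and> nu S q1 \<le> nu S q2 \<longrightarrow>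
        cond_C_i S q1 q2 \<or> cond_C_ii S q1 q2)"

text \<open>Non-resonance holds for all pairs over a singular point by
  \<open>fibre_non_resonant\<close>, so it drops out of the definition.\<close>

lemma globally_admissible_iff:
  "globally_admissible P \<eta> S \<longleftrightarrow> (\<forall>p\<in>singular_points P. p \<in> E' P \<and> fibre_admissible p)"
proof -
  have F: "{q \<in> topspace (surf_top (surf S)). \<eta> q = p} = fibre p" for p
    by (simp add: fibre_def compact_spectral_curve_def)
  have nr: "non_resonant S q1 q2" if "p \<in> singular_points P" "q1 \<in> fibre p" "q2 \<in> fibre p" "q1 \<noteq> q2" for p q1 q2
    by (rule fibre_non_resonant[OF that(2-4) singular_corner[OF that(1)]])
  show ?thesis
    unfolding globally_admissible_def Let_def F fibre_admissible_def using nr by blast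
qed

lemma nu_le_iff:
  assumes "ram S q1 > 0" "ram S q2 > 0"
  shows "nu S q1 \<le> nu S q2 \<longleftrightarrow> sbar S q1 * int (ram S q2) \<le> sbar S q2 * int (ram S q1)"
  using of_int_divide_le_iff[of "int (ram S q1)" "int (ram S q2)" "sbar S q1" "sbar S q2", where 'a = real] assms
  by (simp add: nu_def)

lemma cond_C_i_iff:
  assumes "ram S q1 > 0" "ram S q2 > 0"
  shows "cond_C_i S q1 q2 \<longleftrightarrow> (\<exists>k. 1 \<le> k \<and> k \<le> max (int (ram S q1)) (int (ram S q2)) - 1 \<and>
    sbar S q1 * k \<le> int (ram S q1) \<and> int (ram S q2) \<le> sbar S q2 * k)"
proof -
  have "(nu S q1 \<le> 1 / of_int k \<and> 1 / of_int k \<le> nu S q2) \<longleftrightarrow>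
      (sbar S q1 * k \<le> int (ram S q1) \<and> int (ram S q2) \<le> sbar S q2 * k)" if "1 \<le> k" for k
    using of_int_divide_le_iff[of "int (ram S q1)" k "sbar S q1" 1, where 'a = real]
      of_int_divide_le_iff[of k "int (ram S q2)" 1 "sbar S q2", where 'a = real] assms that
    by (simp add: nu_def)
  thus ?thesis unfolding cond_C_i_def of_nat_max by blast
qed

lemma cond_C_ii_iff:
  assumes "ram S q1 > 0" "ram S q2 > 0"
  shows "cond_C_ii S q1 q2 \<longleftrightarrow> sbar S q1 * max (int (ram S q1)) (int (ram S q2)) \<le> int (ram S q1)"
proof -
  have "of_nat (max (ram S q1) (ram S q2)) = real_of_int (max (int (ram S q1)) (int (ram S q2)))"
    by (simp add: max_def)
  thus ?thesis
    using of_int_divide_le_iff[of "int (ram S q1)" "max (int (ram S q1)) (int (ram S q2))" "sbar S q1" 1, where 'a = real] assms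
    unfolding cond_C_ii_def nu_def by (simp add: less_max_iff_disj)
qed

text \<open>At this corner \<nu> = 1 - m/r = 1 - 1/slope, an increasing function of the slope.
  Comparing \<nu> with 1/k thus amounts to comparing 1/slope with (k - 1)/k, which explains the form
  of the edge conditions.\<close>

lemma fibre_admissible_0inf: "fibre_admissible (Aff 0, Inf_pt) \<longleftrightarrow> globally_admissible_0inf P"
proof -
  let ?p = "(Aff 0, Inf_pt)"
  have corner: "fst ?p \<in> {Aff 0, Inf_pt}" "snd ?p \<in> {Aff 0, Inf_pt}" and p: "(fst ?p = Inf_pt) \<noteq> (snd ?p = Inf_pt)"
    by simp_all
  obtain \<phi> where inj_\<phi>: "inj_on \<phi> (fibre ?p)" and im: "corner_edges P ?p = \<phi> ` fibre ?p"
    and er: "\<And>q. q \<in> fibre ?p \<Longrightarrow> edge_r (\<phi> q) = int (ram S q)"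
    and ek: "\<And>q. q \<in> fibre ?p \<Longrightarrow> edge_k (\<phi> q) = int (ymult q)"
    and sl: "\<And>q. q \<in> fibre ?p \<Longrightarrow> slope (\<phi> q) = of_int (int (ram S q)) / of_int (int (ymult q))"
    by (rule fibre_edges_bij[OF corner p]) (rule that)
  have inj: "\<phi> q1 \<noteq> \<phi> q2 \<longleftrightarrow> q1 \<noteq> q2" if "q1 \<in> fibre ?p" "q2 \<in> fibre ?p" for q1 q2
    using inj_on_eq_iff[OF inj_\<phi> that] by simp
  have pos: "ram S q > 0" "ymult q > 0" if "q \<in> fibre ?p" for q using fibre_props(1,2)[OF that corner] .
  have sb: "sbar S q = int (ram S q) - int (ymult q)" if "q \<in> fibre ?p" for q
    using fibre_props(6)[OF that corner] by (simp add: orient_def)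
  have slope_le: "slope (\<phi> q1) \<le> slope (\<phi> q2) \<longleftrightarrow> nu S q1 \<le> nu S q2" if "q1 \<in> fibre ?p" "q2 \<in> fibre ?p" for q1 q2
  proof -
    have "slope (\<phi> q1) \<le> slope (\<phi> q2) \<longleftrightarrow> int (ram S q1) * int (ymult q2) \<le> int (ram S q2) * int (ymult q1)"
      unfolding sl[OF that(1)] sl[OF that(2)]
      using pos[OF that(1)] pos[OF that(2)] by (intro of_int_divide_le_iff) auto
    thus ?thesis
      unfolding nu_le_iff[OF pos(1)[OF that(1)] pos(1)[OF that(2)]] sb[OF that(1)] sb[OF that(2)]
      by (simp add: algebra_simps)
  qed
  have slope1: "slope (\<phi> q) \<le> 1 \<longleftrightarrow> int (ram S q) \<le> int (ymult q)" if "q \<in> fibre ?p" for q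
    using of_int_divide_le_iff[of "int (ymult q)" 1 "int (ram S q)" 1, where 'a = rat] pos[OF that]
    unfolding sl[OF that] by simp
  have loc: "edge_loc_adm_0inf (\<phi> q) \<longleftrightarrow> locally_admissible S q" if q: "q \<in> fibre ?p" for q
  proof -
    have 1: "int (ram S q) = int (ymult q) \<Longrightarrow> int (ram S q) = 1" using fibre_props(3)[OF q corner] by simp
    have p0: "int (ram S q) > 0" "int (ymult q) > 0" "ram S q = 1 \<longleftrightarrow> int (ram S q) = 1"
      using pos[OF q] by simp_all
    show ?thesis
      unfolding edge_loc_adm_0inf_def edge_sbar_0inf_def slope1[OF q] locally_admissible_iff[OF q corner] sb[OF q]
        er[OF q] ek[OF q] p0(3)
      by (rule local_admissibility_0inf[OF p0(1,2) 1])
  qed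
  have glob: "globalisable_0inf (\<phi> q1) (\<phi> q2) \<longleftrightarrow> cond_C_i S q1 q2 \<or> cond_C_ii S q1 q2"
    if q: "q1 \<in> fibre ?p" "q2 \<in> fibre ?p" for q1 q2
  proof -
    let ?r1 = "int (ram S q1)" and ?r2 = "int (ram S q2)" and ?m1 = "int (ymult q1)" and ?m2 = "int (ymult q2)"
    let ?R = "max ?r1 ?r2"
    have ps: "?r1 > 0" "?r2 > 0" "?m1 > 0" "?m2 > 0" using pos q by auto
    have A: "(1 / slope (\<phi> q2) \<le> (of_int k - 1) / of_int k) \<longleftrightarrow> ?r2 \<le> (?r2 - ?m2) * k" if "k > 0" for k
      using of_int_divide_le_iff[of ?r2 k ?m2 "k - 1", where 'a = rat] ps that
      unfolding sl[OF q(2)] by (simp add: algebra_simps)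
    have B: "((of_int k - 1) / of_int k \<le> 1 / slope (\<phi> q1)) \<longleftrightarrow> (?r1 - ?m1) * k \<le> ?r1" if "k > 0" for k
      using of_int_divide_le_iff[of k ?r1 "k - 1" ?m1, where 'a = rat] ps that
      unfolding sl[OF q(1)] by (simp add: algebra_simps)
    have R: "max (edge_r (\<phi> q1)) (edge_r (\<phi> q2)) = ?R" using er q by simp
    have "globalisable_0inf (\<phi> q1) (\<phi> q2) \<longleftrightarrow>
      (?r1 > ?m1 \<and> (\<exists>k\<in>{2..?R - 1}. ?r2 \<le> (?r2 - ?m2) * k \<and> (?r1 - ?m1) * k \<le> ?r1)) \<or>
      (?r1 > ?m1 \<and> (?r1 - ?m1) * ?R \<le> ?r1) \<or> ?r1 \<le> ?m1"
    proof -
      have "(\<exists>k\<in>{2..?R - 1}. 1 / slope (\<phi> q2) \<le> (of_int k - 1) / of_int k \<and> (of_int k - 1) / of_int k \<le> 1 / slope (\<phi> q1))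
        \<longleftrightarrow> (\<exists>k\<in>{2..?R - 1}. ?r2 \<le> (?r2 - ?m2) * k \<and> (?r1 - ?m1) * k \<le> ?r1)"
        using A B by (intro bex_cong refl) auto
      moreover have "1 / slope (\<phi> q1) \<ge> (of_int ?R - 1) / of_int ?R \<longleftrightarrow> (?r1 - ?m1) * ?R \<le> ?r1"
        by (rule B) (use ps in auto)
      moreover have "1 < slope (\<phi> q1) \<longleftrightarrow> ?r1 > ?m1" using slope1[OF q(1)] by (simp only: not_le[symmetric])
      ultimately show ?thesis unfolding globalisable_0inf_def Let_def R slope1[OF q(1)] by simp
    qed
    also have "\<dots> \<longleftrightarrow> cond_C_i S q1 q2 \<or> cond_C_ii S q1 q2"
    proof -
      \<comment> \<open>The value k = 1, left out on the edge side, cannot occur on the point side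
        either: it would require \<open>ymult q2 \<le> 0\<close>.\<close>
      have 1: "(\<exists>k\<in>{2..?R - 1}. ?r2 \<le> (?r2 - ?m2) * k \<and> (?r1 - ?m1) * k \<le> ?r1) \<longleftrightarrow> cond_C_i S q1 q2"
        unfolding cond_C_i_iff[OF pos(1)[OF q(1)] pos(1)[OF q(2)]] sb[OF q(1)] sb[OF q(2)]
      proof
        assume "\<exists>k. 1 \<le> k \<and> k \<le> ?R - 1 \<and> (?r1 - ?m1) * k \<le> ?r1 \<and> ?r2 \<le> (?r2 - ?m2) * k"
        then obtain k where k: "1 \<le> k" "k \<le> ?R - 1" "(?r1 - ?m1) * k \<le> ?r1" "?r2 \<le> (?r2 - ?m2) * k" by blast
        have "k \<noteq> 1" using k(4) ps by auto
        thus "\<exists>k\<in>{2..?R - 1}. ?r2 \<le> (?r2 - ?m2) * k \<and> (?r1 - ?m1) * k \<le> ?r1"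
          using k by (intro bexI[of _ k]) auto
      next
        assume "\<exists>k\<in>{2..?R - 1}. ?r2 \<le> (?r2 - ?m2) * k \<and> (?r1 - ?m1) * k \<le> ?r1"
        then obtain k where "k \<in> {2..?R - 1}" "?r2 \<le> (?r2 - ?m2) * k" "(?r1 - ?m1) * k \<le> ?r1" by blast
        thus "\<exists>k. 1 \<le> k \<and> k \<le> ?R - 1 \<and> (?r1 - ?m1) * k \<le> ?r1 \<and> ?r2 \<le> (?r2 - ?m2) * k"
          by (intro exI[of _ k]) auto
      qed
      have 2: "(?r1 - ?m1) * ?R \<le> ?r1 \<longleftrightarrow> cond_C_ii S q1 q2"
        unfolding cond_C_ii_iff[OF pos(1)[OF q(1)] pos(1)[OF q(2)]] sb[OF q(1)] ..
      \<comment> \<open>A nonpositive \<nu> satisfies (C-ii), matching the unconditional case of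
        slope at most 1.\<close>
      have 3: "cond_C_ii S q1 q2" if "?r1 \<le> ?m1"
      proof -
        have "(?r1 - ?m1) * ?R \<le> 0" using that ps by (intro mult_nonpos_nonneg) auto
        thus ?thesis using 2 ps by simp
      qed
      show ?thesis unfolding 1 2 using 3 by (cases "?r1 \<le> ?m1") auto
    qed
    finally show ?thesis .
  qed
  show ?thesis
    unfolding fibre_admissible_def globally_admissible_0inf_def Let_def corner_edges_0inf im ball_simps(9)
    using loc glob slope_le inj by (intro conj_cong ball_cong refl) (simp_all cong: ball_cong)
qed

text \<open>A divisor of the positive number r + 1 cannot exceed it, and for r < s the residue 1
  means r = 1.\<close>

lemma cong_pm1_large:
  assumes "cong_pm1 r s" "r > 0" "s > r + 1"
  shows "r = 1"
  using assms(1) unfolding cong_pm1_def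
proof
  assume "[r = 1] (mod s)"
  thus ?thesis using assms by (simp add: cong_def)
next
  assume "[r = - 1] (mod s)"
  hence "s dvd r + 1" by (simp add: cong_iff_dvd_diff)
  thus ?thesis using assms zdvd_imp_le[of s "r + 1"] by simp
qed

text \<open>At this corner \<nu> = m/r - 1 = 1/slope - 1 decreases with the slope, so the labels of
  a pair are exchanged between edges and points.\<close>

lemma fibre_admissible_inf0: "fibre_admissible (Inf_pt, Aff 0) \<longleftrightarrow> globally_admissible_inf0 P"
proof -
  let ?p = "(Inf_pt, Aff 0)"
  have corner: "fst ?p \<in> {Aff 0, Inf_pt}" "snd ?p \<in> {Aff 0, Inf_pt}" and p: "(fst ?p = Inf_pt) \<noteq> (snd ?p = Inf_pt)"
    by simp_all
  obtain \<phi> where inj_\<phi>: "inj_on \<phi> (fibre ?p)" and im: "corner_edges P ?p = \<phi> ` fibre ?p"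
    and er: "\<And>q. q \<in> fibre ?p \<Longrightarrow> edge_r (\<phi> q) = int (ram S q)"
    and ek: "\<And>q. q \<in> fibre ?p \<Longrightarrow> edge_k (\<phi> q) = int (ymult q)"
    and sl: "\<And>q. q \<in> fibre ?p \<Longrightarrow> slope (\<phi> q) = of_int (int (ram S q)) / of_int (int (ymult q))"
    by (rule fibre_edges_bij[OF corner p]) (rule that)
  have inj: "\<phi> q1 \<noteq> \<phi> q2 \<longleftrightarrow> q1 \<noteq> q2" if "q1 \<in> fibre ?p" "q2 \<in> fibre ?p" for q1 q2
    using inj_on_eq_iff[OF inj_\<phi> that] by simp
  have pos: "ram S q > 0" "ymult q > 0" if "q \<in> fibre ?p" for q using fibre_props(1,2)[OF that corner] .
  have sb: "sbar S q = int (ymult q) - int (ram S q)" if "q \<in> fibre ?p" for q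
    using fibre_props(6)[OF that corner] by (simp add: orient_def)
  have slope_le: "slope (\<phi> q1) \<le> slope (\<phi> q2) \<longleftrightarrow> nu S q2 \<le> nu S q1" if "q1 \<in> fibre ?p" "q2 \<in> fibre ?p" for q1 q2
  proof -
    have "slope (\<phi> q1) \<le> slope (\<phi> q2) \<longleftrightarrow> int (ram S q1) * int (ymult q2) \<le> int (ram S q2) * int (ymult q1)"
      unfolding sl[OF that(1)] sl[OF that(2)]
      using pos[OF that(1)] pos[OF that(2)] by (intro of_int_divide_le_iff) auto
    thus ?thesis
      unfolding nu_le_iff[OF pos(1)[OF that(2)] pos(1)[OF that(1)]] sb[OF that(1)] sb[OF that(2)]
      by (simp add: algebra_simps)
  qed
  have slope1: "slope (\<phi> q) \<ge> 1 \<longleftrightarrow> int (ymult q) \<le> int (ram S q)" if "q \<in> fibre ?p" for q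
    using of_int_divide_le_iff[of 1 "int (ymult q)" 1 "int (ram S q)", where 'a = rat] pos[OF that]
    unfolding sl[OF that] by simp
  have loc: "edge_loc_adm_inf0 (\<phi> q) \<longleftrightarrow> locally_admissible S q" if q: "q \<in> fibre ?p" for q
  proof -
    have 1: "int (ram S q) = int (ymult q) \<Longrightarrow> int (ram S q) = 1" using fibre_props(3)[OF q corner] by simp
    have 2: "int (ram S q) = 1 \<Longrightarrow> cong_pm1 (int (ram S q)) (int (ymult q) - int (ram S q))"
      by (simp add: cong_pm1_def)
    have 3: "int (ram S q) = 1" if "cong_pm1 (int (ram S q)) (int (ymult q) - int (ram S q))"
        "int (ymult q) - int (ram S q) > int (ram S q) + 1"
      by (rule cong_pm1_large[OF that(1) _ that(2)]) (use pos[OF q] in simp)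
    have p0: "int (ram S q) > 0" "int (ymult q) > 0" "ram S q = 1 \<longleftrightarrow> int (ram S q) = 1"
      using pos[OF q] by simp_all
    show ?thesis
      unfolding edge_loc_adm_inf0_def edge_sbar_inf0_def slope1[OF q] locally_admissible_iff[OF q corner] sb[OF q]
        er[OF q] ek[OF q] p0(3)
      by (rule local_admissibility_inf0[OF p0(1,2) 1 2 3])
  qed
  have glob: "globalisable_inf0 (\<phi> q1) (\<phi> q2) \<longleftrightarrow> cond_C_i S q2 q1 \<or> cond_C_ii S q2 q1"
    if q: "q1 \<in> fibre ?p" "q2 \<in> fibre ?p" for q1 q2
  proof -
    let ?r1 = "int (ram S q1)" and ?r2 = "int (ram S q2)" and ?m1 = "int (ymult q1)" and ?m2 = "int (ymult q2)"
    let ?R = "max ?r1 ?r2"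
    have ps: "?r1 > 0" "?r2 > 0" "?m1 > 0" "?m2 > 0" using pos q by auto
    have A: "(1 / slope (\<phi> q2) \<le> (of_int k + 1) / of_int k) \<longleftrightarrow> (?m2 - ?r2) * k \<le> ?r2" if "k > 0" for k
      using of_int_divide_le_iff[of ?r2 k ?m2 "k + 1", where 'a = rat] ps that
      unfolding sl[OF q(2)] by (simp add: algebra_simps)
    have B: "((of_int k + 1) / of_int k \<le> 1 / slope (\<phi> q1)) \<longleftrightarrow> ?r1 \<le> (?m1 - ?r1) * k" if "k > 0" for k
      using of_int_divide_le_iff[of k ?r1 "k + 1" ?m1, where 'a = rat] ps that
      unfolding sl[OF q(1)] by (simp add: algebra_simps)
    have R: "max (edge_r (\<phi> q1)) (edge_r (\<phi> q2)) = ?R" using er q by simp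
    have s0: "0 < slope (\<phi> q1)" using ps unfolding sl[OF q(1)] by simp
    have "globalisable_inf0 (\<phi> q1) (\<phi> q2) \<longleftrightarrow>
      (?m2 > ?r2 \<and> (\<exists>k\<in>{1..?R - 1}. (?m2 - ?r2) * k \<le> ?r2 \<and> ?r1 \<le> (?m1 - ?r1) * k)) \<or>
      (?m2 > ?r2 \<and> (?m2 - ?r2) * ?R \<le> ?r2) \<or> ?m2 \<le> ?r2"
    proof -
      have "(\<exists>k\<in>{1..?R - 1}. 1 / slope (\<phi> q2) \<le> (of_int k + 1) / of_int k \<and> (of_int k + 1) / of_int k \<le> 1 / slope (\<phi> q1))
        \<longleftrightarrow> (\<exists>k\<in>{1..?R - 1}. (?m2 - ?r2) * k \<le> ?r2 \<and> ?r1 \<le> (?m1 - ?r1) * k)"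
        using A B by (intro bex_cong refl) auto
      moreover have "1 / slope (\<phi> q2) \<le> (of_int ?R + 1) / of_int ?R \<longleftrightarrow> (?m2 - ?r2) * ?R \<le> ?r2"
        by (rule A) (use ps in auto)
      moreover have "slope (\<phi> q2) < 1 \<longleftrightarrow> ?m2 > ?r2" using slope1[OF q(2)] by (simp only: not_le[symmetric])
      ultimately show ?thesis unfolding globalisable_inf0_def Let_def R slope1[OF q(2)] using s0 by simp
    qed
    also have "\<dots> \<longleftrightarrow> cond_C_i S q2 q1 \<or> cond_C_ii S q2 q1"
    proof -
      have 1: "(\<exists>k\<in>{1..?R - 1}. (?m2 - ?r2) * k \<le> ?r2 \<and> ?r1 \<le> (?m1 - ?r1) * k) \<longleftrightarrow> cond_C_i S q2 q1"
        unfolding cond_C_i_iff[OF pos(1)[OF q(2)] pos(1)[OF q(1)]] sb[OF q(1)] sb[OF q(2)] max.commute[of ?r2]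
        by auto
      have 2: "(?m2 - ?r2) * ?R \<le> ?r2 \<longleftrightarrow> cond_C_ii S q2 q1"
        unfolding cond_C_ii_iff[OF pos(1)[OF q(2)] pos(1)[OF q(1)]] sb[OF q(2)] max.commute[of ?r2] ..
      have 3: "cond_C_ii S q2 q1" if "?m2 \<le> ?r2"
      proof -
        have "(?m2 - ?r2) * ?R \<le> 0" using that ps by (intro mult_nonpos_nonneg) auto
        thus ?thesis using 2 ps by simp
      qed
      show ?thesis unfolding 1 2 using 3 by (cases "?m2 \<le> ?r2") auto
    qed
    finally show ?thesis .
  qed
  \<comment> \<open>Renaming the bound points makes up for the exchanged labels.\<close>
  have pairs: "(\<forall>q1\<in>fibre ?p. \<forall>q2\<in>fibre ?p. q1 \<noteq> q2 \<and> nu S q1 \<le> nu S q2 \<longrightarrow> cond_C_i S q1 q2 \<or> cond_C_ii S q1 q2) \<longleftrightarrow>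
     (\<forall>q1\<in>fibre ?p. \<forall>q2\<in>fibre ?p. q1 \<noteq> q2 \<and> nu S q2 \<le> nu S q1 \<longrightarrow> cond_C_i S q2 q1 \<or> cond_C_ii S q2 q1)"
    by metis
  show ?thesis
    unfolding fibre_admissible_def globally_admissible_inf0_def Let_def corner_edges_inf0 im ball_simps(9) pairs
    using loc glob slope_le inj by (intro conj_cong ball_cong refl) (simp_all cong: ball_cong)
qed

text \<open>Both affine coordinates have poles here, so \<open>sbar\<close> = -(r + m) is negative,
  which gives local admissibility and (C-ii).\<close>

lemma fibre_admissible_infinf: "fibre_admissible (Inf_pt, Inf_pt)"
proof -
  let ?p = "(Inf_pt, Inf_pt)"
  have corner: "fst ?p \<in> {Aff 0, Inf_pt}" "snd ?p \<in> {Aff 0, Inf_pt}" by simp_all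
  have s: "sbar S q \<le> -1" "ram S q > 0" if "q \<in> fibre ?p" for q
    using fibre_props(1,2,6)[OF that corner] by (simp_all add: orient_def)
  have "cond_C_ii S q1 q2" if "q1 \<in> fibre ?p" "q2 \<in> fibre ?p" for q1 q2
  proof -
    have "sbar S q1 * max (int (ram S q1)) (int (ram S q2)) \<le> 0"
      using s[OF that(1)] by (intro mult_nonpos_nonneg) auto
    thus ?thesis unfolding cond_C_ii_iff[OF s(2)[OF that(1)] s(2)[OF that(2)]] by simp
  qed
  thus ?thesis unfolding fibre_admissible_def using locally_admissible_iff[OF _ corner] s by blast
qed

lemma corner_singular_iff:
  assumes corner: "fst p \<in> {Aff 0, Inf_pt}" "snd p \<in> {Aff 0, Inf_pt}"
  shows "p \<in> singular_points P \<longleftrightarrow> lcoef P p 0 0 = 0 \<and> lcoef P p 1 0 = 0 \<and> lcoef P p 0 1 = 0"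
proof -
  let ?C = "lcoef P p"
  note fin = finite_msupp_lcoef[of P p]
  have aff0: "aff (fst p) = 0" "aff (snd p) = 0" using corner by auto
  have v: "psum (msupp ?C) ?C 0 0 = ?C 0 0"
  proof -
    have "psum (msupp ?C) ?C 0 0 = (\<Sum>q\<in>msupp ?C. if q = (0, 0) then ?C 0 0 else 0)"
      unfolding psum_def by (intro sum.cong refl) (auto simp: prod_eq_iff power_0_left)
    thus ?thesis using fin by (simp add: msupp_def)
  qed
  have x: "deriv (\<lambda>u. psum (msupp ?C) ?C u 0) 0 = ?C 1 0"
  proof -
    have "deriv (\<lambda>u. psum (msupp ?C) ?C u 0) 0 = (\<Sum>q\<in>msupp ?C. if q = (1, 0) then ?C 1 0 else 0)"
      unfolding DERIV_imp_deriv[OF has_derivative_psum_x[OF fin]]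
    proof (intro sum.cong refl)
      fix q :: "nat \<times> nat"
      show "?C (fst q) (snd q) * (of_nat (fst q) * 0 ^ (fst q - 1)) * 0 ^ snd q = (if q = (1, 0) then ?C 1 0 else 0)"
        by (cases "fst q = 0"; cases "fst q = 1"; cases "snd q = 0") (auto simp: prod_eq_iff power_0_left)
    qed
    thus ?thesis using fin by (simp add: msupp_def)
  qed
  have y: "deriv (\<lambda>v. psum (msupp ?C) ?C 0 v) 0 = ?C 0 1"
  proof -
    have "deriv (\<lambda>v. psum (msupp ?C) ?C 0 v) 0 = (\<Sum>q\<in>msupp ?C. if q = (0, 1) then ?C 0 1 else 0)"
      unfolding DERIV_imp_deriv[OF has_derivative_psum_y[OF fin]]
    proof (intro sum.cong refl)
      fix q :: "nat \<times> nat"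
      show "?C (fst q) (snd q) * 0 ^ fst q * (of_nat (snd q) * 0 ^ (snd q - 1)) = (if q = (0, 1) then ?C 0 1 else 0)"
        by (cases "snd q = 0"; cases "snd q = 1"; cases "fst q = 0") (auto simp: prod_eq_iff power_0_left)
    qed
    thus ?thesis using fin by (simp add: msupp_def)
  qed
  show ?thesis
    unfolding singular_points_def proj_curve_def mem_Collect_eq aff0 local_equation_eq v x y by blast
qed

text \<open>Needed because the edge conditions are imposed whether or not the corner is singular.
  The fibre has at most one point. A constant or linear monomial in the support bounds the weight of
  the face from above, and as the face has positive lattice length this forces r = 1 or m = 1. In
  the latter case \<open>sbar\<close> is \<plusminus>(r - 1), and r is 1 modulo r - 1.\<close>

lemma fibre_admissible_smooth:
  assumes corner: "fst p \<in> {Aff 0, Inf_pt}" "snd p \<in> {Aff 0, Inf_pt}" and smooth: "p \<notin> singular_points P"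
    and p: "(fst p = Inf_pt) \<noteq> (snd p = Inf_pt)"
  shows "fibre_admissible p"
proof -
  let ?C = "lcoef P p" and ?S = "msupp (lcoef P p)"
  have "q1 = q2" if "q1 \<in> fibre p" "q2 \<in> fibre p" for q1 q2
    using inj_onD[OF inj, of q1 q2] that smooth by (simp add: fibre_def)
  moreover have "locally_admissible S q" if q: "q \<in> fibre p" for q
  proof -
    note F = fibre_props[OF q corner]
    obtain i0 j0 g where f: "(i0, j0 + g * ram S q) \<in> ?S" "(i0 + g * ymult q, j0) \<in> ?S"
      "\<And>s. s \<in> face (int (ram S q)) (int (ymult q)) ?S \<longleftrightarrow>
         s \<in> ?S \<and> (\<exists>k\<le>g. s = (i0 + (g - k) * ymult q, j0 + k * ram S q))"
      "card {w ^ ram S q |w. w \<noteq> 0 \<and> blowup ?C (ram S q) (ymult q) 0 w = 0} = g"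
      "finite {w ^ ram S q |w. w \<noteq> 0 \<and> blowup ?C (ram S q) (ymult q) 0 w = 0}"
      by (rule corner_face[OF F(1-3)]) (rule that)
    have "ylead q ^ ram S q \<in> {w ^ ram S q |w. w \<noteq> 0 \<and> blowup ?C (ram S q) (ymult q) 0 w = 0}"
      using F(4,5) by blast
    \<comment> \<open>The point itself provides a root of the face polynomial, so the face is not a
      vertex.\<close>
    hence g: "g \<ge> 1" using f(4,5) card_gt_0_iff[of "{w ^ ram S q |w. w \<noteq> 0 \<and> blowup ?C (ram S q) (ymult q) 0 w = 0}"] by auto
    have le: "wt (ram S q) (ymult q) s \<le> wt (ram S q) (ymult q) t"
      if "s \<in> face (int (ram S q)) (int (ymult q)) ?S" "t \<in> ?S" for s t
      using that wt_ord_le[OF finite_msupp_lcoef that(2)] unfolding face_eq_wt[OF finite_msupp_lcoef] by simp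
    have tf: "(i0 + g * ymult q, j0) \<in> face (int (ram S q)) (int (ymult q)) ?S"
      unfolding f(3) using f(2) by (intro conjI exI[of _ 0]) auto
    have "ram S q = 1 \<or> ymult q = 1"
    proof -
      consider "(0, 0) \<in> ?S" | "(1, 0) \<in> ?S" | "(0, 1) \<in> ?S"
        using smooth corner_singular_iff[OF corner] by (auto simp: msupp_def)
      thus ?thesis
      proof cases
        case 1
        have "ram S q * (g * ymult q) \<le> wt (ram S q) (ymult q) (i0 + g * ymult q, j0)"
          by (simp add: wt_def algebra_simps)
        also have "\<dots> \<le> 0" using le[OF tf 1] by (simp add: wt_def)
        finally show ?thesis using F(1,2) g by simp
      next
        case 2
        have "ram S q * (g * ymult q) \<le> wt (ram S q) (ymult q) (i0 + g * ymult q, j0)"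
          by (simp add: wt_def algebra_simps)
        also have "\<dots> \<le> ram S q * 1" using le[OF tf 2] by (simp add: wt_def)
        finally have "g * ymult q \<le> 1" using F(1) by simp
        moreover have "ymult q \<le> g * ymult q" using g by simp
        ultimately have "ymult q \<le> 1" by linarith
        thus ?thesis using F(2) by simp
      next
        case 3
        have "ymult q * (g * ram S q) \<le> wt (ram S q) (ymult q) (i0 + g * ymult q, j0)"
          by (simp add: wt_def algebra_simps)
        also have "\<dots> \<le> ymult q * 1" using le[OF tf 3] by (simp add: wt_def)
        finally have "g * ram S q \<le> 1" using F(2) by simp
        moreover have "ram S q \<le> g * ram S q" using g by simp
        ultimately have "ram S q \<le> 1" by linarith
        thus ?thesis using F(1) by simp
      qed
    qed
    moreover have "sbar S q \<in> {int (ram S q) - int (ymult q), int (ymult q) - int (ram S q)}"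
      using F(6) p corner by (auto simp: orient_def)
    moreover have "cong_pm1 (int (ram S q)) (int (ram S q) - 1)"
      by (simp add: cong_pm1_def cong_iff_dvd_diff)
    ultimately show ?thesis
      unfolding locally_admissible_iff[OF q corner] using F(1,2) by auto
  qed
  ultimately show ?thesis unfolding fibre_admissible_def by blast
qed

lemma origin_smooth_iff: "(Aff 0, Aff 0) \<notin> singular_points P \<longleftrightarrow> lattice_count (Gamma_hat P) = 0"
proof -
  have C: "lcoef P (Aff 0, Aff 0) i j = cf P i j" for i j
    using cf_nonzero_le[of P i j] by (auto simp: lcoef_def flip_def)
  obtain a b where ab: "cf P a 0 \<noteq> 0" "cf P 0 b \<noteq> 0"
    using lcoef_axes[OF irr dx dy, of "(Aff 0, Aff 0)"] unfolding C by blast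
  show ?thesis
    unfolding lattice_count_Gamma_hat[OF ab] using corner_singular_iff[of "(Aff 0, Aff 0)"] unfolding C by auto
qed

theorem globally_admissible_iff_Newton:
  "globally_admissible P \<eta> S \<longleftrightarrow>
    lattice_count (Gamma_hat P) = 0 \<and> globally_admissible_0inf P \<and> globally_admissible_inf0 P"
proof -
  have sub: "singular_points P \<subseteq> {(Aff 0, Aff 0), (Aff 0, Inf_pt), (Inf_pt, Aff 0), (Inf_pt, Inf_pt)}"
  proof
    fix p assume "p \<in> singular_points P"
    from singular_corner[OF this] show "p \<in> {(Aff 0, Aff 0), (Aff 0, Inf_pt), (Inf_pt, Aff 0), (Inf_pt, Inf_pt)}"
      by (cases p) auto
  qed
  have E: "p \<in> singular_points P \<Longrightarrow> p \<in> E' P \<longleftrightarrow> snd p = Inf_pt \<or> p = (Inf_pt, Aff 0)" for p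
    unfolding E'_def singular_points_def by (cases p) auto
  have "globally_admissible P \<eta> S \<longleftrightarrow> (Aff 0, Aff 0) \<notin> singular_points P \<and>
     ((Aff 0, Inf_pt) \<in> singular_points P \<longrightarrow> fibre_admissible (Aff 0, Inf_pt)) \<and>
     ((Inf_pt, Aff 0) \<in> singular_points P \<longrightarrow> fibre_admissible (Inf_pt, Aff 0))"
    (is "?L \<longleftrightarrow> ?R")
  proof
    assume L: ?L
    have "(Aff 0, Aff 0) \<notin> singular_points P"
    proof
      assume a: "(Aff 0, Aff 0) \<in> singular_points P"
      hence "(Aff 0, Aff 0) \<in> E' P" using L unfolding globally_admissible_iff by blast
      thus False unfolding E[OF a] by simp
    qed
    thus ?R using L unfolding globally_admissible_iff by blast
  next
    assume R: ?R
    show ?L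
      unfolding globally_admissible_iff
    proof
      fix p assume p: "p \<in> singular_points P"
      hence cs: "p = (Aff 0, Inf_pt) \<or> p = (Inf_pt, Aff 0) \<or> p = (Inf_pt, Inf_pt)" using sub R by blast
      hence "fibre_admissible p" using R p fibre_admissible_infinf by blast
      moreover have "p \<in> E' P" unfolding E[OF p] using cs by auto
      ultimately show "p \<in> E' P \<and> fibre_admissible p" by blast
    qed
  qed
  moreover have "fibre_admissible (Aff 0, Inf_pt)" if "(Aff 0, Inf_pt) \<notin> singular_points P"
    by (rule fibre_admissible_smooth[OF _ _ that]) simp_all
  moreover have "fibre_admissible (Inf_pt, Aff 0)" if "(Inf_pt, Aff 0) \<notin> singular_points P"
    by (rule fibre_admissible_smooth[OF _ _ that]) simp_all
  ultimately show ?thesis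
    unfolding origin_smooth_iff[symmetric] fibre_admissible_0inf[symmetric] fibre_admissible_inf0[symmetric] by blast
qed

end

theorem theorem4p24:
  fixes P :: "complex poly poly"
    and X :: "'a surface"
    and \<eta> :: "'a \<Rightarrow> P1 \<times> P1"
    and B :: "'a bidiff"
  assumes "irreducible P"
    and "deg_x P > 0" and "deg_y P > 0"
    and "nondegenerate P"
    and "normalisation P X \<eta>"
    and "fundamental_bidifferential X B"
  shows "globally_admissible P \<eta> (compact_spectral_curve X \<eta> B) \<longleftrightarrow>
    lattice_count (Gamma_hat P) = 0 \<and> globally_admissible_0inf P \<and> globally_admissible_inf0 P"
proof -
  \<comment> \<open>A nonempty support makes every face nonempty in the passage from
    \<open>nondegenerate\<close> to \<open>nondeg\<close>.\<close>
  obtain i where "cf P i 0 \<noteq> 0" using cf_y0[OF assms(1,2)] by blast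
  hence "(i, 0) \<in> msupp (cf P)" by (simp add: msupp_def)
  hence "nondeg (cf P)" by (intro nondeg_cf_if_nondegenerate[OF assms(4)]) blast
  then interpret normalised_curve P X \<eta> B
    using assms by unfold_locales
  show ?thesis by (rule globally_admissible_iff_Newton)
qed

end
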